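(* For an essentially ${\mathbb S}^1$-gapped $J$-unitary $T$, the signature $\mathrm{Sig}(T)$ is well defined, i.e. independent of the choice of the annulus width $h$, and it is a homotopy invariant: if $s\mapsto T_s$ is a norm-continuous path of essentially ${\mathbb S}^1$-gapped $J$-unitaries, then $s\mapsto\mathrm{Sig}(T_s)$ is constant.
   Context: ${\cal H}$ is a separable complex Hilbert space, ${\cal K}={\cal H}\oplus{\cal H}$, $J=\begin{pmatrix}{\bf 1}&0\\0&-{\bf 1}\end{pmatrix}$, ${\mathbb S}^1$ the unit circle. A bounded invertible $T$ is $J$-unitary if $T^*JT=J$; it is essentially ${\mathbb S}^1$-gapped if $\sigma_{\mathrm{ess}}(T)\cap{\mathbb S}^1=\emptyset$ (essential spectrum = spectrum minus isolated eigenvalues of finite algebraic multiplicity). For such $T$ choose $h>0$ such that the closed annulus ${\mathbb S}^1_h=\{z: e^{-h}\le|z|\le e^h\}$ contains only discrete spectrum of $T$ and no spectrum of $T$ lies on its boundary; let ${\cal E}_=$ be the (finite-dimensional) span of the generalized eigenspaces (ranges of Riesz projections) of all eigenvalues of $T$ in ${\mathbb S}^1_h$. With $\Phi_=$ a frame for ${\cal E}_=$ (an isometry onto ${\cal E}_=$), let $\nu_\pm({\cal E}_=)$ be the number of positive/negative eigenvalues of the Hermitian matrix $\Phi_=^*J\Phi_=$. The signature is $\mathrm{Sig}(T)=\nu_+({\cal E}_=)-\nu_-({\cal E}_=)$. *)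

theory Defs
  imports "HOL-Analysis.Analysis" "Jordan_Normal_Form.Char_Poly"
begin

class chilbert = banach +
  fixes scaleC :: "complex \<Rightarrow> 'a \<Rightarrow> 'a"
    and cinner :: "'a \<Rightarrow> 'a \<Rightarrow> complex"
  assumes scaleC_of_real: "scaleC (of_real r) x = scaleR r x"
    and scaleC_add_right: "scaleC c (x + y) = scaleC c x + scaleC c y"
    and scaleC_add_left: "scaleC (c + d) x = scaleC c x + scaleC d x"
    and scaleC_scaleC: "scaleC c (scaleC d x) = scaleC (c * d) x"
    and cinner_commute: "cinner x y = cnj (cinner y x)"
    and cinner_add_left: "cinner (x + y) z = cinner x z + cinner y z"
    and cinner_scaleC_left: "cinner (scaleC c x) y = cnj c * cinner x y"
    and cinner_norm: "cinner x x = complex_of_real ((norm x)\<^sup>2)"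

definition separable_space :: "'a::topological_space itself \<Rightarrow> bool" where
  "separable_space _ \<longleftrightarrow> (\<exists>D::'a set. countable D \<and> closure D = UNIV)"

text \<open>Elements of K are pairs; the norm of the product type is
sqrt(norm a ^ 2 + norm b ^ 2), i.e. the Hilbert norm of the direct sum.\<close>

definition scaleK :: "complex \<Rightarrow> 'h::chilbert \<times> 'h \<Rightarrow> 'h \<times> 'h" where
  "scaleK c v = (scaleC c (fst v), scaleC c (snd v))"

definition cinnerK :: "'h::chilbert \<times> 'h \<Rightarrow> 'h \<times> 'h \<Rightarrow> complex" where
  "cinnerK v w = cinner (fst v) (fst w) + cinner (snd v) (snd w)"

definition Jop :: "'h::chilbert \<times> 'h \<Rightarrow> 'h \<times> 'h" where
  "Jop v = (fst v, - snd v)"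

definition clinearK :: "('h::chilbert \<times> 'h \<Rightarrow> 'h \<times> 'h) \<Rightarrow> bool" where
  "clinearK T \<longleftrightarrow> (\<forall>x y. T (x + y) = T x + T y) \<and> (\<forall>c x. T (scaleK c x) = scaleK c (T x))"

definition boundedK :: "('h::chilbert \<times> 'h \<Rightarrow> 'h \<times> 'h) \<Rightarrow> bool" where
  "boundedK T \<longleftrightarrow> clinearK T \<and> (\<exists>C. \<forall>x. norm (T x) \<le> C * norm x)"

definition bounded_invertibleK :: "('h::chilbert \<times> 'h \<Rightarrow> 'h \<times> 'h) \<Rightarrow> bool" where
  "bounded_invertibleK T \<longleftrightarrow> boundedK T \<and>
     (\<exists>S. boundedK S \<and> T \<circ> S = id \<and> S \<circ> T = id)"

definition adjointK :: "('h::chilbert \<times> 'h \<Rightarrow> 'h \<times> 'h) \<Rightarrow> ('h \<times> 'h \<Rightarrow> 'h \<times> 'h)" where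
  "adjointK T = (SOME S. \<forall>x y. cinnerK (T x) y = cinnerK x (S y))"

definition J_unitary :: "('h::chilbert \<times> 'h \<Rightarrow> 'h \<times> 'h) \<Rightarrow> bool" where
  "J_unitary T \<longleftrightarrow> bounded_invertibleK T \<and> adjointK T \<circ> Jop \<circ> T = Jop"

definition opnormK :: "('h::chilbert \<times> 'h \<Rightarrow> 'h \<times> 'h) \<Rightarrow> real" where
  "opnormK T = (SUP x\<in>{x. norm x \<le> 1}. norm (T x))"

definition shiftK :: "('h::chilbert \<times> 'h \<Rightarrow> 'h \<times> 'h) \<Rightarrow> complex \<Rightarrow> ('h \<times> 'h \<Rightarrow> 'h \<times> 'h)" where
  "shiftK T z = (\<lambda>x. scaleK z x - T x)"

definition spectrumK :: "('h::chilbert \<times> 'h \<Rightarrow> 'h \<times> 'h) \<Rightarrow> complex set" where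
  "spectrumK T = {z. \<not> bounded_invertibleK (shiftK T z)}"

definition isolated_in_spectrum :: "('h::chilbert \<times> 'h \<Rightarrow> 'h \<times> 'h) \<Rightarrow> complex \<Rightarrow> bool" where
  "isolated_in_spectrum T mu \<longleftrightarrow> mu \<in> spectrumK T \<and>
     (\<exists>r>0. cball mu r \<inter> spectrumK T = {mu})"

text \<open>Riesz projection for the circle of radius r around mu:
  P v = (1 / (2 pi i)) \<ointegral> (z - T)^-1 v dz  with z = mu + r e^(it), dz = i r e^(it) dt.\<close>
definition riesz_proj_r :: "('h::chilbert \<times> 'h \<Rightarrow> 'h \<times> 'h) \<Rightarrow> complex \<Rightarrow> real \<Rightarrow> 'h \<times> 'h \<Rightarrow> 'h \<times> 'h" where
  "riesz_proj_r T mu r v = scaleR (1 / (2 * pi))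
     (integral {0..2*pi} (\<lambda>t. scaleK (of_real r * cis t) (inv_into UNIV (shiftK T (mu + of_real r * cis t)) v)))"

definition riesz_proj :: "('h::chilbert \<times> 'h \<Rightarrow> 'h \<times> 'h) \<Rightarrow> complex \<Rightarrow> 'h \<times> 'h \<Rightarrow> 'h \<times> 'h" where
  "riesz_proj T mu = riesz_proj_r T mu (SOME r. r > 0 \<and> cball mu r \<inter> spectrumK T = {mu})"

definition cspanK :: "('h::chilbert \<times> 'h) set \<Rightarrow> ('h \<times> 'h) set" where
  "cspanK S = {v. \<exists>F c. finite F \<and> F \<subseteq> S \<and> v = (\<Sum>x\<in>F. scaleK (c x) x)}"

definition cdimK_finite :: "('h::chilbert \<times> 'h) set \<Rightarrow> bool" where
  "cdimK_finite S \<longleftrightarrow> (\<exists>F. finite F \<and> S \<subseteq> cspanK F)"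

definition discrete_spectrumK :: "('h::chilbert \<times> 'h \<Rightarrow> 'h \<times> 'h) \<Rightarrow> complex set" where
  "discrete_spectrumK T = {mu. isolated_in_spectrum T mu \<and> cdimK_finite (range (riesz_proj T mu))}"

definition essential_spectrumK :: "('h::chilbert \<times> 'h \<Rightarrow> 'h \<times> 'h) \<Rightarrow> complex set" where
  "essential_spectrumK T = spectrumK T - discrete_spectrumK T"

definition ess_S1_gapped :: "('h::chilbert \<times> 'h \<Rightarrow> 'h \<times> 'h) \<Rightarrow> bool" where
  "ess_S1_gapped T \<longleftrightarrow> essential_spectrumK T \<inter> sphere 0 1 = {}"

definition annulus :: "real \<Rightarrow> complex set" where
  "annulus h = {z. exp (- h) \<le> norm z \<and> norm z \<le> exp h}"

definition admissible_width :: "('h::chilbert \<times> 'h \<Rightarrow> 'h \<times> 'h) \<Rightarrow> real \<Rightarrow> bool" where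
  "admissible_width T h \<longleftrightarrow> h > 0 \<and>
     spectrumK T \<inter> annulus h \<subseteq> discrete_spectrumK T \<and>
     spectrumK T \<inter> (sphere 0 (exp h) \<union> sphere 0 (exp (- h))) = {}"

definition E_eq :: "('h::chilbert \<times> 'h \<Rightarrow> 'h \<times> 'h) \<Rightarrow> real \<Rightarrow> ('h \<times> 'h) set" where
  "E_eq T h = cspanK (\<Union>mu\<in>spectrumK T \<inter> annulus h. range (riesz_proj T mu))"

text \<open>A frame of a finite dimensional subspace E: an orthonormal list spanning E
(equivalently, the columns of an isometry from C^n onto E).\<close>
definition is_frame :: "('h::chilbert \<times> 'h) set \<Rightarrow> ('h \<times> 'h) list \<Rightarrow> bool" where
  "is_frame E \<Phi> \<longleftrightarrow> cspanK (set \<Phi>) = E \<and>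
     (\<forall>i<length \<Phi>. \<forall>j<length \<Phi>. cinnerK (\<Phi> ! i) (\<Phi> ! j) = (if i = j then 1 else 0))"

definition gram_J :: "('h::chilbert \<times> 'h) list \<Rightarrow> complex mat" where
  "gram_J \<Phi> = mat (length \<Phi>) (length \<Phi>) (\<lambda>(i, j). cinnerK (\<Phi> ! i) (Jop (\<Phi> ! j)))"

definition nu_pos :: "complex mat \<Rightarrow> nat" where
  "nu_pos M = (\<Sum>x\<in>{x::real. x > 0 \<and> poly (char_poly M) (of_real x) = 0}. order (of_real x) (char_poly M))"

definition nu_neg :: "complex mat \<Rightarrow> nat" where
  "nu_neg M = (\<Sum>x\<in>{x::real. x < 0 \<and> poly (char_poly M) (of_real x) = 0}. order (of_real x) (char_poly M))"

definition sig_frame :: "('h::chilbert \<times> 'h) list \<Rightarrow> int" where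
  "sig_frame \<Phi> = int (nu_pos (gram_J \<Phi>)) - int (nu_neg (gram_J \<Phi>))"

end

theory Submission
  imports Defs "Jordan_Normal_Form.Schur_Decomposition"
begin

text \<open>The generalized eigenspaces of T for eigenvalues on the unit circle span a finite-dimensional
space on which the form (x, y) \<mapsto> \<langle>x, J y\<rangle> is nondegenerate. In any larger finite-dimensional invariant
subspace the remaining eigenvalues contribute an orthogonal sum of two isotropic subspaces, one for
the eigenvalues inside the circle and one for those outside, and such a hyperbolic summand has
signature zero. Hence the signature of every finite-dimensional invariant subspace containing the unit
generalized eigenvectors is that of their span, whatever the annulus. For a nearby T' such a subspace is
spanned by the ranges of the Riesz projections of T' along small circles around the unit eigenvalues of
T. It has no larger dimension than the span for T and contains perturbed positive and negative definite
subspaces of the old dimensions, so its inertia is the same and the signature is locally constant.\<close>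

text \<open>Everything rests on one pairing rule: as \<open>T\<close> preserves the form,
  generalized eigenvectors for \<nu> and \<mu> are J-orthogonal unless cnj \<nu> * \<mu> = 1. Off
  the circle an eigenvalue pairs only with its reflection, on the circle only with itself. This rule
  does not give nondegeneracy, since the complement of the unit eigenspace may be
  infinite-dimensional and need not be spanned by generalized eigenvectors; there the equation (T -
  \<mu>) u = w is solved inside the kernel of the Riesz projection instead. The obstacle to homotopy
  invariance is that unit eigenvalues may split and leave the circle, so the unit eigenspace can
  jump. Persistence of definite subspaces yields only lower bounds for the inertia of the comparison
  space; they are attained because nondegeneracy makes the positive and negative counts for
  \<open>T\<close> add up to the dimension that bounds that space from above. Riesz projections come
  with an arbitrary radius. Once a finite-dimensional range is identified with an algebraic
  generalized eigenspace, this choice disappears.\<close>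

no_notation vec_nth (infixl \<open>$\<close> 90)
no_notation vector_scalar_mult (infixl \<open>*s\<close> 70)

section \<open>Unitary diagonalization of Hermitian matrices\<close>

lemma mat_adjoint_eq:
  "mat_adjoint U = mat (dim_col U) (dim_row U) (\<lambda>(i, j). conjugate (U $$ (j, i)))"
  by (rule eq_matI) (auto simp: mat_adjoint_def mat_of_rows_def)

lemma mat_adjoint_carrier [simp]:
  "U \<in> carrier_mat n m \<Longrightarrow> mat_adjoint U \<in> carrier_mat m n"
  by (auto simp: mat_adjoint_eq)

lemma mat_adjoint_mult:
  fixes X Y :: "complex mat"
  assumes X: "X \<in> carrier_mat n m" and Y: "Y \<in> carrier_mat m k"
  shows "mat_adjoint (X * Y) = mat_adjoint Y * mat_adjoint X"
  using assms
  by (intro eq_matI) (auto simp: mat_adjoint_eq scalar_prod_def cnj_sum mult.commute intro!: sum.cong)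

lemma mat_adjoint_adjoint:
  fixes X :: "complex mat"
  shows "mat_adjoint (mat_adjoint X) = X"
  by (intro eq_matI) (auto simp: mat_adjoint_eq)

lemma mat_adjoint_one: "mat_adjoint (1\<^sub>m n) = (1\<^sub>m n :: complex mat)"
  by (rule eq_matI) (auto simp: mat_adjoint_eq)

lemma mult_four_block_diag:
  assumes "A \<in> carrier_mat k k" "D \<in> carrier_mat n n" "A' \<in> carrier_mat k k" "D' \<in> carrier_mat n n"
  shows "four_block_mat A (0\<^sub>m k n) (0\<^sub>m n k) D * four_block_mat A' (0\<^sub>m k n) (0\<^sub>m n k) D'
    = four_block_mat (A * A') (0\<^sub>m k n) (0\<^sub>m n k) (D * (D' :: complex mat))"
  using mult_four_block_mat[OF assms(1) zero_carrier_mat zero_carrier_mat assms(2)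
      assms(3) zero_carrier_mat zero_carrier_mat assms(4)] assms
  by simp

lemma mat_adjoint_four_block_diag:
  fixes A D :: "complex mat"
  assumes A: "A \<in> carrier_mat k k" and D: "D \<in> carrier_mat n n"
  shows "mat_adjoint (four_block_mat A (0\<^sub>m k n) (0\<^sub>m n k) D)
    = four_block_mat (mat_adjoint A) (0\<^sub>m k n) (0\<^sub>m n k) (mat_adjoint D)"
proof (rule eq_matI, goal_cases)
  case (1 i j)
  then have "i < k + n" "j < k + n" using A D by (simp_all add: mat_adjoint_eq)
  then show ?case using A D by (cases "i < k"; cases "j < k"; simp add: mat_adjoint_eq)
qed (use A D in \<open>simp_all add: mat_adjoint_eq\<close>)

text \<open>Gram-Schmidt on a basis starting with \<open>v\<close> keeps \<open>v\<close> as its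
  first vector. Its output is orthogonal but not normalised, so the columns are divided by their
  norms; this is the factor \<alpha>.\<close>

lemma unitary_completion:
  fixes v :: "complex vec"
  assumes v: "v \<in> carrier_vec n" and v0: "v \<noteq> 0\<^sub>v n" and n: "0 < n"
  shows "\<exists>U \<alpha>. U \<in> carrier_mat n n \<and> mat_adjoint U * U = 1\<^sub>m n \<and> col U 0 = \<alpha> \<cdot>\<^sub>v v"
proof -
  interpret cof_vec_space n "TYPE(complex)" .
  define b where "b = basis_completion v"
  define ws where "ws = gram_schmidt n b"
  have b: "set b \<subseteq> carrier_vec n" "distinct b" "\<not> lin_dep (set b)" "hd b = v" "length b = n"
    using basis_completion[OF v v0] by (auto simp: b_def)
  then obtain vs where bv: "b = v # vs" using n by (cases b) auto
  note gs = gram_schmidt_result[OF b(1-3) ws_def]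
  have hdws: "hd ws = v" using gram_schmidt_hd[OF v, of vs] by (simp add: ws_def bv)
  have ws: "set ws \<subseteq> carrier_vec n" "corthogonal ws" "length ws = n" using gs b by auto
  have ws0: "ws ! 0 = v" using hdws ws(3) n by (cases ws) auto
  have dim: "dim_vec (ws ! j) = n" if "j < n" for j
    using ws(1,3) that by (metis carrier_vecD nth_mem subsetD)
  define N where "N j = sqrt (\<Sum>i<n. (cmod (ws ! j $ i))\<^sup>2)" for j
  have inner: "(\<Sum>i<n. ws ! k $ i * cnj (ws ! j $ i)) = ws ! k \<bullet>c ws ! j" if "j < n" "k < n" for j k
    using dim that by (auto simp: scalar_prod_def atLeast0LessThan)
  have diag: "(\<Sum>i<n. ws ! j $ i * cnj (ws ! j $ i)) = of_real ((N j)\<^sup>2)" for j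
    unfolding N_def by (simp add: sum_nonneg complex_norm_square[symmetric] del: of_real_power)
  have N0: "N j \<noteq> 0" if "j < n" for j
  proof
    assume "N j = 0"
    with diag[of j] inner[OF that that] have "ws ! j \<bullet>c ws ! j = 0" by simp
    with corthogonalD[OF ws(2)] ws(3) that show False by auto
  qed
  define U where "U = mat n n (\<lambda>(i, j). ws ! j $ i / of_real (N j))"
  have "mat_adjoint U * U = 1\<^sub>m n"
  proof (rule eq_matI)
    fix j k assume "j < dim_row (1\<^sub>m n :: complex mat)" "k < dim_col (1\<^sub>m n :: complex mat)"
    then have jk: "j < n" "k < n" by auto
    have "(mat_adjoint U * U) $$ (j, k) = (\<Sum>i<n. ws ! k $ i * cnj (ws ! j $ i)) / (of_real (N j) * of_real (N k))"
      using jk by (auto simp: U_def mat_adjoint_eq scalar_prod_def sum_divide_distrib mult_ac atLeast0LessThan intro!: sum.cong)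
    also have "\<dots> = (if j = k then 1 else 0)"
    proof (cases "j = k")
      case True
      then show ?thesis using diag[of k] N0[OF jk(2)] by (simp add: power2_eq_square)
    next
      case False
      then have "ws ! k \<bullet>c ws ! j = 0" using corthogonalD[OF ws(2)] ws(3) jk by auto
      then show ?thesis using False inner[OF jk] by simp
    qed
    finally show "(mat_adjoint U * U) $$ (j, k) = 1\<^sub>m n $$ (j, k)" using jk by simp
  qed (auto simp: U_def mat_adjoint_eq)
  moreover have "col U 0 = (1 / of_real (N 0)) \<cdot>\<^sub>v v"
    using n v by (intro eq_vecI) (auto simp: U_def ws0)
  ultimately show ?thesis unfolding U_def by (meson mat_carrier)
qed

text \<open>Deflation: an eigenvector is completed to a unitary matrix and the remaining block is
  treated by induction. The same list \<open>ds\<close> gives the diagonal and the factorisation of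
  the characteristic polynomial, because \<open>nu_pos\<close> and \<open>nu_neg\<close> count root
  multiplicities while inertia counts diagonal signs.\<close>

lemma hermitian_diagonalization:
  fixes A :: "complex mat"
  assumes "A \<in> carrier_mat n n" and "mat_adjoint A = A"
  shows "\<exists>U ds. U \<in> carrier_mat n n \<and> length ds = n \<and> U * mat_adjoint U = 1\<^sub>m n \<and>
           mat_adjoint U * A * U = mat n n (\<lambda>(i, j). if i = j then complex_of_real (ds ! i) else 0) \<and>
           char_poly A = (\<Prod>d\<leftarrow>ds. [:- complex_of_real d, 1:])"
  using assms
proof (induction n arbitrary: A)
  case 0
  then show ?case
    by (intro exI[of _ A] exI[of _ "[]"]) (auto simp: char_poly_def char_poly_matrix_def)
next
  case (Suc n A)
  note A = Suc.prems(1) and herm = Suc.prems(2)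
  have "\<not> constant (poly (char_poly A))"
    using degree_monic_char_poly[OF A] by (simp add: constant_degree)
  then obtain e where "poly (char_poly A) e = 0"
    using fundamental_theorem_of_algebra by blast
  then have "eigenvalue A e" using eigenvalue_root_char_poly[OF A] by simp
  then obtain v where v: "v \<in> carrier_vec (Suc n)" "v \<noteq> 0\<^sub>v (Suc n)" "A *\<^sub>v v = e \<cdot>\<^sub>v v"
    using A by (auto simp: eigenvalue_def eigenvector_def)
  obtain U \<alpha> where U: "U \<in> carrier_mat (Suc n) (Suc n)"
    and UU: "mat_adjoint U * U = 1\<^sub>m (Suc n)" and U0: "col U 0 = \<alpha> \<cdot>\<^sub>v v"
    using unitary_completion[OF v(1,2)] by auto
  have UH: "mat_adjoint U \<in> carrier_mat (Suc n) (Suc n)" using U by simp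
  have UU': "U * mat_adjoint U = 1\<^sub>m (Suc n)"
    using mat_mult_left_right_inverse[OF UH U UU] .
  define A' where "A' = mat_adjoint U * A * U"
  have A': "A' \<in> carrier_mat (Suc n) (Suc n)" unfolding A'_def by (intro mult_carrier_mat[OF mult_carrier_mat[OF UH A] U])
  have A'herm: "mat_adjoint A' = A'"
    unfolding A'_def mat_adjoint_mult[OF mult_carrier_mat[OF UH A] U] mat_adjoint_mult[OF UH A]
      mat_adjoint_adjoint herm
    by (simp only: assoc_mult_mat[OF UH A U])
  have col0: "col A' 0 = e \<cdot>\<^sub>v col (1\<^sub>m (Suc n)) 0"
  proof -
    have "col A' 0 = mat_adjoint U *\<^sub>v (A *\<^sub>v col U 0)"
      unfolding A'_def assoc_mult_mat[OF UH A U]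
      by (simp only: col_mult2[OF UH mult_carrier_mat[OF A U] zero_less_Suc] col_mult2[OF A U zero_less_Suc])
    also have "A *\<^sub>v col U 0 = e \<cdot>\<^sub>v col U 0"
      using A v by (simp add: U0 mult_mat_vec smult_smult_assoc mult.commute)
    also have "mat_adjoint U *\<^sub>v (e \<cdot>\<^sub>v col U 0) = e \<cdot>\<^sub>v (mat_adjoint U *\<^sub>v col U 0)"
      by (rule mult_mat_vec[OF UH]) (use U in \<open>simp add: carrier_vecI\<close>)
    also have "mat_adjoint U *\<^sub>v col U 0 = col (1\<^sub>m (Suc n)) 0"
      using col_mult2[OF UH U, of 0] by (simp add: UU)
    finally show ?thesis .
  qed
  have A'i0: "A' $$ (i, 0) = (if i = 0 then e else 0)" if "i < Suc n" for i
  proof -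
    have "A' $$ (i, 0) = col A' 0 $ i" using A' that by simp
    then show ?thesis using that unfolding col0 by simp
  qed
  have A'cnj: "A' $$ (i, j) = cnj (A' $$ (j, i))" if "i < Suc n" "j < Suc n" for i j
    using arg_cong[OF A'herm, of "\<lambda>M. M $$ (i, j)"] A' that by (simp add: mat_adjoint_eq)
  \<comment> \<open>Hermitian symmetry carries the zeros of the first column over to the first row;
    this is what splits the matrix into blocks.\<close>
  have A'0i: "A' $$ (0, i) = (if i = 0 then e else 0)" if "i < Suc n" for i
    using A'cnj[of 0 i] A'cnj[of 0 0] A'i0[of i] A'i0[of 0] that by auto
  have e_real: "e = of_real (Re e)"
    using A'cnj[of 0 0] A'i0[of 0] by (simp add: complex_eq_iff)
  define A3 where "A3 = mat n n (\<lambda>(i, j). A' $$ (Suc i, Suc j))"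
  have A3: "A3 \<in> carrier_mat n n" by (simp add: A3_def)
  have A3herm: "mat_adjoint A3 = A3"
    by (intro eq_matI) (simp_all add: A3_def mat_adjoint_eq A'cnj[symmetric])
  define E1 where "E1 = mat 1 1 (\<lambda>_. e)"
  have E1: "E1 \<in> carrier_mat 1 1" by (simp add: E1_def)
  have A'block: "A' = four_block_mat E1 (0\<^sub>m 1 n) (0\<^sub>m n 1) A3"
    using A' A'i0 A'0i by (intro eq_matI) (auto simp: E1_def A3_def)
  obtain V ds where V: "V \<in> carrier_mat n n" and ds: "length ds = n"
    and VV: "V * mat_adjoint V = 1\<^sub>m n"
    and VA: "mat_adjoint V * A3 * V = mat n n (\<lambda>(i, j). if i = j then complex_of_real (ds ! i) else 0)"
    and cp: "char_poly A3 = (\<Prod>d\<leftarrow>ds. [:- complex_of_real d, 1:])"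
    using Suc.IH[OF A3 A3herm] by blast
  have VH: "mat_adjoint V \<in> carrier_mat n n" using V by simp
  define V' where "V' = four_block_mat (1\<^sub>m 1) (0\<^sub>m 1 n) (0\<^sub>m n 1) V"
  have V': "V' \<in> carrier_mat (Suc n) (Suc n)" using four_block_carrier_mat[of "1\<^sub>m 1" 1 1 V n n "0\<^sub>m 1 n" "0\<^sub>m n 1"] V by (simp add: V'_def)
  have V'H: "mat_adjoint V' = four_block_mat (1\<^sub>m 1) (0\<^sub>m 1 n) (0\<^sub>m n 1) (mat_adjoint V)"
    unfolding V'_def using mat_adjoint_four_block_diag[OF _ V, of "1\<^sub>m 1" 1] by (simp add: mat_adjoint_one)
  have V'Hc: "mat_adjoint V' \<in> carrier_mat (Suc n) (Suc n)" using V' by simp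
  have "V' * mat_adjoint V' = four_block_mat (1\<^sub>m 1) (0\<^sub>m 1 n) (0\<^sub>m n 1) (1\<^sub>m n)"
    unfolding V'H unfolding V'_def by (subst mult_four_block_diag[OF _ V _ VH]) (simp_all add: VV)
  also have "\<dots> = 1\<^sub>m (Suc n)" by (rule eq_matI) auto
  finally have V'V': "V' * mat_adjoint V' = 1\<^sub>m (Suc n)" .
  have V'A': "mat_adjoint V' * A' * V' = four_block_mat E1 (0\<^sub>m 1 n) (0\<^sub>m n 1) (mat_adjoint V * A3 * V)"
    unfolding V'H A'block unfolding V'_def mult_four_block_diag[OF one_carrier_mat VH E1 A3]
    by (subst mult_four_block_diag[OF _ mult_carrier_mat[OF VH A3] _ V]) (use E1 in simp_all)
  define W where "W = U * V'"
  have W: "W \<in> carrier_mat (Suc n) (Suc n)" using U V' by (simp add: W_def)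
  have WH: "mat_adjoint W = mat_adjoint V' * mat_adjoint U"
    unfolding W_def by (rule mat_adjoint_mult[OF U V'])
  have WW: "W * mat_adjoint W = 1\<^sub>m (Suc n)"
    unfolding WH unfolding W_def
    by (simp only: assoc_mult_mat[OF U V' mult_carrier_mat[OF V'Hc UH]]
        assoc_mult_mat[OF V' V'Hc UH, symmetric] V'V' left_mult_one_mat[OF UH] UU')
  have UHA: "mat_adjoint U * A \<in> carrier_mat (Suc n) (Suc n)" using UH A by simp
  have "mat_adjoint W * A * W = mat_adjoint V' * A' * V'"
    unfolding WH A'_def unfolding W_def
    by (simp only: assoc_mult_mat[OF V'Hc UH A] assoc_mult_mat[OF V'Hc UHA mult_carrier_mat[OF U V']]
        assoc_mult_mat[OF UHA U V', symmetric] assoc_mult_mat[OF V'Hc mult_carrier_mat[OF UHA U] V', symmetric])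
  also have "\<dots> = mat (Suc n) (Suc n) (\<lambda>(i, j). if i = j then complex_of_real ((Re e # ds) ! i) else 0)"
    unfolding V'A' VA using e_real
    by (intro eq_matI) (auto simp: E1_def nth_Cons split: nat.splits)
  finally have WA: "mat_adjoint W * A * W = \<dots>" .
  have "similar_mat_wit A' A (mat_adjoint U) U"
    by (rule similar_mat_witI[of _ _ "Suc n"]) (use UU UU' A U UH A' in \<open>auto simp: A'_def\<close>)
  then have "char_poly A = char_poly A'"
    using char_poly_similar by (metis similar_mat_def)
  also have "\<dots> = char_poly E1 * char_poly A3"
    unfolding A'block by (rule char_poly_four_block_zeros_col[OF E1 _ A3]) simp
  also have "char_poly E1 = [:- complex_of_real (Re e), 1:]"
    using e_real by (simp add: E1_def char_poly_defs det_def sign_def)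
  finally have "char_poly A = (\<Prod>d\<leftarrow>Re e # ds. [:- complex_of_real d, 1:])"
    by (simp add: cp)
  with W WW WA ds show ?case
    by (intro exI[of _ W] exI[of _ "Re e # ds"]) auto
qed

lemma order_prod_linear:
  "Polynomial.order (complex_of_real x) (\<Prod>d\<leftarrow>ds. [:- complex_of_real d, 1:]) = count_list ds x"
proof (induction ds)
  case Nil
  then show ?case by (simp add: order_0I)
next
  case (Cons d ds)
  have 0: "(\<Prod>d\<leftarrow>ds. [:- complex_of_real d, 1:]) \<noteq> 0" by (auto simp: prod_list_zero_iff)
  have "Polynomial.order (complex_of_real x) [:- complex_of_real d, 1:] = (if x = d then 1 else 0)"
    using order_power_n_n[of "complex_of_real d" 1] by (auto intro!: order_0I)
  moreover have "[:- complex_of_real d, 1:] * (\<Prod>d\<leftarrow>ds. [:- complex_of_real d, 1:]) \<noteq> 0"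
    using 0 by (metis mult_eq_0_iff one_neq_zero pCons_eq_0_iff)
  ultimately show ?case using Cons.IH by (simp add: order_mult del: mult_pCons_left)
qed

text \<open>With \<open>P\<close> a sign condition, this turns the multiplicity sums in
  \<open>nu_pos\<close> and \<open>nu_neg\<close> into counts of diagonal entries.\<close>

lemma sum_order_prod_linear:
  assumes "cp = (\<Prod>d\<leftarrow>ds. [:- complex_of_real d, 1:])"
  shows "(\<Sum>x\<in>{x. P x \<and> poly cp (complex_of_real x) = 0}. Polynomial.order (complex_of_real x) cp)
    = card {i. i < length ds \<and> P (ds ! i)}"
proof -
  have "{x. P x \<and> poly cp (complex_of_real x) = 0} = set (filter P ds)"
    by (auto simp: assms poly_prod_list prod_list_zero_iff)
  then have "(\<Sum>x\<in>{x. P x \<and> poly cp (complex_of_real x) = 0}. Polynomial.order (complex_of_real x) cp)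
     = (\<Sum>x\<in>set (filter P ds). count_list (filter P ds) x)"
    unfolding assms order_prod_linear
    by (intro sum.cong) (auto simp: count_list_eq_length_filter conj_commute intro!: arg_cong[of _ _ length] filter_cong)
  then show ?thesis by (simp add: sum_count_set length_filter_conv_card)
qed

section \<open>Inertia of Hermitian forms\<close>

context vector_space begin

lemma independent_Un_disjoint_span:
  assumes X: "finite X" "independent X" and Y: "finite Y" "independent Y"
    and XY: "span X \<inter> span Y \<subseteq> {0}"
  shows "independent (X \<union> Y)" "X \<inter> Y = {}"
proof -
  show disj: "X \<inter> Y = {}"
    using XY X Y span_superset dependent_zero by blast
  show "independent (X \<union> Y)"
  proof (rule independent_if_scalars_zero)
    show "finite (X \<union> Y)" using X Y by simp
    fix f x assume s: "(\<Sum>x\<in>X \<union> Y. f x *s x) = 0" and x: "x \<in> X \<union> Y"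
    have sum: "(\<Sum>x\<in>X. f x *s x) + (\<Sum>x\<in>Y. f x *s x) = 0"
      using s disj X Y by (simp add: sum.union_disjoint)
    have "(\<Sum>x\<in>X. f x *s x) = - (\<Sum>x\<in>Y. f x *s x)"
      using sum by (simp add: add_eq_0_iff2)
    moreover have "(\<Sum>x\<in>X. f x *s x) \<in> span X" "(\<Sum>x\<in>Y. f x *s x) \<in> span Y"
      by (intro span_sum span_scale span_base; assumption)+
    ultimately have "(\<Sum>x\<in>X. f x *s x) \<in> span X \<inter> span Y"
      by (metis IntI span_neg)
    then have 0: "(\<Sum>x\<in>X. f x *s x) = 0" "(\<Sum>x\<in>Y. f x *s x) = 0"
      using XY sum by auto
    then show "f x = 0"
      using x independentD[OF X(2,1) order_refl] independentD[OF Y(2,1) order_refl] by blast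
  qed
qed

lemma finite_basis_exists:
  assumes "finite F" "V \<subseteq> span F"
  obtains C where "finite C" "C \<subseteq> V" "independent C" "V \<subseteq> span C"
proof -
  obtain C where C: "C \<subseteq> V" "independent C" "V \<subseteq> span C"
    using maximal_independent_subset[of V] by blast
  moreover have "finite C"
    using independent_span_bound[OF assms(1) C(2)] C(1) assms(2) by blast
  ultimately show thesis using that by blast
qed

end

text \<open>Conjugate-linear in the first argument, and of any signature. The two instances below
  are the inner product of K and the indefinite form given by \<open>Jop\<close>.\<close>

locale hermitian_space = vector_space scale
  for scale :: "complex \<Rightarrow> 'a::ab_group_add \<Rightarrow> 'a" (infixr \<open>*s\<close> 75) +
  fixes B :: "'a \<Rightarrow> 'a \<Rightarrow> complex"
  assumes B_add_right: "B x (y + z) = B x y + B x z"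
    and B_scale_right: "B x (c *s y) = c * B x y"
    and B_cnj: "cnj (B x y) = B y x"
begin

lemma B_add_left: "B (x + y) z = B x z + B y z"
  by (metis B_add_right B_cnj complex_cnj_add)

lemma B_scale_left: "B (c *s x) y = cnj c * B x y"
  by (metis B_scale_right B_cnj complex_cnj_mult)

lemma B_zero_right [simp]: "B x 0 = 0"
  using B_scale_right[of x 0 0] by simp

lemma B_zero_left [simp]: "B 0 x = 0"
  using B_scale_left[of 0 0 x] by simp

lemma B_minus_right: "B x (- y) = - B x y"
  using B_scale_right[of x "-1" y] by simp

lemma B_minus_left: "B (- x) y = - B x y"
  using B_scale_left[of "-1" x y] by simp

lemma B_diff_right: "B x (y - z) = B x y - B x z"
  using B_add_right[of x y "- z"] by (simp add: B_minus_right)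

lemma B_diff_left: "B (x - y) z = B x z - B y z"
  using B_add_left[of x "- y" z] by (simp add: B_minus_left)

lemma B_sum_right: "B x (sum f I) = (\<Sum>i\<in>I. B x (f i))"
  by (induction I rule: infinite_finite_induct) (auto simp: B_add_right)

lemma B_sum_left: "B (sum f I) x = (\<Sum>i\<in>I. B (f i) x)"
  by (induction I rule: infinite_finite_induct) (auto simp: B_add_left)

lemma subspace_orthogonal: "subspace {x. B x y = 0}" "subspace {y. B x y = 0}"
  by (auto simp: subspace_def B_add_left B_scale_left B_add_right B_scale_right)

lemma B_span_zero:
  assumes "\<And>x y. x \<in> X \<Longrightarrow> y \<in> Y \<Longrightarrow> B x y = 0" "x \<in> span X" "y \<in> span Y"
  shows "B x y = 0"
proof -
  have "B x y = 0" if "x \<in> X" for x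
    using span_induct[OF assms(3) subspace_orthogonal(2)] assms(1) that by blast
  then show ?thesis
    using span_induct[OF assms(2) subspace_orthogonal(1)] by blast
qed

definition q :: "'a \<Rightarrow> real" where "q x = Re (B x x)"

lemma B_self: "B x x = of_real (q x)"
  using B_cnj[of x x] by (simp add: q_def complex_eq_iff)

lemma q_zero [simp]: "q 0 = 0"
  by (simp add: q_def)

text \<open>Vectors with \<open>q w = 0\<close> are allowed, so degenerate forms have such bases as
  well; nothing is normalised.\<close>

definition ortho_basis :: "'a set \<Rightarrow> 'a set \<Rightarrow> bool" where
  "ortho_basis W M \<longleftrightarrow> finite W \<and> independent W \<and> span W = M \<and> (\<forall>x\<in>W. \<forall>y\<in>W. x \<noteq> y \<longrightarrow> B x y = 0)"

lemma q_sum_orthogonal: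
  assumes "finite W" "\<And>x y. x \<in> W \<Longrightarrow> y \<in> W \<Longrightarrow> x \<noteq> y \<Longrightarrow> B x y = 0"
  shows "q (\<Sum>w\<in>W. c w *s w) = (\<Sum>w\<in>W. (cmod (c w))\<^sup>2 * q w)"
proof -
  have "B (\<Sum>w\<in>W. c w *s w) (\<Sum>w\<in>W. c w *s w)
      = (\<Sum>w\<in>W. \<Sum>w'\<in>W. cnj (c w) * c w' * B w w')"
    unfolding B_sum_left B_scale_left unfolding B_sum_right B_scale_right
    by (simp add: sum_distrib_left mult_ac)
  also have "\<dots> = (\<Sum>w\<in>W. \<Sum>w'\<in>W. if w' = w then cnj (c w) * c w * B w w else 0)"
    using assms(2) by (intro sum.cong refl) auto
  also have "\<dots> = (\<Sum>w\<in>W. of_real ((cmod (c w))\<^sup>2 * q w))"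
    using assms(1) by (intro sum.cong refl) (simp add: B_self complex_norm_square mult_ac del: of_real_power)
  finally show ?thesis by (simp add: q_def flip: of_real_sum)
qed

lemma q_span_orthogonal_pos:
  assumes "finite W" "independent W" "\<And>x y. x \<in> W \<Longrightarrow> y \<in> W \<Longrightarrow> x \<noteq> y \<Longrightarrow> B x y = 0"
    and "\<And>w. w \<in> W \<Longrightarrow> q w > 0" "x \<in> span W" "x \<noteq> 0"
  shows "q x > 0"
proof -
  from assms(5) obtain c where x: "x = (\<Sum>w\<in>W. c w *s w)"
    unfolding span_finite[OF assms(1)] by auto
  have "\<exists>w\<in>W. c w \<noteq> 0"
  proof (rule ccontr)
    assume "\<not> ?thesis"
    then have "x = 0" unfolding x by (intro sum.neutral) simp
    with assms(6) show False ..
  qed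
  then obtain w where w: "w \<in> W" "c w \<noteq> 0" by blast
  have "0 < (\<Sum>w\<in>W. (cmod (c w))\<^sup>2 * q w)"
    using assms(1) w assms(4) by (intro sum_pos2[of _ w]) (auto simp: less_imp_le)
  also have "\<dots> = q x"
    unfolding x by (rule q_sum_orthogonal[symmetric]) (use assms in auto)
  finally show ?thesis .
qed

text \<open>The dimension count behind Sylvester's law: a positive definite span meets the span of
  the basis vectors with \<open>q w \<le> 0\<close> only in 0, so the two dimensions add up to at
  most \<open>card W\<close>.\<close>

lemma card_positive_le:
  assumes W: "ortho_basis W M" and X: "finite X" "independent X" "X \<subseteq> M"
    and pos: "\<And>x. x \<in> span X \<Longrightarrow> x \<noteq> 0 \<Longrightarrow> q x > 0"
  shows "card X \<le> card {w\<in>W. q w > 0}"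
proof -
  define N where "N = {w\<in>W. \<not> q w > 0}"
  have fW: "finite W" and iW: "independent W" and sW: "span W = M"
    and oW: "\<And>x y. x \<in> W \<Longrightarrow> y \<in> W \<Longrightarrow> x \<noteq> y \<Longrightarrow> B x y = 0"
    using W by (auto simp: ortho_basis_def)
  have fN: "finite N" and iN: "independent N"
    using fW independent_mono[OF iW, of N] by (auto simp: N_def)
  have "q x \<le> 0" if "x \<in> span N" for x
  proof -
    from that obtain c where x: "x = (\<Sum>w\<in>N. c w *s w)"
      unfolding span_finite[OF fN] by auto
    have "q x = (\<Sum>w\<in>N. (cmod (c w))\<^sup>2 * q w)"
      unfolding x by (rule q_sum_orthogonal[OF fN]) (auto simp: N_def oW)
    then show ?thesis by (auto simp: N_def intro!: sum_nonpos mult_nonneg_nonpos)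
  qed
  then have "span X \<inter> span N \<subseteq> {0}" using pos by fastforce
  from independent_Un_disjoint_span[OF X(1,2) fN iN this]
  have XN: "independent (X \<union> N)" "X \<inter> N = {}" by auto
  have "card (X \<union> N) \<le> card W"
    using independent_span_bound[OF fW XN(1)] X(3) sW span_superset[of W] by (auto simp: N_def)
  moreover have "card (X \<union> N) = card X + card N" using XN X fN by (simp add: card_Un_disjoint)
  moreover have "card W = card {w\<in>W. q w > 0} + card N"
    unfolding N_def using fW by (subst card_Un_disjoint[symmetric]) (auto intro: arg_cong[of _ _ card])
  ultimately show ?thesis by simp
qed

text \<open>Lets every statement about positive vectors be reused for negative ones.\<close>

lemma hermitian_space_neg: "hermitian_space scale (\<lambda>x y. - B x y)"
  by unfold_locales (auto simp: B_add_right B_scale_right B_cnj)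

lemma q_neg: "hermitian_space.q (\<lambda>x y. - B x y) x = - q x"
  by (simp add: hermitian_space.q_def[OF hermitian_space_neg] q_def)

lemma ortho_basis_neg:
  "hermitian_space.ortho_basis scale (\<lambda>x y. - B x y) W M \<longleftrightarrow> ortho_basis W M"
  by (simp add: hermitian_space.ortho_basis_def[OF hermitian_space_neg] ortho_basis_def)

lemma card_negative_le:
  assumes W: "ortho_basis W M" and X: "finite X" "independent X" "X \<subseteq> M"
    and neg: "\<And>x. x \<in> span X \<Longrightarrow> x \<noteq> 0 \<Longrightarrow> q x < 0"
  shows "card X \<le> card {w\<in>W. q w < 0}"
  using hermitian_space.card_positive_le[OF hermitian_space_neg, unfolded ortho_basis_neg q_neg, OF W X] neg
  by simp

lemma q_span_orthogonal_neg:
  assumes "finite W" "independent W" "\<And>x y. x \<in> W \<Longrightarrow> y \<in> W \<Longrightarrow> x \<noteq> y \<Longrightarrow> B x y = 0"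
    and "\<And>w. w \<in> W \<Longrightarrow> q w < 0" "x \<in> span W" "x \<noteq> 0"
  shows "q x < 0"
  using hermitian_space.q_span_orthogonal_pos[OF hermitian_space_neg, unfolded q_neg, OF assms(1,2)] assms(3-6)
  by simp

text \<open>A relation rather than a function, so that existence (finite dimension) and uniqueness
  (Sylvester) can be proved separately.\<close>

definition has_inertia :: "'a set \<Rightarrow> nat \<Rightarrow> nat \<Rightarrow> bool" where
  "has_inertia M p n \<longleftrightarrow> (\<exists>W. ortho_basis W M \<and> p = card {w\<in>W. q w > 0} \<and> n = card {w\<in>W. q w < 0})"

lemma positive_part:
  assumes "ortho_basis W M"
  shows "finite {w\<in>W. q w > 0}" "independent {w\<in>W. q w > 0}" "{w\<in>W. q w > 0} \<subseteq> M"
    "x \<in> span {w\<in>W. q w > 0} \<Longrightarrow> x \<noteq> 0 \<Longrightarrow> q x > 0"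
proof -
  show 1: "finite {w\<in>W. q w > 0}" "independent {w\<in>W. q w > 0}" "{w\<in>W. q w > 0} \<subseteq> M"
    using assms span_superset[of W] independent_mono[of W "{w\<in>W. q w > 0}"] by (auto simp: ortho_basis_def)
  show "x \<in> span {w\<in>W. q w > 0} \<Longrightarrow> x \<noteq> 0 \<Longrightarrow> q x > 0"
    by (rule q_span_orthogonal_pos[OF 1(1,2)]) (use assms in \<open>auto simp: ortho_basis_def\<close>)
qed

lemma negative_part:
  assumes "ortho_basis W M"
  shows "finite {w\<in>W. q w < 0}" "independent {w\<in>W. q w < 0}" "{w\<in>W. q w < 0} \<subseteq> M"
    "x \<in> span {w\<in>W. q w < 0} \<Longrightarrow> x \<noteq> 0 \<Longrightarrow> q x < 0"
proof -
  show 1: "finite {w\<in>W. q w < 0}" "independent {w\<in>W. q w < 0}" "{w\<in>W. q w < 0} \<subseteq> M"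
    using assms span_superset[of W] independent_mono[of W "{w\<in>W. q w < 0}"] by (auto simp: ortho_basis_def)
  show "x \<in> span {w\<in>W. q w < 0} \<Longrightarrow> x \<noteq> 0 \<Longrightarrow> q x < 0"
    by (rule q_span_orthogonal_neg[OF 1(1,2)]) (use assms in \<open>auto simp: ortho_basis_def\<close>)
qed

text \<open>Sylvester's law of inertia: the definite part of each basis is a competitor in the
  dimension count for the other basis.\<close>

lemma has_inertia_unique:
  assumes "has_inertia M p n" "has_inertia M p' n'"
  shows "p = p'" "n = n'"
proof -
  obtain W where W: "ortho_basis W M" "p = card {w\<in>W. q w > 0}" "n = card {w\<in>W. q w < 0}"
    using assms(1) by (auto simp: has_inertia_def)
  obtain W' where W': "ortho_basis W' M" "p' = card {w\<in>W'. q w > 0}" "n' = card {w\<in>W'. q w < 0}"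
    using assms(2) by (auto simp: has_inertia_def)
  show "p = p'"
    unfolding W W'
    by (rule antisym; rule card_positive_le) (use W(1) W'(1) positive_part in blast)+
  show "n = n'"
    unfolding W W'
    by (rule antisym; rule card_negative_le) (use W(1) W'(1) negative_part in blast)+
qed

text \<open>A squeeze: the definite subspaces force \<open>p \<le> p'\<close> and
  \<open>n \<le> n'\<close>, while the dimension bound forces
  \<open>p' + n' \<le> p + n\<close>.\<close>

lemma has_inertiaI_maximal:
  assumes ex: "has_inertia M p' n'" and F: "finite F" "M \<subseteq> span F" "card F \<le> p + n"
    and X: "finite X" "independent X" "X \<subseteq> M" "card X = p"
    and pos: "\<And>x. x \<in> span X \<Longrightarrow> x \<noteq> 0 \<Longrightarrow> q x > 0"
    and Y: "finite Y" "independent Y" "Y \<subseteq> M" "card Y = n"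
    and neg: "\<And>x. x \<in> span Y \<Longrightarrow> x \<noteq> 0 \<Longrightarrow> q x < 0"
  shows "has_inertia M p n"
proof -
  obtain W where W: "ortho_basis W M" "p' = card {w\<in>W. q w > 0}" "n' = card {w\<in>W. q w < 0}"
    using ex by (auto simp: has_inertia_def)
  have "p \<le> p'" using card_positive_le[OF W(1) X(1-3) pos] X(4) W(2) by simp
  moreover have "n \<le> n'" using card_negative_le[OF W(1) Y(1-3) neg] Y(4) W(3) by simp
  moreover have "p' + n' \<le> p + n"
  proof -
    have fW: "finite W" using W by (simp add: ortho_basis_def)
    have "p' + n' = card ({w\<in>W. q w > 0} \<union> {w\<in>W. q w < 0})"
      unfolding W by (rule card_Un_disjoint[symmetric]) (use fW in auto)
    also have "\<dots> \<le> card W" by (rule card_mono) (use fW in auto)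
    also have "\<dots> \<le> card F"
      using independent_span_bound[OF F(1), of W] W(1) F(2) span_superset[of W] by (auto simp: ortho_basis_def)
    finally show ?thesis using F(3) by simp
  qed
  ultimately have "p' = p" "n' = n" by linarith+
  then show ?thesis using ex by simp
qed

text \<open>A vector common to both summands is orthogonal to all of \<open>M1\<close>, hence zero,
  so two orthogonal bases unite to a basis of the sum.\<close>

lemma has_inertia_orthogonal_sum:
  assumes M1: "has_inertia M1 p1 n1" and M2: "has_inertia M2 p2 n2"
    and orth: "\<And>x y. x \<in> M1 \<Longrightarrow> y \<in> M2 \<Longrightarrow> B x y = 0"
    and nondeg: "\<And>x. x \<in> M1 \<Longrightarrow> (\<And>y. y \<in> M1 \<Longrightarrow> B x y = 0) \<Longrightarrow> x = 0"
  shows "has_inertia (span (M1 \<union> M2)) (p1 + p2) (n1 + n2)"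
proof -
  obtain W where W: "ortho_basis W M1" "p1 = card {w\<in>W. q w > 0}" "n1 = card {w\<in>W. q w < 0}"
    using M1 by (auto simp: has_inertia_def)
  obtain V where V: "ortho_basis V M2" "p2 = card {w\<in>V. q w > 0}" "n2 = card {w\<in>V. q w < 0}"
    using M2 by (auto simp: has_inertia_def)
  note WV = W(1)[unfolded ortho_basis_def] V(1)[unfolded ortho_basis_def]
  have "span W \<inter> span V \<subseteq> {0}"
  proof
    fix x assume x: "x \<in> span W \<inter> span V"
    have "x = 0"
    proof (rule nondeg)
      show "x \<in> M1" using x WV by auto
      fix y assume "y \<in> M1"
      then have "B y x = 0" using x WV orth by auto
      then show "B x y = 0" using B_cnj[of y x] by simp
    qed
    then show "x \<in> {0}" by simp
  qed
  with WV have iu: "independent (W \<union> V)" and disj: "W \<inter> V = {}"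
    using independent_Un_disjoint_span[of W V] by auto
  have sub: "W \<subseteq> M1" "V \<subseteq> M2" using WV span_superset by auto
  have orth': "B y x = 0" if "x \<in> M1" "y \<in> M2" for x y
    using orth[OF that] B_cnj[of x y] by simp
  have "B x y = 0" if "x \<in> W \<union> V" "y \<in> W \<union> V" "x \<noteq> y" for x y
    using that WV sub orth orth' by blast
  moreover have "span (W \<union> V) = span (M1 \<union> M2)"
  proof -
    have "span M1 = span W" "span M2 = span V" using WV span_span[of W] span_span[of V] by auto
    then show ?thesis unfolding span_Un by simp
  qed
  ultimately have ob: "ortho_basis (W \<union> V) (span (M1 \<union> M2))"
    using WV iu by (auto simp: ortho_basis_def)
  have "p1 + p2 = card ({w\<in>W. q w > 0} \<union> {w\<in>V. q w > 0})"
    unfolding W V using WV disj by (subst card_Un_disjoint) auto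
  also have "\<dots> = card {w\<in>W \<union> V. q w > 0}" by (rule arg_cong[of _ _ card]) auto
  finally have p: "p1 + p2 = \<dots>" .
  have "n1 + n2 = card ({w\<in>W. q w < 0} \<union> {w\<in>V. q w < 0})"
    unfolding W V using WV disj by (subst card_Un_disjoint) auto
  also have "\<dots> = card {w\<in>W \<union> V. q w < 0}" by (rule arg_cong[of _ _ card]) auto
  finally show ?thesis using ob p unfolding has_inertia_def by blast
qed

text \<open>An involution that negates the form maps an orthogonal basis to an orthogonal basis with
  all signs reversed.\<close>

lemma has_inertia_flip:
  assumes M: "has_inertia M p n" and R: "Vector_Spaces.linear scale scale R"
    and RR: "\<And>x. x \<in> M \<Longrightarrow> R (R x) = x" and RM: "\<And>x. x \<in> M \<Longrightarrow> R x \<in> M"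
    and flip: "\<And>x y. x \<in> M \<Longrightarrow> y \<in> M \<Longrightarrow> B (R x) (R y) = - B x y"
  shows "has_inertia M n p"
proof -
  interpret R: Vector_Spaces.linear scale scale R by fact
  obtain W where W: "ortho_basis W M" "p = card {w\<in>W. q w > 0}" "n = card {w\<in>W. q w < 0}"
    using M by (auto simp: has_inertia_def)
  note Wd = W(1)[unfolded ortho_basis_def]
  have WM: "W \<subseteq> M" using Wd span_superset by auto
  have inj: "inj_on R M" by (metis RR inj_onI)
  have "independent (R ` W)"
    using R.independent_injective_image[of W] Wd inj by simp
  moreover have "span (R ` W) = M"
  proof -
    have "x \<in> R ` M" if "x \<in> M" for x
      by (rule image_eqI[where x = "R x"]) (simp_all add: RR RM that)
    then have "R ` M = M" using RM by blast
    then show ?thesis using R.span_image[of W] Wd by simp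
  qed
  moreover have "B x y = 0" if h: "x \<in> R ` W" "y \<in> R ` W" "x \<noteq> y" for x y
  proof -
    obtain a b where ab: "x = R a" "y = R b" "a \<in> W" "b \<in> W" using h(1,2) by auto
    then have "B a b = 0" using Wd h(3) by auto
    moreover have "a \<in> M" "b \<in> M" using ab WM by auto
    ultimately show ?thesis using flip[of a b] by (simp add: ab)
  qed
  ultimately have ob: "ortho_basis (R ` W) M"
    using Wd by (auto simp: ortho_basis_def)
  have qR: "q (R w) = - q w" if "w \<in> W" for w using that WM flip by (auto simp: q_def)
  have inj': "inj_on R W" using inj WM by (rule inj_on_subset)
  have "{w \<in> R ` W. q w > 0} = R ` {w\<in>W. q w < 0}" using qR by auto
  moreover have "{w \<in> R ` W. q w < 0} = R ` {w\<in>W. q w > 0}" using qR by auto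
  ultimately show ?thesis
    using ob card_image[OF inj_on_subset[OF inj', of "{w\<in>W. q w < 0}"]]
      card_image[OF inj_on_subset[OF inj', of "{w\<in>W. q w > 0}"]]
    unfolding has_inertia_def W(2,3) by (intro exI[of _ "R ` W"]) auto
qed

definition gram :: "'a list \<Rightarrow> complex mat" where
  "gram \<Phi> = mat (length \<Phi>) (length \<Phi>) (\<lambda>(i, j). B (\<Phi> ! i) (\<Phi> ! j))"

text \<open>The bridge from matrix eigenvalues to inertia: the unitary matrix that diagonalizes the
  Gram matrix recombines \<open>\<Phi>\<close> into an orthogonal basis \<open>w\<close> on which
  \<open>q\<close> takes the values \<open>ds\<close>.\<close>

lemma has_inertia_gram:
  assumes dist: "distinct \<Phi>" and ind: "independent (set \<Phi>)"
  shows "has_inertia (span (set \<Phi>)) (nu_pos (gram \<Phi>)) (nu_neg (gram \<Phi>))"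
proof -
  define n where "n = length \<Phi>"
  define G where "G = gram \<Phi>"
  have Gij: "G $$ (i, j) = B (\<Phi> ! i) (\<Phi> ! j)" if "i < n" "j < n" for i j
    using that by (auto simp: G_def gram_def n_def)
  have Gc: "G \<in> carrier_mat n n" by (auto simp: G_def gram_def n_def)
  have "mat_adjoint G = G"
    using Gc by (intro eq_matI) (auto simp: mat_adjoint_eq Gij B_cnj)
  from hermitian_diagonalization[OF Gc this] obtain U ds where
    U: "U \<in> carrier_mat n n" and ds: "length ds = n" and UU: "U * mat_adjoint U = 1\<^sub>m n"
    and UGU: "mat_adjoint U * G * U = mat n n (\<lambda>(i, j). if i = j then complex_of_real (ds ! i) else 0)"
    and cp: "char_poly G = (\<Prod>d\<leftarrow>ds. [:- complex_of_real d, 1:])" by blast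
  define w where "w j = (\<Sum>i<n. U $$ (i, j) *s \<Phi> ! i)" for j
  have Bw: "B (w j) (w k) = (if j = k then complex_of_real (ds ! j) else 0)" if jk: "j < n" "k < n" for j k
  proof -
    have "B (w j) (w k) = (\<Sum>i<n. \<Sum>l<n. cnj (U $$ (i, j)) * (U $$ (l, k) * G $$ (i, l)))"
      unfolding w_def B_sum_left B_scale_left unfolding B_sum_right B_scale_right
      by (simp add: sum_distrib_left Gij)
    also have "\<dots> = (\<Sum>l<n. (\<Sum>i<n. cnj (U $$ (i, j)) * G $$ (i, l)) * U $$ (l, k))"
      by (subst sum.swap) (simp add: sum_distrib_right sum_distrib_left mult_ac)
    also have "\<dots> = (mat_adjoint U * G * U) $$ (j, k)"
      using U Gc jk by (simp add: scalar_prod_def mat_adjoint_eq atLeast0LessThan)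
    finally show ?thesis unfolding UGU using jk by simp
  qed
  have \<Phi>w: "\<Phi> ! i = (\<Sum>j<n. cnj (U $$ (i, j)) *s w j)" if i: "i < n" for i
  proof -
    have "(\<Sum>j<n. cnj (U $$ (i, j)) *s w j) = (\<Sum>l<n. (\<Sum>j<n. U $$ (l, j) * cnj (U $$ (i, j))) *s \<Phi> ! l)"
      unfolding w_def by (simp add: scale_sum_right scale_sum_left mult.commute) (rule sum.swap)
    also have "\<dots> = (\<Sum>l<n. (U * mat_adjoint U) $$ (l, i) *s \<Phi> ! l)"
      using U i by (intro sum.cong) (auto simp: scalar_prod_def mat_adjoint_eq atLeast0LessThan)
    also have "\<dots> = (\<Sum>l<n. if l = i then \<Phi> ! l else 0)"
      unfolding UU using i by (intro sum.cong) auto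
    finally show ?thesis using i by simp
  qed
  define W where "W = w ` {..<n}"
  have spanW: "span W = span (set \<Phi>)"
    unfolding span_eq
  proof
    show "W \<subseteq> span (set \<Phi>)"
      unfolding W_def w_def
      by (intro image_subsetI span_sum span_scale span_base) (simp add: n_def)
    show "set \<Phi> \<subseteq> span W"
    proof
      fix x assume "x \<in> set \<Phi>"
      then obtain i where "i < n" "x = \<Phi> ! i" by (auto simp: in_set_conv_nth n_def)
      then show "x \<in> span W"
        using \<Phi>w[of i] unfolding W_def by (simp only:) (intro span_sum span_scale span_base, simp)
    qed
  qed
  have fW: "finite W" and cW: "card W \<le> n"
    using card_image_le[of "{..<n}" w] by (auto simp: W_def)
  \<comment> \<open>\<open>W\<close> is the image of n indices and spans a space of dimension n.
    Hence \<open>w\<close> is injective on the indices and \<open>W\<close> is independent, so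
    counting entries of \<open>ds\<close> is counting elements of \<open>W\<close>.\<close>
  have dim: "dim (span W) = n"
    unfolding spanW using dim_eq_card_independent[OF ind] distinct_card[OF dist] by (simp add: n_def)
  obtain C where C: "C \<subseteq> W" "independent C" "W \<subseteq> span C"
    using maximal_independent_subset[of W] by blast
  then have "span C = span W" by (metis span_mono span_span subset_antisym)
  then have "card C = n" using dim dim_eq_card_independent[OF C(2)] by (metis dim_span)
  then have cW': "card W = n" using cW card_mono[OF fW C(1)] by simp
  with \<open>card C = n\<close> have "C = W" by (intro card_subset_eq[OF fW C(1)]) simp
  then have iW: "independent W" and inj: "inj_on w {..<n}"
    using C(2) cW' by (auto simp: W_def intro!: eq_card_imp_inj_on)
  have "ortho_basis W (span (set \<Phi>))"
    unfolding ortho_basis_def using fW iW spanW Bw by (auto simp: W_def)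
  moreover have "nu_pos G = card {x\<in>W. q x > 0}"
  proof -
    have "{x\<in>W. q x > 0} = w ` {i. i < length ds \<and> 0 < ds ! i}"
      using ds Bw by (auto simp: W_def q_def)
    moreover have "inj_on w {i. i < length ds \<and> 0 < ds ! i}"
      by (rule inj_on_subset[OF inj]) (use ds in auto)
    ultimately show ?thesis
      unfolding nu_pos_def using sum_order_prod_linear[OF cp, of "\<lambda>x. x > 0"] by (simp add: card_image)
  qed
  moreover have "nu_neg G = card {x\<in>W. q x < 0}"
  proof -
    have "{x\<in>W. q x < 0} = w ` {i. i < length ds \<and> ds ! i < 0}"
      using ds Bw by (auto simp: W_def q_def)
    moreover have "inj_on w {i. i < length ds \<and> ds ! i < 0}"
      by (rule inj_on_subset[OF inj]) (use ds in auto)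
    ultimately show ?thesis
      unfolding nu_neg_def using sum_order_prod_linear[OF cp, of "\<lambda>x. x < 0"] by (simp add: card_image)
  qed
  ultimately show ?thesis unfolding has_inertia_def G_def by blast
qed

text \<open>Diagonalizing the Gram matrix of any basis also covers degenerate and indefinite forms,
  where successive orthogonalisation could stop at a null vector.\<close>

lemma has_inertia_exists:
  assumes "subspace M" "finite F" "M \<subseteq> span F"
  shows "\<exists>p n. has_inertia M p n"
proof -
  obtain C where C: "finite C" "C \<subseteq> M" "independent C" "M \<subseteq> span C"
    using finite_basis_exists[OF assms(2,3)] .
  obtain \<Phi> where \<Phi>: "set \<Phi> = C" "distinct \<Phi>" using finite_distinct_list[OF C(1)] by blast
  have "span C = M" using C assms(1) by (simp add: span_subspace)
  then show ?thesis using has_inertia_gram[of \<Phi>] \<Phi> C by auto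
qed

text \<open>Only the pairing between \<open>F\<close> and \<open>G\<close> survives, so the
  reflection that is 1 on \<open>F\<close> and -1 on \<open>G\<close> negates the form; by
  uniqueness the two counts agree. The subspaces may overlap: the reflection is defined on a basis
  drawn from their union, with \<open>F\<close> taking precedence.\<close>

lemma has_inertia_hyperbolic:
  assumes F: "subspace F" and G: "subspace G" and S: "finite S" "F \<subseteq> span S" "G \<subseteq> span S"
    and FF: "\<And>x y. x \<in> F \<Longrightarrow> y \<in> F \<Longrightarrow> B x y = 0"
    and GG: "\<And>x y. x \<in> G \<Longrightarrow> y \<in> G \<Longrightarrow> B x y = 0"
  shows "\<exists>p. has_inertia (span (F \<union> G)) p p"
proof -
  obtain D where D: "D \<subseteq> F \<union> G" "independent D" "F \<union> G \<subseteq> span D"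
    using maximal_independent_subset[of "F \<union> G"] by blast
  interpret P: vector_space_pair scale scale ..
  obtain R where R: "Vector_Spaces.linear scale scale R" and Rd: "\<And>x. x \<in> D \<Longrightarrow> R x = (if x \<in> F then x else - x)"
    using P.linear_independent_extend[OF D(2), of "\<lambda>x. if x \<in> F then x else - x"] by auto
  interpret R: Vector_Spaces.linear scale scale R by fact
  have M: "span (F \<union> G) = span D"
    unfolding span_eq using D(1,3) span_mono[OF D(1)] span_superset[of "F \<union> G"] by blast
  have Rmem: "R x \<in> span D" if "x \<in> span D" for x
  proof -
    have "span D \<subseteq> {x. R x \<in> span D}"
      by (rule span_minimal) (auto simp: Rd span_base span_neg R.subspace_linear_preimage)
    with that show ?thesis by blast
  qed
  have RR: "R (R x) = x" if "x \<in> span D" for x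
    using that
  proof (induction rule: span_induct)
    case base
    show ?case by (auto simp: subspace_def R.add R.scale)
  next
    case (step x)
    then show ?case by (auto simp: Rd R.neg)
  qed
  \<comment> \<open>Mixed pairs change sign by construction; for pairs inside \<open>F\<close> or
    inside \<open>G\<close> both sides vanish by isotropy.\<close>
  have flipD: "B (R x) (R y) = - B x y" if "x \<in> D" "y \<in> D" for x y
  proof (cases "x \<in> F"; cases "y \<in> F")
    assume "x \<notin> F" "y \<notin> F"
    then have "B x y = 0" using that D(1) by (intro GG) auto
    then show ?thesis using that \<open>x \<notin> F\<close> \<open>y \<notin> F\<close> by (simp add: Rd B_minus_left B_minus_right)
  qed (use that FF in \<open>simp_all add: Rd B_minus_left B_minus_right\<close>)
  have flip1: "B (R x) (R y) = - B x y" if "x \<in> D" "y \<in> span D" for x y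
    using that(2)
  proof (induction rule: span_induct)
    case base
    show ?case by (auto simp: subspace_def R.add R.scale B_add_right B_scale_right)
  next
    case (step y)
    then show ?case using flipD that by simp
  qed
  have flip: "B (R x) (R y) = - B x y" if "x \<in> span D" "y \<in> span D" for x y
    using that(1)
  proof (induction rule: span_induct)
    case base
    show ?case by (auto simp: subspace_def R.add R.scale B_add_left B_scale_left)
  next
    case (step y)
    then show ?case using flip1 that by simp
  qed
  have "span D \<subseteq> span S"
    unfolding M[symmetric] by (rule span_minimal) (use S in auto)
  then obtain p n where pn: "has_inertia (span D) p n"
    using has_inertia_exists[OF subspace_span S(1)] by blast
  have "has_inertia (span D) n p"
    by (rule has_inertia_flip[OF pn R RR Rmem flip])
  from has_inertia_unique(1)[OF pn this] pn have "has_inertia (span D) p p" by simp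
  then show ?thesis unfolding M by blast
qed

end

section \<open>The Hilbert space K and bounded operators\<close>

lemma scaleC_one: "scaleC 1 (x::'h::chilbert) = x"
  using scaleC_of_real[of 1 x] by simp

interpretation K: vector_space "scaleK :: complex \<Rightarrow> 'h::chilbert \<times> 'h \<Rightarrow> 'h \<times> 'h"
  by unfold_locales
    (simp_all add: scaleK_def scaleC_add_right scaleC_add_left scaleC_scaleC scaleC_one)

lemma cspanK_eq_span: "cspanK S = K.span S"
  unfolding cspanK_def K.span_explicit by blast

lemma scaleK_of_real: "scaleK (of_real r) x = scaleR r (x::'h::chilbert \<times> 'h)"
  by (simp add: scaleK_def scaleC_of_real prod_eq_iff)

lemma cinner_zero_left: "cinner 0 (y::'h::chilbert) = 0"
  using cinner_add_left[of 0 0 y] by simp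

lemma cinner_add_right: "cinner x (y + z) = cinner x y + cinner x (z::'h::chilbert)"
  by (metis cinner_add_left cinner_commute complex_cnj_add)

lemma cinner_scaleC_right: "cinner x (scaleC c y) = c * cinner x (y::'h::chilbert)"
  by (metis cinner_commute cinner_scaleC_left complex_cnj_cnj complex_cnj_mult)

interpretation H: hermitian_space "scaleK :: complex \<Rightarrow> 'h::chilbert \<times> 'h \<Rightarrow> 'h \<times> 'h" cinnerK
proof unfold_locales
  fix x y z :: "'h \<times> 'h" and c
  show "cinnerK x (y + z) = cinnerK x y + cinnerK x z"
    by (simp add: cinnerK_def cinner_add_right)
  show "cinnerK x (scaleK c y) = c * cinnerK x y"
    by (simp add: cinnerK_def scaleK_def cinner_scaleC_right algebra_simps)
  show "cnj (cinnerK x y) = cinnerK y x"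
    unfolding cinnerK_def complex_cnj_add by (metis cinner_commute)
qed

lemma cinnerK_self: "cinnerK x x = of_real ((norm x)\<^sup>2)"
  by (cases x) (simp add: cinnerK_def cinner_norm norm_Pair real_sqrt_pow2 del: of_real_power)

lemma H_q: "H.q x = (norm x)\<^sup>2"
  by (simp add: H.q_def cinnerK_self del: of_real_power)

lemma norm_scaleK: "norm (scaleK c x) = cmod c * norm (x::'h::chilbert \<times> 'h)"
proof -
  have "complex_of_real ((norm (scaleK c x))\<^sup>2) = cnj c * c * complex_of_real ((norm x)\<^sup>2)"
    by (simp add: cinnerK_self[symmetric] H.B_scale_left H.B_scale_right del: of_real_power)
  also have "\<dots> = complex_of_real ((cmod c * norm x)\<^sup>2)"
    by (simp add: power_mult_distrib complex_norm_square[of c, unfolded of_real_power] mult.commute)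
  finally have "(norm (scaleK c x))\<^sup>2 = (cmod c * norm x)\<^sup>2"
    by (simp only: of_real_eq_iff)
  then show ?thesis by (simp add: power2_eq_iff_nonneg)
qed

lemma cinnerK_Cauchy_Schwarz: "cmod (cinnerK x y) \<le> norm x * norm (y::'h::chilbert \<times> 'h)"
proof (cases "y = 0")
  case False
  define c where "c = cinnerK y x / of_real ((norm y)\<^sup>2)"
  have ny: "(norm y)\<^sup>2 > 0" using False by simp
  have yx: "cinnerK y x = c * of_real ((norm y)\<^sup>2)" using False by (simp add: c_def)
  have xy: "cinnerK x y = cnj c * of_real ((norm y)\<^sup>2)"
    using H.B_cnj[of y x] by (simp add: yx)
  have "complex_of_real ((norm (x - scaleK c y))\<^sup>2)
      = of_real ((norm x)\<^sup>2) - c * cinnerK x y - cnj c * cinnerK y x + cnj c * c * of_real ((norm y)\<^sup>2)"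
    by (simp add: cinnerK_self[symmetric] H.B_diff_left H.B_diff_right H.B_scale_left H.B_scale_right
        algebra_simps del: of_real_power)
  also have "\<dots> = of_real ((norm x)\<^sup>2 - (cmod c)\<^sup>2 * (norm y)\<^sup>2)"
    unfolding xy yx by (simp add: complex_norm_square[of c, unfolded of_real_power] algebra_simps)
  finally have "(norm (x - scaleK c y))\<^sup>2 = (norm x)\<^sup>2 - (cmod c)\<^sup>2 * (norm y)\<^sup>2"
    by (simp only: of_real_eq_iff)
  then have "(cmod c)\<^sup>2 * (norm y)\<^sup>2 \<le> (norm x)\<^sup>2"
    by (metis diff_ge_0_iff_ge zero_le_power2)
  then have "cmod c * norm y \<le> norm x"
    by (metis norm_ge_zero power2_le_imp_le power_mult_distrib)
  then show ?thesis
    unfolding xy by (simp add: norm_mult power2_eq_square mult_right_mono flip: mult.assoc)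
qed (use H.B_zero_right[of x] in simp)

interpretation scaleK: bounded_bilinear "scaleK :: complex \<Rightarrow> 'h::chilbert \<times> 'h \<Rightarrow> 'h \<times> 'h"
proof
  fix a a' :: complex and b b' :: "'h \<times> 'h" and r :: real
  show "scaleK (a + a') b = scaleK a b + scaleK a' b" by (rule K.scale_left_distrib)
  show "scaleK a (b + b') = scaleK a b + scaleK a b'" by (rule K.scale_right_distrib)
  show "scaleK (r *\<^sub>R a) b = r *\<^sub>R scaleK a b"
    by (simp add: scaleK_of_real[symmetric] scaleR_conv_of_real)
  show "scaleK a (r *\<^sub>R b) = r *\<^sub>R scaleK a b"
    by (simp add: scaleK_of_real[symmetric] mult.commute)
  show "\<exists>K. \<forall>a (b::'h \<times> 'h). norm (scaleK a b) \<le> norm a * norm b * K"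
    by (intro exI[of _ 1]) (simp add: norm_scaleK)
qed

lemma clinearK_iff_linear: "clinearK T \<longleftrightarrow> Vector_Spaces.linear scaleK scaleK T"
  by (auto simp: clinearK_def Vector_Spaces.linear_iff K.vector_space_axioms)

lemma clinearKD:
  assumes "clinearK T"
  shows "T (x + y) = T x + T y" "T (scaleK c x) = scaleK c (T x)" "T (x - y) = T x - T y"
    "T 0 = 0" "T (- x) = - T x" "T (sum f I) = (\<Sum>i\<in>I. T (f i))"
proof -
  interpret T: Vector_Spaces.linear scaleK scaleK T using assms by (simp add: clinearK_iff_linear)
  show "T (x + y) = T x + T y" "T (scaleK c x) = scaleK c (T x)" "T (x - y) = T x - T y"
    "T 0 = 0" "T (- x) = - T x" "T (sum f I) = (\<Sum>i\<in>I. T (f i))"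
    by (rule T.add T.scale T.diff T.zero T.neg T.sum)+
qed

lemma clinearKI: "(\<And>x y. T (x + y) = T x + T y) \<Longrightarrow> (\<And>c x. T (scaleK c x) = scaleK c (T x)) \<Longrightarrow> clinearK T"
  by (simp add: clinearK_def)

lemma boundedKI:
  assumes "clinearK T" "\<And>x. norm (T x) \<le> C * norm x" shows "boundedK T"
  using assms by (auto simp: boundedK_def)

lemma boundedK_bounded_linear:
  assumes "boundedK T" shows "bounded_linear T"
proof -
  obtain C where C: "\<And>x. norm (T x) \<le> C * norm x" using assms by (auto simp: boundedK_def)
  note T = clinearKD[of T]
  show ?thesis
    by (rule bounded_linear_intro[of _ C])
      (use assms T C in \<open>auto simp: boundedK_def scaleK_of_real[symmetric] mult.commute\<close>)
qed

lemma clinearK_shiftK: "clinearK T \<Longrightarrow> clinearK (shiftK T z)"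
  by (rule clinearKI) (simp_all add: shiftK_def clinearKD K.scale_right_distrib K.scale_right_diff_distrib mult.commute)

lemma boundedK_shiftK:
  assumes "boundedK T" shows "boundedK (shiftK T z)"
proof -
  obtain C where C: "\<And>x. norm (T x) \<le> C * norm x" using assms by (auto simp: boundedK_def)
  show ?thesis
  proof (rule boundedKI[OF clinearK_shiftK])
    show "clinearK T" using assms by (simp add: boundedK_def)
    fix x show "norm (shiftK T z x) \<le> (cmod z + C) * norm x"
      using norm_triangle_ineq4[of "scaleK z x" "T x"] C[of x]
      by (simp add: shiftK_def norm_scaleK algebra_simps)
  qed
qed

lemma bounded_invertibleKD:
  assumes "bounded_invertibleK S"
  shows "boundedK S" "bij S" "boundedK (inv_into UNIV S)" "S (inv_into UNIV S x) = x" "inv_into UNIV S (S x) = x"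
    "\<exists>C>0. \<forall>x. norm x \<le> C * norm (S x)"
proof -
  show S: "boundedK S" using assms by (simp add: bounded_invertibleK_def)
  obtain S' where S': "boundedK S'" "S \<circ> S' = id" "S' \<circ> S = id"
    using assms by (auto simp: bounded_invertibleK_def)
  have bij: "bij S" and inv: "inv_into UNIV S = S'"
    using S'(2,3) by (auto intro!: o_bij inv_unique_comp)
  show "bij S" by fact
  show "boundedK (inv_into UNIV S)" using S' inv by simp
  show "S (inv_into UNIV S x) = x" using bij by (simp add: bij_is_surj surj_f_inv_f)
  show "inv_into UNIV S (S x) = x" using bij by (simp add: bij_is_inj)
  obtain C where C: "\<And>x. norm (S' x) \<le> C * norm x" using S'(1) by (auto simp: boundedK_def)
  have "norm x \<le> max C 1 * norm (S x)" for x
  proof -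
    have "norm x = norm (S' (S x))" using S'(3) by (metis comp_apply id_apply)
    also have "\<dots> \<le> C * norm (S x)" by (rule C)
    also have "\<dots> \<le> max C 1 * norm (S x)" by (intro mult_right_mono) auto
    finally show ?thesis .
  qed
  then show "\<exists>C>0. \<forall>x. norm x \<le> C * norm (S x)"
    by (intro exI[of _ "max C 1"]) auto
qed

text \<open>The lower bound gives injectivity and is at the same time the norm bound of the
  inverse.\<close>

lemma bounded_invertibleKI:
  assumes S: "boundedK S" and surj: "surj S" and C: "\<And>x. norm x \<le> C * norm (S x)"
  shows "bounded_invertibleK S"
proof -
  have lin: "clinearK S" using S by (simp add: boundedK_def)
  have inj: "inj S"
  proof (rule injI)
    fix x y assume "S x = S y"
    then have "S (x - y) = 0" by (simp add: clinearKD[OF lin])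
    with C[of "x - y"] show "x = y" by simp
  qed
  have SS: "S (inv_into UNIV S x) = x" for x by (rule surj_f_inv_f[OF surj])
  have "boundedK (inv_into UNIV S)"
  proof (rule boundedKI[OF clinearKI])
    fix x y c
    show "inv_into UNIV S (x + y) = inv_into UNIV S x + inv_into UNIV S y"
      by (rule injD[OF inj]) (simp add: SS clinearKD[OF lin])
    show "inv_into UNIV S (scaleK c x) = scaleK c (inv_into UNIV S x)"
      by (rule injD[OF inj]) (simp add: SS clinearKD[OF lin])
    show "norm (inv_into UNIV S x) \<le> C * norm x" using C[of "inv_into UNIV S x"] by (simp add: SS)
  qed
  then show ?thesis
    unfolding bounded_invertibleK_def using S inj SS
    by (intro conjI exI[of _ "inv_into UNIV S"]) (auto simp: fun_eq_iff)
qed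

text \<open>Solves S' x = y as the fixed point of a contraction, which replaces the Neumann series.\<close>
lemma bounded_invertibleK_perturb:
  assumes S: "bounded_invertibleK S" and C: "\<And>x. norm x \<le> C * norm (S x)" "0 < C"
    and S': "boundedK S'" and e: "\<And>x. norm (S' x - S x) \<le> e * norm x" "C * e \<le> 1 / 2"
  shows "bounded_invertibleK S'" "norm x \<le> 2 * C * norm (S' x)"
proof -
  note Sd = bounded_invertibleKD[OF S]
  have lin: "clinearK S" "clinearK S'" using Sd(1) S' by (auto simp: boundedK_def)
  have low: "norm x \<le> 2 * C * norm (S' x)" for x
  proof -
    have "norm (S x) \<le> norm (S' x) + norm (S' x - S x)"
      by (metis norm_minus_commute norm_triangle_sub add.commute)
    then have "norm (S x) \<le> norm (S' x) + e * norm x" using e(1)[of x] by linarith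
    then have "C * norm (S x) \<le> C * norm (S' x) + (C * e) * norm x"
      using C(2) mult_left_mono[of "norm (S x)" "norm (S' x) + e * norm x" C] by (simp add: algebra_simps)
    moreover have "(C * e) * norm x \<le> 1 / 2 * norm x" by (rule mult_right_mono[OF e(2)]) simp
    ultimately show ?thesis using C(1)[of x] by linarith
  qed
  then show "norm x \<le> 2 * C * norm (S' x)" .
  have "surj S'"
  unfolding surj_def
  proof
    fix y
    define f where "f x = inv_into UNIV S (y - (S' x - S x))" for x
    have "\<exists>!x. f x = x"
    proof (rule banach_fix_type)
      show "\<forall>x z. dist (f x) (f z) \<le> 1 / 2 * dist x z"
      proof (intro allI)
        fix x z
        have "S (f x - f z) = S' (z - x) - S (z - x)"
          by (simp add: f_def clinearKD[OF lin(1)] clinearKD[OF lin(2)] Sd(4))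
        then have "norm (f x - f z) \<le> C * norm (S' (z - x) - S (z - x))"
          using C(1)[of "f x - f z"] by simp
        also have "\<dots> \<le> C * (e * norm (z - x))"
          using C(2) e(1) by (intro mult_left_mono) auto
        also have "\<dots> = (C * e) * norm (z - x)" by simp
        also have "\<dots> \<le> 1 / 2 * norm (z - x)" by (rule mult_right_mono[OF e(2)]) simp
        finally show "dist (f x) (f z) \<le> 1 / 2 * dist x z" by (simp add: dist_norm norm_minus_commute)
      qed
    qed auto
    then obtain x where "f x = x" by blast
    then have "S x = y - (S' x - S x)" using Sd(4)[of "y - (S' x - S x)"] by (simp add: f_def)
    then show "\<exists>x. y = S' x" by (intro exI[of _ x]) simp
  qed
  then show "bounded_invertibleK S'" using bounded_invertibleKI[OF S' _ low] by blast
qed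

lemma closed_spectrumK:
  assumes T: "boundedK T" shows "closed (spectrumK T)"
  unfolding closed_def open_dist
proof
  fix z assume "z \<in> - spectrumK T"
  then have z: "bounded_invertibleK (shiftK T z)" by (simp add: spectrumK_def)
  obtain C where C: "C > 0" "\<And>x. norm x \<le> C * norm (shiftK T z x)" using bounded_invertibleKD(6)[OF z] by blast
  show "\<exists>e>0. \<forall>w. dist w z < e \<longrightarrow> w \<in> - spectrumK T"
  proof (intro exI conjI allI impI)
    show "1 / (2 * C) > 0" using C by simp
    fix w assume w: "dist w z < 1 / (2 * C)"
    have "bounded_invertibleK (shiftK T w)"
    proof (rule bounded_invertibleK_perturb[OF z C(2,1) boundedK_shiftK[OF T]])
      show "norm (shiftK T w x - shiftK T z x) \<le> dist w z * norm x" for x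
        by (simp add: shiftK_def dist_norm norm_scaleK K.scale_left_diff_distrib[symmetric])
      show "C * dist w z \<le> 1 / 2" using w C(1) by (simp add: field_simps)
    qed
    then show "w \<in> - spectrumK T" by (simp add: spectrumK_def)
  qed
qed

text \<open>If no uniform constant exists, points violating ever larger constants accumulate at some
  \<open>l\<close> in \<open>Z\<close>. But \<open>l\<close> lies in the resolvent set, and its own
  bound extends to a neighbourhood at the cost of a factor 2.\<close>

lemma resolvent_bound_compact:
  assumes T: "boundedK T" and Z: "compact Z" "Z \<inter> spectrumK T = {}"
  shows "\<exists>C>0. \<forall>z\<in>Z. \<forall>x. norm x \<le> C * norm (shiftK T z x)"
proof (rule ccontr)
  assume neg: "\<not> ?thesis"
  have "\<exists>z x. z \<in> Z \<and> norm x > real (Suc n) * norm (shiftK T z x)" for n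
    using neg[simplified, rule_format, of "real (Suc n)"] by (force simp: not_le)
  then obtain z x where zx: "\<And>n. z n \<in> Z" "\<And>n. norm (x n) > real (Suc n) * norm (shiftK T (z n) (x n))"
    by metis
  obtain l s where l: "l \<in> Z" "strict_mono s" "(z \<circ> s) \<longlonglongrightarrow> l"
    using Z(1) zx(1) unfolding compact_def by metis
  have "bounded_invertibleK (shiftK T l)" using l(1) Z(2) by (auto simp: spectrumK_def)
  then obtain C where C: "C > 0" "\<And>x. norm x \<le> C * norm (shiftK T l x)" using bounded_invertibleKD(6) by blast
  obtain N where N: "\<And>n. n \<ge> N \<Longrightarrow> dist (z (s n)) l < 1 / (2 * C)"
    using metric_LIMSEQ_D[OF l(3), of "1 / (2 * C)"] C(1) by (auto simp: o_def)
  \<comment> \<open>Far enough along the subsequence for both requirements: \<open>z m\<close> is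
    within 1 / (2 C) of \<open>l\<close>, and the violated constant \<open>Suc m\<close> exceeds 2
    C.\<close>
  define m where "m = s (max N (nat \<lceil>2 * C\<rceil>))"
  have "nat \<lceil>2 * C\<rceil> \<le> m"
    using seq_suble[OF l(2), of "max N (nat \<lceil>2 * C\<rceil>)"] unfolding m_def by linarith
  then have m: "2 * C < real (Suc m)" by linarith
  have dist: "C * cmod (l - z m) \<le> 1 / 2"
    using N[of "max N (nat \<lceil>2 * C\<rceil>)"] C(1) unfolding m_def
    by (simp add: dist_norm norm_minus_commute field_simps)
  let ?y = "x m"
  have "shiftK T l ?y = shiftK T (z m) ?y + scaleK (l - z m) ?y"
    by (simp add: shiftK_def K.scale_left_diff_distrib)
  then have "norm (shiftK T l ?y) \<le> norm (shiftK T (z m) ?y) + cmod (l - z m) * norm ?y"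
    by (metis norm_scaleK norm_triangle_ineq)
  then have "C * norm (shiftK T l ?y) \<le> C * (norm (shiftK T (z m) ?y) + cmod (l - z m) * norm ?y)"
    using C(1) by (intro mult_left_mono) auto
  also have "\<dots> = C * norm (shiftK T (z m) ?y) + (C * cmod (l - z m)) * norm ?y"
    by (simp add: algebra_simps)
  also have "\<dots> \<le> C * norm (shiftK T (z m) ?y) + 1 / 2 * norm ?y"
    using mult_right_mono[OF dist, of "norm ?y"] by simp
  finally have "norm ?y \<le> 2 * C * norm (shiftK T (z m) ?y)" using C(2)[of ?y] by linarith
  also have "\<dots> \<le> real (Suc m) * norm (shiftK T (z m) ?y)"
    using m by (intro mult_right_mono) auto
  finally show False using zx(2)[of m] by simp
qed

section \<open>Riesz representation, adjoints and the indefinite form\<close>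

text \<open>The representing vector is a multiple of the element of least norm in the hyperplane f =
  1. It exists by completeness and the parallelogram law, and minimality makes it orthogonal to the
  kernel of \<open>f\<close>.\<close>

lemma riesz_representation:
  fixes f :: "'h::chilbert \<times> 'h \<Rightarrow> complex"
  assumes add: "\<And>x y. f (x + y) = f x + f y" and scale: "\<And>c x. f (scaleK c x) = c * f x"
    and bound: "\<And>x. cmod (f x) \<le> C * norm x"
  shows "\<exists>z. \<forall>x. f x = cinnerK z x"
proof (cases "\<forall>x. f x = 0")
  case True
  then show ?thesis by (intro exI[of _ 0]) simp
next
  case False
  then obtain v where "f v \<noteq> 0" by blast
  then have v: "f (scaleK (1 / f v) v) = 1" by (simp add: scale)
  have fdiff: "f (x - y) = f x - f y" for x y
    using add[of "x - y" y] by simp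
  define S where "S = {x. f x = 1}"
  define m where "m = Inf (norm ` S)"
  have S0: "S \<noteq> {}" using v unfolding S_def by blast
  have bdd: "bdd_below (norm ` S)" by (rule bdd_belowI[of _ 0]) auto
  have m_le: "m \<le> norm x" if "x \<in> S" for x
    unfolding m_def using that bdd by (intro cINF_lower)
  have m0: "0 \<le> m" unfolding m_def using S0 by (intro cINF_greatest) auto
  have "\<exists>x\<in>S. norm x < m + 1 / real (Suc n)" for n
    using cInf_lessD[of "norm ` S" "m + 1 / real (Suc n)"] S0 unfolding m_def by auto
  then obtain x where x: "\<And>n. x n \<in> S" "\<And>n. norm (x n) < m + 1 / real (Suc n)" by metis
  have para: "(norm (a - b))\<^sup>2 = 2 * (norm a)\<^sup>2 + 2 * (norm b)\<^sup>2 - (norm (a + b))\<^sup>2" for a b :: "'h \<times> 'h"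
    unfolding H_q[symmetric] H.q_def by (simp add: H.B_add_left H.B_add_right H.B_diff_left H.B_diff_right)
  \<comment> \<open>The midpoint of \<open>x j\<close> and \<open>x k\<close> again satisfies f = 1,
    so its norm is at least m; the parallelogram law turns this into a bound on the
    distance.\<close>
  have close: "(norm (x j - x k))\<^sup>2 \<le> (8 * m + 4) * (1 / real (Suc n))" if "n \<le> j" "n \<le> k" for j k n
  proof -
    let ?e = "1 / real (Suc n)"
    have e: "0 \<le> ?e" "?e \<le> 1" by auto
    have le: "(norm (x i))\<^sup>2 \<le> (m + ?e)\<^sup>2" if "n \<le> i" for i
    proof (rule power_mono)
      have "1 / real (Suc i) \<le> ?e" using that by (simp add: frac_le)
      then show "norm (x i) \<le> m + ?e" using x(2)[of i] by linarith
    qed simp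
    have "scaleK (1 / 2) (x j + x k) \<in> S" using x(1) by (simp add: S_def scale add)
    then have "2 * m \<le> norm (x j + x k)" using m_le[of "scaleK (1 / 2) (x j + x k)"] by (simp add: norm_scaleK)
    then have "(2 * m)\<^sup>2 \<le> (norm (x j + x k))\<^sup>2" using m0 by (intro power_mono) auto
    then have "(norm (x j - x k))\<^sup>2 \<le> 4 * (m + ?e)\<^sup>2 - (2 * m)\<^sup>2"
      unfolding para using le[OF that(1)] le[OF that(2)] by linarith
    also have "\<dots> = 8 * m * ?e + 4 * (?e * ?e)" by (simp add: power2_eq_square algebra_simps)
    also have "\<dots> \<le> 8 * m * ?e + 4 * ?e"
      using mult_left_mono[OF e(2) e(1)] by simp
    finally show ?thesis by (simp only: distrib_right)
  qed
  have "Cauchy x"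
  proof (rule metric_CauchyI)
    fix e :: real assume e: "0 < e"
    obtain n where n: "(8 * m + 4) / e\<^sup>2 < real (Suc n)"
      using reals_Archimedean2 by (metis less_trans of_nat_less_iff lessI)
    then have n': "(8 * m + 4) * (1 / real (Suc n)) < e\<^sup>2"
      using e by (simp add: field_simps)
    show "\<exists>M. \<forall>j\<ge>M. \<forall>k\<ge>M. dist (x j) (x k) < e"
    proof (intro exI allI impI)
      fix j k assume "n \<le> j" "n \<le> k"
      then have "(norm (x j - x k))\<^sup>2 < e\<^sup>2" using close n' by (meson le_less_trans)
      then show "dist (x j) (x k) < e" using e by (simp add: dist_norm power2_less_imp_less)
    qed
  qed
  then obtain y where y: "x \<longlonglongrightarrow> y" using Cauchy_convergent_iff convergentD by blast
  have "bounded_linear f"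
    by (rule bounded_linear_intro[of _ C])
      (use add scale bound in \<open>auto simp: scaleK_of_real[symmetric] scaleR_conv_of_real mult.commute\<close>)
  then have "(\<lambda>n. f (x n)) \<longlonglongrightarrow> f y" by (rule bounded_linear.tendsto[OF _ y])
  moreover have "f (x n) = 1" for n using x(1)[of n] by (simp add: S_def)
  ultimately have fy: "f y = 1" by (simp add: LIMSEQ_const_iff)
  have "(\<lambda>n. m + 1 / real (Suc n)) \<longlonglongrightarrow> m + 0"
    by (intro tendsto_intros LIMSEQ_Suc[OF lim_1_over_n])
  then have ny: "norm y \<le> m"
    using tendsto_le[OF _ _ tendsto_norm[OF y], of _ "m + 0"] x(2) by (simp add: less_imp_le)
  \<comment> \<open>Removing from \<open>y\<close> its component along \<open>w\<close> stays in the
    hyperplane and would shorten \<open>y\<close> unless that component is zero.\<close>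
  have orth: "cinnerK y w = 0" if w: "f w = 0" for w
  proof (cases "w = 0")
    case False
    define c where "c = cinnerK w y / of_real ((norm w)\<^sup>2)"
    have nw: "(norm w)\<^sup>2 > 0" using False by simp
    have wy: "cinnerK w y = c * of_real ((norm w)\<^sup>2)" using False by (simp add: c_def)
    have yw: "cinnerK y w = cnj c * of_real ((norm w)\<^sup>2)" using H.B_cnj[of w y] by (simp add: wy)
    have "y - scaleK c w \<in> S" using fy w by (simp add: S_def fdiff scale)
    then have "norm y \<le> norm (y - scaleK c w)" using ny m_le by (meson order_trans)
    then have "(norm y)\<^sup>2 \<le> (norm (y - scaleK c w))\<^sup>2" by (intro power_mono) auto
    moreover have "complex_of_real ((norm (y - scaleK c w))\<^sup>2) = of_real ((norm y)\<^sup>2 - (cmod c)\<^sup>2 * (norm w)\<^sup>2)"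
    proof -
      have "complex_of_real ((norm (y - scaleK c w))\<^sup>2)
          = of_real ((norm y)\<^sup>2) - c * cinnerK y w - cnj c * cinnerK w y + cnj c * c * of_real ((norm w)\<^sup>2)"
        by (simp add: cinnerK_self[symmetric] H.B_diff_left H.B_diff_right H.B_scale_left H.B_scale_right
            algebra_simps del: of_real_power)
      then show ?thesis
        unfolding wy yw by (simp add: complex_norm_square[of c, unfolded of_real_power] algebra_simps)
    qed
    ultimately have "(cmod c)\<^sup>2 * (norm w)\<^sup>2 \<le> 0" by (simp only: of_real_eq_iff)
    then have "c = 0" using nw by (simp add: mult_le_0_iff)
    then show ?thesis by (simp add: yw)
  qed (use H.B_zero_right[of y] in simp)
  have y0: "y \<noteq> 0" using fy scale[of 0 0] by auto
  have "f u = cinnerK (scaleK (1 / of_real ((norm y)\<^sup>2)) y) u" for u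
  proof -
    have "cinnerK y (u - scaleK (f u) y) = 0" by (rule orth) (simp add: fdiff scale fy)
    then have "cinnerK y u = f u * of_real ((norm y)\<^sup>2)"
      by (simp add: H.B_diff_right H.B_scale_right cinnerK_self del: of_real_power)
    then show ?thesis using y0 by (simp add: H.B_scale_left)
  qed
  then show ?thesis by blast
qed

text \<open>The \<open>SOME\<close> in \<open>adjointK\<close> is meaningful only if an adjoint
  exists; representing the functionals x \<mapsto> <y, T x> supplies one.\<close>

lemma adjointK_works:
  assumes "boundedK T" shows "cinnerK (T x) y = cinnerK x (adjointK T y)"
proof -
  have lin: "clinearK T" using assms by (simp add: boundedK_def)
  obtain C where C: "\<And>x. norm (T x) \<le> C * norm x" using assms by (auto simp: boundedK_def)
  have "\<exists>z. \<forall>x. cinnerK y (T x) = cinnerK z x" for y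
  proof (rule riesz_representation)
    show "cinnerK y (T (a + b)) = cinnerK y (T a) + cinnerK y (T b)" for a b
      by (simp add: clinearKD[OF lin] H.B_add_right)
    show "cinnerK y (T (scaleK c a)) = c * cinnerK y (T a)" for c a
      by (simp add: clinearKD[OF lin] H.B_scale_right)
    show "cmod (cinnerK y (T a)) \<le> (norm y * C) * norm a" for a
      using cinnerK_Cauchy_Schwarz[of y "T a"] mult_left_mono[OF C[of a], of "norm y"] by simp
  qed
  then obtain S where S: "\<And>y x. cinnerK y (T x) = cinnerK (S y) x" by metis
  have "\<forall>x y. cinnerK (T x) y = cinnerK x (S y)" using S H.B_cnj by metis
  then show ?thesis
    unfolding adjointK_def using someI[of "\<lambda>S. \<forall>x y. cinnerK (T x) y = cinnerK x (S y)" S] by blast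
qed

text \<open>The adjoint disappears from the development here: later arguments see a bounded
  bijection that preserves the form.\<close>

lemma J_unitary_form:
  assumes "J_unitary T" shows "cinnerK (T x) (Jop (T y)) = cinnerK x (Jop y)"
proof -
  have "adjointK T (Jop (T y)) = Jop y"
    using assms unfolding J_unitary_def by (metis comp_apply)
  then show ?thesis
    using adjointK_works[of T x "Jop (T y)"] assms by (simp add: J_unitary_def bounded_invertibleK_def)
qed

interpretation J: hermitian_space "scaleK :: complex \<Rightarrow> 'h::chilbert \<times> 'h \<Rightarrow> 'h \<times> 'h" "\<lambda>x y. cinnerK x (Jop y)"
proof unfold_locales
  fix x y z :: "'h \<times> 'h" and c
  have add: "Jop (y + z) = Jop y + Jop z" by (simp add: Jop_def)
  have sc: "Jop (scaleK c y) = scaleK c (Jop y)"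
    using K.scale_minus_right[of c "(0, snd y)"] by (simp add: Jop_def scaleK_def)
  show "cinnerK x (Jop (y + z)) = cinnerK x (Jop y) + cinnerK x (Jop z)"
    by (simp add: add H.B_add_right)
  show "cinnerK x (Jop (scaleK c y)) = c * cinnerK x (Jop y)"
    by (simp add: sc H.B_scale_right)
  have "cinnerK x (Jop y) = cinnerK (Jop x) y"
    using H.B_minus_right[of "(0, snd x)" "(0, snd y)"] H.B_minus_left[of "(0, snd x)" "(0, snd y)"]
    by (simp add: Jop_def cinnerK_def cinner_zero_left)
  then show "cnj (cinnerK x (Jop y)) = cinnerK y (Jop x)" using H.B_cnj[of "Jop x" y] by simp
qed

lemma norm_Jop: "norm (Jop x) = norm x"
  by (cases x) (simp add: Jop_def norm_Pair)

section \<open>Riesz projections\<close>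

text \<open>Equidistant left-endpoint sums, whose nodes on a circle are roots of unity. Uniform
  continuity bounds the error on each of the N pieces by \<open>L / real N * e'\<close>, and the
  induction accumulates these to \<open>L * e'\<close>.\<close>

lemma riemann_sum_tendsto:
  fixes f :: "real \<Rightarrow> 'a::banach"
  assumes f: "continuous_on {0..L} f" and L: "0 < L"
  shows "(\<lambda>N. (L / real N) *\<^sub>R (\<Sum>k<N. f (L * real k / real N))) \<longlonglongrightarrow> integral {0..L} f"
proof (rule LIMSEQ_I)
  fix e :: real assume e: "0 < e"
  define e' where "e' = e / (2 * L)"
  have e': "0 < e'" "L * e' < e" using e L by (auto simp: e'_def)
  have "uniformly_continuous_on {0..L} f" using f by (simp add: compact_uniformly_continuous)
  then obtain d where d: "0 < d" "\<And>x y. x \<in> {0..L} \<Longrightarrow> y \<in> {0..L} \<Longrightarrow> dist y x < d \<Longrightarrow> dist (f y) (f x) < e'"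
    unfolding uniformly_continuous_on_def using e'(1) by meson
  obtain N0 :: nat where N0: "L / d < real N0" using reals_Archimedean2 by blast
  show "\<exists>N0. \<forall>N\<ge>N0. norm ((L / real N) *\<^sub>R (\<Sum>k<N. f (L * real k / real N)) - integral {0..L} f) < e"
  proof (intro exI allI impI)
    fix N assume N: "N0 \<le> N"
    have "0 < L / d" using L d by simp
    with N0 N have N': "L / d < real N" "0 < real N" by linarith+
    then have Nd: "L / real N < d" using d by (simp add: field_simps)
    define t where "t k = L * real k / real N" for k
    have t0: "t 0 = 0" and tN: "t N = L" using N' by (auto simp: t_def)
    have tS: "t (Suc k) = t k + L / real N" for k by (simp add: t_def add_divide_distrib distrib_left)
    have t_le: "t k \<le> L" if "k \<le> N" for k
      using that L N' by (simp add: t_def field_simps)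
    have t_ge: "0 \<le> t k" for k using L by (simp add: t_def)
    have "norm ((L / real N) *\<^sub>R (\<Sum>i<k. f (t i)) - integral {0..t k} f) \<le> real k * (L / real N * e')" if "k \<le> N" for k
      using that
    proof (induction k)
      case 0
      then show ?case by (simp add: t0)
    next
      case (Suc k)
      have le: "t k \<le> t (Suc k)" using L by (simp add: tS)
      have sub: "{t k..t (Suc k)} \<subseteq> {0..L}" "{0..t (Suc k)} \<subseteq> {0..L}"
        using t_ge[of k] t_le[OF Suc.prems] by auto
      have c: "continuous_on {t k..t (Suc k)} f" "continuous_on {0..t (Suc k)} f"
        using continuous_on_subset[OF f] sub by blast+
      have comb: "integral {0..t k} f + integral {t k..t (Suc k)} f = integral {0..t (Suc k)} f"
        by (rule Henstock_Kurzweil_Integration.integral_combine[OF t_ge le])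
          (rule integrable_continuous_real[OF c(2)])
      have "integral {t k..t (Suc k)} (\<lambda>x. f (t k) - f x) = (t (Suc k) - t k) *\<^sub>R f (t k) - integral {t k..t (Suc k)} f"
        using le by (subst integral_diff) (auto intro: integrable_continuous_real c)
      moreover have "norm (integral {t k..t (Suc k)} (\<lambda>x. f (t k) - f x)) \<le> e' * (t (Suc k) - t k)"
      proof (rule integral_bound[OF le])
        show "continuous_on {t k..t (Suc k)} (\<lambda>x. f (t k) - f x)" by (intro continuous_intros c)
        fix x assume x: "x \<in> {t k..t (Suc k)}"
        then have "dist (t k) x < d" using Nd by (simp add: tS dist_real_def)
        moreover have "x \<in> {0..L}" "t k \<in> {0..L}" using x sub le by auto
        ultimately have "dist (f (t k)) (f x) < e'" by (intro d(2))
        then show "norm (f (t k) - f x) \<le> e'" by (simp add: dist_norm)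
      qed
      ultimately have step: "norm ((L / real N) *\<^sub>R f (t k) - integral {t k..t (Suc k)} f) \<le> L / real N * e'"
        by (simp add: tS mult.commute)
      have "(L / real N) *\<^sub>R (\<Sum>i<Suc k. f (t i)) - integral {0..t (Suc k)} f
          = ((L / real N) *\<^sub>R (\<Sum>i<k. f (t i)) - integral {0..t k} f)
            + ((L / real N) *\<^sub>R f (t k) - integral {t k..t (Suc k)} f)"
        by (simp add: comb[symmetric] scaleR_add_right)
      also have "norm \<dots> \<le> real k * (L / real N * e') + L / real N * e'"
        by (rule norm_triangle_le, rule add_mono[OF Suc.IH step]) (use Suc.prems in simp)
      also have "\<dots> = real (Suc k) * (L / real N * e')" by (simp add: algebra_simps add_divide_distrib)
      finally show ?case .
    qed
    from this[of N] have "norm ((L / real N) *\<^sub>R (\<Sum>k<N. f (t k)) - integral {0..L} f) \<le> L * e'"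
      using N' by (simp add: tN)
    then show "norm ((L / real N) *\<^sub>R (\<Sum>k<N. f (L * real k / real N)) - integral {0..L} f) < e"
      using e'(2) by (simp add: t_def)
  qed
qed

lemma LIMSEQ_unique_eventually:
  fixes l m :: "'a::t2_space"
  assumes "f \<longlonglongrightarrow> l" "g \<longlonglongrightarrow> m" "\<forall>\<^sub>F n in sequentially. f n = g n"
  shows "l = m"
  using LIMSEQ_unique[OF _ assms(2)] assms(1) tendsto_cong[OF assms(3)] by blast

text \<open>A geometric sum whose ratio is an N-th root of unity different from 1. Averaging over
  the roots thus isolates the exponent 0.\<close>

lemma sum_roots_of_unity_power:
  assumes "j < N"
  shows "(\<Sum>k<N. cis (- (2 * pi * real k / real N)) ^ j) = (if j = 0 then of_nat N else 0)"
proof (cases "j = 0")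
  case False
  define z where "z = cis (- (2 * pi * real j / real N))"
  have N: "0 < N" using assms by simp
  have "inj_on (\<lambda>k. cis (2 * pi * real k / real N)) {..<N}"
    using Complex.bij_betw_roots_unity[OF N] by (simp add: bij_betw_def)
  from inj_onD[OF this, of j 0] have "cis (2 * pi * real j / real N) \<noteq> 1" using assms False by auto
  then have z1: "z \<noteq> 1" unfolding z_def using cis_cnj by (metis complex_cnj_one complex_cnj_cnj)
  have "z ^ N = cis (real N * (- (2 * pi * real j / real N)))" unfolding z_def by (rule Complex.DeMoivre)
  also have "real N * (- (2 * pi * real j / real N)) = - (2 * pi * real j)" using N by simp
  also have "cis (- (2 * pi * real j)) = 1"
    using cis_cnj[of "2 * pi * real j"] cis_multiple_2pi[of "real j"] by simp
  finally have zN: "z ^ N = 1" .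
  have "(\<Sum>k<N. cis (- (2 * pi * real k / real N)) ^ j) = (\<Sum>k<N. z ^ k)"
    unfolding z_def Complex.DeMoivre by (rule sum.cong[OF refl], rule arg_cong[of _ _ cis]) simp
  also have "\<dots> = 0" using geometric_sum[OF z1, of N] by (simp add: zN)
  finally show ?thesis using False by simp
qed simp

text \<open>Second resolvent identity: with y = S'^-1 v and x = S^-1 v one has S (y - x) = (S - S')
  y.\<close>

lemma resolvent_difference:
  assumes S: "bounded_invertibleK S" and S': "bounded_invertibleK S'"
    and C: "\<And>x. norm x \<le> C * norm (S x)" "0 < C" and C': "\<And>x. norm x \<le> C' * norm (S' x)"
    and e: "\<And>x. norm (S' x - S x) \<le> e * norm x" "0 \<le> e"
  shows "norm (inv_into UNIV S' v - inv_into UNIV S v) \<le> C * e * C' * norm v"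
proof -
  note Sd = bounded_invertibleKD[OF S] and S'd = bounded_invertibleKD[OF S']
  have lin: "clinearK S" using Sd(1) by (simp add: boundedK_def)
  let ?x = "inv_into UNIV S v" and ?y = "inv_into UNIV S' v"
  have "S (?y - ?x) = S ?y - S' ?y" by (simp add: clinearKD[OF lin] Sd(4) S'd(4))
  then have "norm (?y - ?x) \<le> C * norm (S ?y - S' ?y)" using C(1) by metis
  also have "\<dots> \<le> C * (e * norm ?y)"
    using C(2) e(1) by (intro mult_left_mono) (auto simp: norm_minus_commute)
  also have "\<dots> \<le> C * (e * (C' * norm v))"
    using C'[of ?y] C(2) e(2) by (intro mult_left_mono) (auto simp: S'd(4))
  finally show ?thesis by (simp add: mult_ac)
qed

text \<open>Only the circle itself is constrained; the spectrum inside is arbitrary. This allows the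
  circles drawn around eigenvalues of one operator to be reused for a nearby operator whose
  eigenvalues have moved.\<close>

locale riesz_circle =
  fixes T :: "'h::chilbert \<times> 'h \<Rightarrow> 'h \<times> 'h" and \<mu> :: complex and r C :: real
  assumes T: "boundedK T" and r: "0 < r" and C: "0 < C"
    and inv: "\<And>t. bounded_invertibleK (shiftK T (\<mu> + of_real r * cis t))"
    and low: "\<And>t x. norm x \<le> C * norm (shiftK T (\<mu> + of_real r * cis t) x)"
begin

abbreviation pt :: "real \<Rightarrow> complex" where "pt t \<equiv> \<mu> + of_real r * cis t"
abbreviation R :: "real \<Rightarrow> 'h \<times> 'h \<Rightarrow> 'h \<times> 'h" where "R t \<equiv> inv_into UNIV (shiftK T (pt t))"
abbreviation P :: "'h \<times> 'h \<Rightarrow> 'h \<times> 'h" where "P \<equiv> riesz_proj_r T \<mu> r"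

text \<open>Riemann sum of the Riesz integral at N equidistant angles; the factor 1 / N is the step
  2 pi / N times the normalisation 1 / (2 pi).\<close>

definition X :: "nat \<Rightarrow> 'h \<times> 'h \<Rightarrow> 'h \<times> 'h" where
  "X N v = (1 / real N) *\<^sub>R (\<Sum>k<N. scaleK (of_real r * cis (2 * pi * real k / real N)) (R (2 * pi * real k / real N) v))"

text \<open>Rescaling of the circle to the unit circle: \<open>shiftK T (pt t)\<close> is r times
  \<open>cis t\<close> minus \<open>A\<close>.\<close>

definition A :: "'h \<times> 'h \<Rightarrow> 'h \<times> 'h" where
  "A x = scaleK (1 / of_real r) (T x - scaleK \<mu> x)"

lemma linT: "clinearK T" using T by (simp add: boundedK_def)

lemma R_simps: "shiftK T (pt t) (R t x) = x" "R t (shiftK T (pt t) x) = x"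
  using bounded_invertibleKD[OF inv] by auto

lemma R_linear: "clinearK (R t)"
  using bounded_invertibleKD(3)[OF inv] by (simp add: boundedK_def)

lemma R_norm: "norm (R t v) \<le> C * norm v"
  using low[of "R t v" t] by (simp add: R_simps)

lemma R_lipschitz: "norm (R s v - R t v) \<le> C * cmod (pt s - pt t) * C * norm v"
  by (rule resolvent_difference[OF inv inv low C low])
    (simp_all add: shiftK_def norm_scaleK K.scale_left_diff_distrib[symmetric])

lemma R_continuous: "continuous_on S (\<lambda>t. R t v)"
proof -
  have "((\<lambda>s. R s v) \<longlongrightarrow> R t v) (at t)" for t
  proof (rule LIM_zero_cancel, rule Lim_null_comparison)
    show "\<forall>\<^sub>F s in at t. norm (R s v - R t v) \<le> C * cmod (pt s - pt t) * C * norm v"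
      by (intro always_eventually allI R_lipschitz)
    have "((\<lambda>s. C * cmod (pt s - pt t) * C * norm v) \<longlongrightarrow> C * cmod (pt t - pt t) * C * norm v) (at t)"
      by (intro tendsto_intros)
    then show "((\<lambda>s. C * cmod (pt s - pt t) * C * norm v) \<longlongrightarrow> 0) (at t)" by simp
  qed
  then show ?thesis
    unfolding continuous_on_def by (meson subset_UNIV tendsto_within_subset)
qed

lemma integrand_continuous: "continuous_on S (\<lambda>t. scaleK (of_real r * cis t) (R t v))"
  by (intro scaleK.continuous_on R_continuous continuous_intros)

lemma X_tendsto_P: "(\<lambda>N. X N v) \<longlonglongrightarrow> P v"
proof -
  have "(\<lambda>N. (1 / (2 * pi)) *\<^sub>R ((2 * pi / real N) *\<^sub>R (\<Sum>k<N. scaleK (of_real r * cis (2 * pi * real k / real N)) (R (2 * pi * real k / real N) v)))) \<longlonglongrightarrow> P v"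
    unfolding riesz_proj_r_def
    by (intro tendsto_scaleR tendsto_const riemann_sum_tendsto integrand_continuous) simp
  then show ?thesis by (simp add: X_def[abs_def])
qed

lemma X_linear: "clinearK (X N)"
  by (rule clinearKI)
    (simp_all add: X_def clinearKD[OF R_linear] K.scale_right_distrib sum.distrib scaleR_add_right
      scaleK_of_real[symmetric] K.scale_sum_right mult_ac)

lemma X_norm: "norm (X N v) \<le> r * C * norm v"
proof (cases "N = 0")
  case False
  have "norm (\<Sum>k<N. scaleK (of_real r * cis (2 * pi * real k / real N)) (R (2 * pi * real k / real N) v))
      \<le> (\<Sum>k<N. r * (C * norm v))"
    using r R_norm by (intro sum_norm_le) (auto simp: norm_scaleK norm_mult intro!: mult_left_mono)
  then show ?thesis using False by (simp add: X_def field_simps)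
qed (use r C in \<open>simp add: X_def\<close>)

lemma P_linear: "clinearK P"
proof (rule clinearKI)
  fix x y :: "'h \<times> 'h" and c
  have "(\<lambda>N. X N x + X N y) \<longlonglongrightarrow> P x + P y" by (intro tendsto_add X_tendsto_P)
  then show "P (x + y) = P x + P y"
    using LIMSEQ_unique X_tendsto_P[of "x + y"] by (simp add: clinearKD[OF X_linear])
  have "(\<lambda>N. scaleK c (X N x)) \<longlonglongrightarrow> scaleK c (P x)" by (intro scaleK.tendsto tendsto_const X_tendsto_P)
  then show "P (scaleK c x) = scaleK c (P x)"
    using LIMSEQ_unique X_tendsto_P[of "scaleK c x"] by (simp add: clinearKD[OF X_linear])
qed

lemma R_commute:
  assumes S: "clinearK S" "\<And>x. S (T x) = T (S x)"
  shows "R t (S x) = S (R t x)"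
proof -
  have "S x = S (shiftK T (pt t) (R t x))" by (simp add: R_simps)
  also have "\<dots> = shiftK T (pt t) (S (R t x))" by (simp add: shiftK_def clinearKD[OF S(1)] S(2))
  finally show ?thesis by (simp add: R_simps)
qed

lemma X_commute:
  assumes S: "clinearK S" "\<And>x. S (T x) = T (S x)"
  shows "X N (S x) = S (X N x)"
  by (simp add: X_def R_commute[OF S] clinearKD[OF S(1)] scaleK_of_real[symmetric])

lemma P_commute:
  assumes S: "boundedK S" "\<And>x. S (T x) = T (S x)"
  shows "P (S x) = S (P x)"
proof -
  have lin: "clinearK S" using S(1) by (simp add: boundedK_def)
  have "(\<lambda>N. S (X N x)) \<longlonglongrightarrow> S (P x)"
    by (rule bounded_linear.tendsto[OF boundedK_bounded_linear[OF S(1)] X_tendsto_P])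
  then show ?thesis using LIMSEQ_unique X_tendsto_P[of "S x"] by (simp add: X_commute[OF lin S(2)])
qed

lemma P_T: "P (T x) = T (P x)"
  by (rule P_commute[OF T refl])

lemma A_linear: "clinearK A"
  by (rule clinearKI) (simp_all add: A_def clinearKD[OF linT] K.scale_right_distrib K.scale_right_diff_distrib mult_ac)

lemma A_power_linear: "clinearK (A ^^ n)"
  by (induction n) (auto simp: clinearK_def clinearKD[OF A_linear])

lemma A_power_T: "(A ^^ n) (T x) = T ((A ^^ n) x)"
  by (induction n) (auto simp: A_def clinearKD[OF linT])

lemma X_A_power: "X N ((A ^^ n) x) = (A ^^ n) (X N x)"
  by (rule X_commute[OF A_power_linear A_power_T])

text \<open>In terms of \<open>A\<close> the integrand is (1 - exp(-it) A)^-1 v, to which a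
  geometric series applies.\<close>

lemma integrand_eq:
  fixes t v defines "y \<equiv> scaleK (of_real r * cis t) (R t v)"
  shows "y - scaleK (cis (- t)) (A y) = v"
proof -
  have "scaleK (cis (- t)) (A y) = scaleK (cis (- t) * (1 / of_real r) * (of_real r * cis t)) (T (R t v) - scaleK \<mu> (R t v))"
    by (simp add: y_def A_def clinearKD[OF linT] K.scale_right_diff_distrib mult_ac)
  also have "cis (- t) * (1 / of_real r) * (of_real r * cis t) = 1"
    using r by (simp add: cis_mult)
  finally have "y - scaleK (cis (- t)) (A y) = shiftK T (pt t) (R t v)"
    by (simp add: y_def shiftK_def K.scale_left_distrib)
  then show ?thesis by (simp add: R_simps)
qed

text \<open>Finite geometric series for w A. When w is an n-th root of unity, the left side becomes
  \<open>y - (A ^^ n) y\<close>, the same operator for every such w.\<close>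

lemma telescope:
  assumes "y - scaleK w (A y) = v"
  shows "y - scaleK (w ^ n) ((A ^^ n) y) = (\<Sum>j<n. scaleK (w ^ j) ((A ^^ j) v))"
proof (induction n)
  case (Suc n)
  have "scaleK (w ^ n) ((A ^^ n) v) = scaleK (w ^ n) ((A ^^ n) y) - scaleK (w ^ Suc n) ((A ^^ Suc n) y)"
    by (simp add: assms[symmetric] clinearKD[OF A_power_linear] K.scale_right_diff_distrib funpow_swap1 mult.commute)
  then have "y - scaleK (w ^ Suc n) ((A ^^ Suc n) y)
      = (y - scaleK (w ^ n) ((A ^^ n) y)) + scaleK (w ^ n) ((A ^^ n) v)"
    by (simp only: diff_add_cancel add_diff_eq)
  then show ?case by (simp only: Suc.IH sum.lessThan_Suc)
qed simp

text \<open>The Riemann sums of the Riesz integral at the N-th roots of unity are exactly the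
inverses of 1 - A^N. All properties of the Riesz projection are read off from this.\<close>
lemma X_right_inverse:
  assumes N: "0 < N" shows "X N v - (A ^^ N) (X N v) = v"
proof -
  define t where "t k = 2 * pi * real k / real N" for k
  define y where "y k = scaleK (of_real r * cis (t k)) (R (t k) v)" for k
  have X: "X N v = (1 / real N) *\<^sub>R (\<Sum>k<N. y k)" by (simp add: X_def y_def t_def)
  have y: "y k - (A ^^ N) (y k) = (\<Sum>j<N. scaleK (cis (- t k) ^ j) ((A ^^ j) v))" for k
  proof -
    have "cis (- t k) ^ N = cis (- (2 * pi * real k))"
      unfolding t_def Complex.DeMoivre using N by (intro arg_cong[of _ _ cis]) simp
    also have "\<dots> = 1" using cis_cnj[of "2 * pi * real k"] cis_multiple_2pi[of "real k"] by simp
    finally show ?thesis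
      using telescope[OF integrand_eq[of "t k" v], of N] by (simp add: y_def)
  qed
  have "X N v - (A ^^ N) (X N v) = (1 / real N) *\<^sub>R (\<Sum>k<N. y k - (A ^^ N) (y k))"
    by (simp add: X scaleK_of_real[symmetric] clinearKD[OF A_power_linear] K.scale_right_diff_distrib sum_subtractf)
  \<comment> \<open>After interchanging the sums, the inner sum over the roots of unity removes
    every power of \<open>A\<close> except the zeroth.\<close>
  also have "\<dots> = (1 / real N) *\<^sub>R (\<Sum>j<N. scaleK (\<Sum>k<N. cis (- t k) ^ j) ((A ^^ j) v))"
    unfolding y K.scale_sum_left by (subst sum.swap) simp
  also have "\<dots> = (1 / real N) *\<^sub>R (\<Sum>j<N. if j = 0 then scaleK (of_nat N) v else 0)"
    by (intro arg_cong[of _ _ "\<lambda>x. (1 / real N) *\<^sub>R x"] sum.cong refl)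
      (auto simp: sum_roots_of_unity_power t_def)
  also have "\<dots> = v"
    using N scaleK_of_real[of "real N" v] by simp
  finally show ?thesis .
qed

lemma X_left_inverse:
  assumes N: "0 < N" shows "X N (v - (A ^^ N) v) = v"
  using X_right_inverse[OF N] by (simp add: clinearKD[OF X_linear] X_A_power)

text \<open>The sums \<open>X N\<close> are bounded by \<open>r * C\<close> uniformly in N, so the
  index and the argument may tend to their limits together.\<close>

lemma X_tendsto:
  assumes u: "u \<longlonglongrightarrow> l" and s: "filterlim s at_top sequentially"
  shows "(\<lambda>n. X (s n) (u n)) \<longlonglongrightarrow> P l"
proof -
  have "(\<lambda>n. X (s n) (u n - l)) \<longlonglongrightarrow> 0"
  proof (rule Lim_null_comparison)
    show "\<forall>\<^sub>F n in sequentially. norm (X (s n) (u n - l)) \<le> r * C * norm (u n - l)"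
      by (intro always_eventually allI X_norm)
    show "(\<lambda>n. r * C * norm (u n - l)) \<longlonglongrightarrow> 0"
      using u by (intro tendsto_mult_right_zero tendsto_norm_zero) (simp add: LIM_zero)
  qed
  moreover have "(\<lambda>n. X (s n) l) \<longlonglongrightarrow> P l" by (rule filterlim_compose[OF X_tendsto_P s])
  ultimately have "(\<lambda>n. X (s n) (u n - l) + X (s n) l) \<longlonglongrightarrow> 0 + P l" by (rule tendsto_add)
  then show ?thesis by (simp add: clinearKD[OF X_linear])
qed

text \<open>With L = 1 - A^N one has 1 - A^(2N) = L (2 - L); inverting and passing to the limit
turns this into P P = P (2 P - 1).\<close>
lemma P_idem: "P (P v) = P v"
proof -
  have 2: "X (2 * N) (scaleK 2 (X N v) - v) = X N (X N v)" if N: "0 < N" for N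
  proof -
    define u w where "u = X N v" and "w = X N u"
    have u: "(A ^^ N) u = u - v" and w: "(A ^^ N) w = w - u"
      using X_right_inverse[OF N, of v] X_right_inverse[OF N, of u] by (simp_all add: u_def w_def algebra_simps)
    have "(A ^^ (2 * N)) w = (A ^^ N) ((A ^^ N) w)" by (simp add: mult_2 funpow_add)
    also have "\<dots> = (w - u) - (u - v)" unfolding w clinearKD[OF A_power_linear] by (simp add: u w)
    also have "\<dots> = w - (scaleK 2 u - v)"
      using K.scale_left_distrib[of 1 1 u] by simp
    finally have "scaleK 2 u - v = w - (A ^^ (2 * N)) w" by simp
    then show ?thesis using X_left_inverse[of "2 * N" w] N by (simp add: u_def w_def)
  qed
  have double: "filterlim (\<lambda>N::nat. 2 * N) at_top sequentially"
    by (rule filterlim_subseq) (simp add: strict_mono_def)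
  have "(\<lambda>N. X (2 * N) (scaleK 2 (X N v) - v)) \<longlonglongrightarrow> P (scaleK 2 (P v) - v)"
    by (rule X_tendsto[OF _ double]) (intro tendsto_intros scaleK.tendsto X_tendsto_P)
  moreover have "(\<lambda>N. X N (X N v)) \<longlonglongrightarrow> P (P v)"
    by (rule X_tendsto[OF X_tendsto_P filterlim_ident])
  moreover have "\<forall>\<^sub>F N in sequentially. X (2 * N) (scaleK 2 (X N v) - v) = X N (X N v)"
    using eventually_gt_at_top[of 0] by eventually_elim (rule 2)
  ultimately have "P (scaleK 2 (P v) - v) = P (P v)"
    by (rule LIMSEQ_unique_eventually)
  then show ?thesis
    using K.scale_left_distrib[of 1 1 "P (P v)"] by (simp add: clinearKD[OF P_linear])
qed

text \<open>On an eigenvector \<open>A\<close> is the scalar \<beta> = (\<nu> - \<mu>) / r, so the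
  Riemann sum is division by 1 - \<beta>^N. The limit is 1 inside the circle and 0 outside.\<close>

lemma X_eigenvector:
  assumes w: "T w = scaleK \<nu> w" and N: "0 < N"
  shows "scaleK (1 - ((\<nu> - \<mu>) / of_real r) ^ N) (X N w) = w"
proof -
  define \<beta> where "\<beta> = (\<nu> - \<mu>) / of_real r"
  have "A w = scaleK \<beta> w" by (simp add: A_def w \<beta>_def K.scale_left_diff_distrib[symmetric])
  then have "(A ^^ N) w = scaleK (\<beta> ^ N) w"
    by (induction N) (simp_all add: clinearKD[OF A_linear] mult.commute)
  then have "(A ^^ N) (X N w) = scaleK (\<beta> ^ N) (X N w)"
    by (simp add: X_A_power[symmetric] clinearKD[OF X_linear])
  then show ?thesis
    using X_right_inverse[OF N, of w] by (simp add: K.scale_left_diff_distrib \<beta>_def)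
qed

lemma P_eigenvector_inside:
  assumes w: "T w = scaleK \<nu> w" and nu: "cmod (\<nu> - \<mu>) < r"
  shows "P w = w"
proof -
  have "cmod ((\<nu> - \<mu>) / of_real r) < 1" using nu r by (simp add: norm_divide)
  then have "(\<lambda>N. ((\<nu> - \<mu>) / of_real r) ^ N) \<longlonglongrightarrow> 0" by (rule LIMSEQ_power_zero)
  then have "(\<lambda>N. scaleK (1 - ((\<nu> - \<mu>) / of_real r) ^ N) (X N w)) \<longlonglongrightarrow> scaleK (1 - 0) (P w)"
    by (intro scaleK.tendsto tendsto_diff tendsto_const X_tendsto_P)
  moreover have "\<forall>\<^sub>F N in sequentially. scaleK (1 - ((\<nu> - \<mu>) / of_real r) ^ N) (X N w) = w"
    using eventually_gt_at_top[of 0] by eventually_elim (rule X_eigenvector[OF w])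
  ultimately have "scaleK (1 - 0) (P w) = w"
    by (rule LIMSEQ_unique_eventually[OF _ tendsto_const])
  then show ?thesis by simp
qed

lemma P_eigenvector_outside:
  assumes w: "T w = scaleK \<nu> w" and nu: "cmod (\<nu> - \<mu>) > r"
  shows "P w = 0"
proof -
  define \<beta> where "\<beta> = (\<nu> - \<mu>) / of_real r"
  have \<beta>: "cmod \<beta> > 1" using nu r by (simp add: norm_divide \<beta>_def)
  then have 0: "(\<lambda>N. inverse \<beta> ^ N) \<longlonglongrightarrow> 0" by (intro LIMSEQ_power_zero) (simp add: norm_inverse inverse_less_1_iff)
  \<comment> \<open>Dividing the identity for \<open>X N w\<close> by \<beta>^N keeps both scalar
    factors convergent, to -1 and to 0.\<close>
  then have "(\<lambda>N. scaleK (inverse \<beta> ^ N - 1) (X N w)) \<longlonglongrightarrow> scaleK (0 - 1) (P w)"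
    by (intro scaleK.tendsto tendsto_diff tendsto_const X_tendsto_P)
  moreover have "scaleK (inverse \<beta> ^ N - 1) (X N w) = scaleK (inverse \<beta> ^ N) w" if N: "0 < N" for N
  proof -
    have "\<beta> \<noteq> 0" using \<beta> by auto
    then have "inverse \<beta> ^ N - 1 = inverse \<beta> ^ N * (1 - \<beta> ^ N)"
      by (simp add: right_diff_distrib power_mult_distrib[symmetric])
    then have "scaleK (inverse \<beta> ^ N - 1) (X N w) = scaleK (inverse \<beta> ^ N) (scaleK (1 - \<beta> ^ N) (X N w))"
      by simp
    also have "scaleK (1 - \<beta> ^ N) (X N w) = w" using X_eigenvector[OF w N] by (simp add: \<beta>_def)
    finally show ?thesis .
  qed
  then have "\<forall>\<^sub>F N in sequentially. scaleK (inverse \<beta> ^ N - 1) (X N w) = scaleK (inverse \<beta> ^ N) w"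
    using eventually_gt_at_top[of 0] by (rule eventually_mono[rotated])
  moreover have "(\<lambda>N. scaleK (inverse \<beta> ^ N) w) \<longlonglongrightarrow> scaleK 0 w"
    by (intro scaleK.tendsto 0 tendsto_const)
  ultimately have "scaleK (0 - 1) (P w) = scaleK 0 w" using LIMSEQ_unique_eventually by blast
  then show ?thesis by simp
qed

text \<open>The solution is a reduced resolvent, up to sign the contour integral of (z - T)^-1 w /
  (z - \<mu>) over 2 pi i. As dz / (z - \<mu>) = i dt on the circle, it is the plain average of
  \<open>R t w\<close>.\<close>

lemma complement_solvable:
  assumes "P w = 0" shows "\<exists>u. P u = 0 \<and> T u - scaleK \<mu> u = w"
proof -
  have int: "(\<lambda>t. R t w) integrable_on {0..2 * pi}"
    by (intro integrable_continuous_real R_continuous)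
  define S where "S x = T x - scaleK \<mu> x" for x
  define I where "I = integral {0..2 * pi} (\<lambda>t. R t w)"
  have bl: "bounded_linear S"
    unfolding S_def by (intro bounded_linear_sub boundedK_bounded_linear[OF T] scaleK.bounded_linear_right)
  \<comment> \<open>T - \<mu> applied to \<open>R t w\<close> restores the weight of the Riesz
    integrand and leaves - w, so integration yields 2 pi (P w - w).\<close>
  have SR: "S (R t w) = scaleK (of_real r * cis t) (R t w) - w" for t
    using R_simps(1)[of t w] by (simp add: S_def shiftK_def K.scale_left_distrib algebra_simps)
  have "S I = integral {0..2 * pi} (\<lambda>t. S (R t w))"
    unfolding I_def using integral_linear[OF int bl] by (simp add: o_def)
  also have "\<dots> = integral {0..2 * pi} (\<lambda>t. scaleK (of_real r * cis t) (R t w)) - (2 * pi) *\<^sub>R w"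
    unfolding SR by (subst integral_diff) (auto intro!: integrable_continuous_real integrand_continuous)
  also have "integral {0..2 * pi} (\<lambda>t. scaleK (of_real r * cis t) (R t w)) = (2 * pi) *\<^sub>R P w"
    by (simp add: riesz_proj_r_def)
  finally have SI: "S I = - ((2 * pi) *\<^sub>R w)" using assms by simp
  define u where "u = - ((1 / (2 * pi)) *\<^sub>R I)"
  have "S u = w"
    unfolding u_def using bl SI by (simp add: linear_simps)
  \<comment> \<open>Because \<open>S\<close> commutes with \<open>P\<close> and
    \<open>P w = 0\<close>, subtracting \<open>P u\<close> moves the solution into the kernel
    without changing its image.\<close>
  moreover have "S (P u) = P (S u)"
    by (simp add: S_def clinearKD[OF P_linear] P_T)
  ultimately have "S (u - P u) = w" using bl assms by (simp add: linear_simps)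
  moreover have "P (u - P u) = 0" by (simp add: clinearKD[OF P_linear] P_idem)
  ultimately show ?thesis unfolding S_def by blast
qed

end

text \<open>The estimate holds termwise for the Riemann sums by \<open>resolvent_difference\<close>,
  uniformly in N, and passes to the limit.\<close>

lemma riesz_proj_r_difference:
  assumes "riesz_circle T \<mu> r C" "riesz_circle T' \<mu> r C'"
    and e: "\<And>x. norm (T' x - T x) \<le> e * norm x" "0 \<le> e"
  shows "norm (riesz_proj_r T' \<mu> r v - riesz_proj_r T \<mu> r v) \<le> r * (C * e * C') * norm v"
proof -
  interpret a: riesz_circle T \<mu> r C by fact
  interpret b: riesz_circle T' \<mu> r C' by fact
  have R: "norm (b.R t v - a.R t v) \<le> C * e * C' * norm v" for t
    by (rule resolvent_difference[OF a.inv b.inv a.low a.C b.low])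
      (use e in \<open>simp_all add: shiftK_def norm_minus_commute\<close>)
  have le: "norm (b.X N v - a.X N v) \<le> r * (C * e * C') * norm v" for N
  proof (cases "N = 0")
    case True
    then show ?thesis using a.r a.C b.C e(2) by (simp add: a.X_def b.X_def)
  next
    case False
    define t where "t k = 2 * pi * real k / real N" for k
    have "b.X N v - a.X N v = (1 / real N) *\<^sub>R (\<Sum>k<N. scaleK (of_real r * cis (t k)) (b.R (t k) v - a.R (t k) v))"
      by (simp add: a.X_def b.X_def t_def scaleR_diff_right[symmetric] sum_subtractf[symmetric] K.scale_right_diff_distrib)
    moreover have "norm (\<Sum>k<N. scaleK (of_real r * cis (t k)) (b.R (t k) v - a.R (t k) v)) \<le> (\<Sum>k<N. r * (C * e * C' * norm v))"
      using a.r by (intro sum_norm_le) (simp add: norm_scaleK norm_mult R[unfolded mult.assoc] mult.assoc)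
    ultimately show ?thesis using False by (simp add: field_simps)
  qed
  have "(\<lambda>N. norm (b.X N v - a.X N v)) \<longlonglongrightarrow> norm (b.P v - a.P v)"
    by (intro tendsto_norm tendsto_diff a.X_tendsto_P b.X_tendsto_P)
  then show ?thesis by (rule Lim_bounded) (simp add: le)
qed

section \<open>Generalized eigenspaces\<close>

text \<open>Free of any contour or radius, and with unbounded height n. For discrete eigenvalues it
  turns out to be the range of the Riesz projection.\<close>

definition gen_eig :: "('h::chilbert \<times> 'h \<Rightarrow> 'h \<times> 'h) \<Rightarrow> complex \<Rightarrow> ('h \<times> 'h) set" where
  "gen_eig T \<mu> = {v. \<exists>n. (shiftK T \<mu> ^^ n) v = 0}"

lemma clinearK_funpow: "clinearK S \<Longrightarrow> clinearK (S ^^ n)"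
proof (induction n)
  case 0
  then show ?case by (simp add: clinearK_def)
next
  case (Suc n)
  then show ?case by (intro clinearKI) (simp_all add: clinearKD[OF Suc.prems] clinearKD[OF Suc.IH[OF Suc.prems]])
qed

lemma funpow_commute:
  assumes "\<And>x. S (T x) = T (S x)" shows "(S ^^ n) (T x) = T ((S ^^ n) x)"
  by (induction n) (auto simp: assms)

lemma shiftK_commute:
  assumes "clinearK S" "\<And>x. S (T x) = T (S x)"
  shows "S (shiftK T z x) = shiftK T z (S x)"
  by (simp add: shiftK_def clinearKD[OF assms(1)] assms(2))

lemma gen_eig_subspace:
  assumes T: "clinearK T" shows "K.subspace (gen_eig T \<mu>)"
proof (rule K.subspaceI)
  note N = clinearK_funpow[OF clinearK_shiftK[OF T, of \<mu>]]
  show "0 \<in> gen_eig T \<mu>" by (auto simp: gen_eig_def clinearKD[OF N])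
  show "scaleK c x \<in> gen_eig T \<mu>" if "x \<in> gen_eig T \<mu>" for c x
    using that by (auto simp: gen_eig_def clinearKD[OF N])
  fix x y assume "x \<in> gen_eig T \<mu>" "y \<in> gen_eig T \<mu>"
  then obtain m n where "(shiftK T \<mu> ^^ m) x = 0" "(shiftK T \<mu> ^^ n) y = 0" by (auto simp: gen_eig_def)
  then have "(shiftK T \<mu> ^^ (n + m)) x = 0" "(shiftK T \<mu> ^^ (m + n)) y = 0"
    by (simp_all only: funpow_add o_apply clinearKD[OF N])
  then have "(shiftK T \<mu> ^^ (m + n)) (x + y) = 0" by (simp add: clinearKD[OF N] add.commute)
  then show "x + y \<in> gen_eig T \<mu>" unfolding gen_eig_def by blast
qed

lemma gen_eig_commute:
  assumes S: "clinearK S" "\<And>x. S (T x) = T (S x)" and v: "v \<in> gen_eig T \<mu>"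
  shows "S v \<in> gen_eig T \<mu>"
proof -
  obtain n where n: "(shiftK T \<mu> ^^ n) v = 0" using v by (auto simp: gen_eig_def)
  have "(shiftK T \<mu> ^^ n) (S v) = S ((shiftK T \<mu> ^^ n) v)"
    by (rule funpow_commute) (rule shiftK_commute[of S T, OF S, symmetric])
  then show ?thesis using n clinearKD[OF S(1)] by (auto simp: gen_eig_def)
qed

lemma gen_eig_shiftD:
  assumes "shiftK T \<mu> v \<in> gen_eig T \<mu>" shows "v \<in> gen_eig T \<mu>"
proof -
  obtain n where "(shiftK T \<mu> ^^ n) (shiftK T \<mu> v) = 0" using assms by (auto simp: gen_eig_def)
  then have "(shiftK T \<mu> ^^ Suc n) v = 0" by (simp add: funpow_swap1)
  then show ?thesis unfolding gen_eig_def by blast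
qed

lemma shiftK_eq_0: "shiftK T \<mu> w = 0 \<longleftrightarrow> T w = scaleK \<mu> w"
  by (auto simp: shiftK_def)

text \<open>The last nonzero vector of the chain obtained by iterating \<mu> - T is an
  eigenvector.\<close>

lemma gen_eig_eigenvector:
  assumes v: "v \<in> gen_eig T \<mu>" "v \<noteq> 0"
  obtains k where "(shiftK T \<mu> ^^ k) v \<noteq> 0" "T ((shiftK T \<mu> ^^ k) v) = scaleK \<mu> ((shiftK T \<mu> ^^ k) v)"
proof -
  define k where "k = (LEAST n. (shiftK T \<mu> ^^ n) v = 0)"
  have k: "(shiftK T \<mu> ^^ k) v = 0"
    using v(1) unfolding k_def gen_eig_def by (auto intro: LeastI)
  then have "k \<noteq> 0" using v(2) by (metis funpow_0)
  then obtain j where j: "k = Suc j" using not0_implies_Suc by blast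
  have "(shiftK T \<mu> ^^ j) v \<noteq> 0"
    using not_less_Least[of j "\<lambda>n. (shiftK T \<mu> ^^ n) v = 0"] j by (simp add: k_def)
  moreover have "shiftK T \<mu> ((shiftK T \<mu> ^^ j) v) = 0" using k by (simp add: j)
  ultimately show thesis using that shiftK_eq_0 by blast
qed

text \<open>Chain down to an eigenvector for \<nu>, which stays in the generalized eigenspace of
  \<mu>. There \<mu> - T is the nonzero scalar \<mu> - \<nu>, so no power kills it.\<close>

lemma gen_eig_disjoint:
  assumes T: "clinearK T" and v: "v \<in> gen_eig T \<nu>" "v \<in> gen_eig T \<mu>" and ne: "\<nu> \<noteq> \<mu>"
  shows "v = 0"
proof (rule ccontr)
  assume "v \<noteq> 0"
  then obtain k where k: "(shiftK T \<nu> ^^ k) v \<noteq> 0" "T ((shiftK T \<nu> ^^ k) v) = scaleK \<nu> ((shiftK T \<nu> ^^ k) v)"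
    using gen_eig_eigenvector[OF v(1)] by blast
  define w where "w = (shiftK T \<nu> ^^ k) v"
  have "w \<in> gen_eig T \<mu>" unfolding w_def
    by (rule gen_eig_commute[OF clinearK_funpow[OF clinearK_shiftK[OF T]] _ v(2)])
      (rule funpow_commute, simp add: shiftK_def clinearKD[OF T])
  then obtain n where n: "(shiftK T \<mu> ^^ n) w = 0" by (auto simp: gen_eig_def)
  have "shiftK T \<mu> w = scaleK (\<mu> - \<nu>) w"
    using k(2) by (simp add: shiftK_def w_def K.scale_left_diff_distrib)
  then have "(shiftK T \<mu> ^^ n) w = scaleK ((\<mu> - \<nu>) ^ n) w" for n
    by (induction n) (simp_all add: clinearKD[OF clinearK_shiftK[OF T]] mult.commute)
  with n ne k(1) show False by (simp add: w_def)
qed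

lemma eigenvalue_in_spectrumK:
  assumes T: "clinearK T" and w: "T w = scaleK \<mu> w" "w \<noteq> 0" shows "\<mu> \<in> spectrumK T"
proof (rule ccontr)
  assume "\<mu> \<notin> spectrumK T"
  then have inv: "bounded_invertibleK (shiftK T \<mu>)" by (simp add: spectrumK_def)
  have "shiftK T \<mu> w = 0" "shiftK T \<mu> 0 = 0" using w clinearKD[OF clinearK_shiftK[OF T]] by (auto simp: shiftK_eq_0)
  with w(2) show False using bounded_invertibleKD(5)[OF inv] by metis
qed

lemma gen_eig_outside_spectrum:
  assumes T: "clinearK T" and \<mu>: "\<mu> \<notin> spectrumK T" shows "gen_eig T \<mu> \<subseteq> {0}"
proof
  fix v assume v: "v \<in> gen_eig T \<mu>"
  show "v \<in> {0}"
  proof (rule ccontr)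
    assume "v \<notin> {0}"
    then show False
      using gen_eig_eigenvector[OF v] eigenvalue_in_spectrumK[OF T] \<mu> by (metis singletonI)
  qed
qed

text \<open>On this space \<mu> - T is the scalar \<mu> - \<nu> plus the locally nilpotent \<nu> -
  T. The induction on height inverts it explicitly and stays inside \<open>M\<close>.\<close>

lemma shiftK_onto_gen_eig:
  assumes T: "clinearK T" and M: "K.subspace M" "\<And>x. x \<in> M \<Longrightarrow> T x \<in> M" and ne: "\<nu> \<noteq> \<mu>"
    and s: "s \<in> gen_eig T \<nu>" "s \<in> M"
  shows "\<exists>u\<in>gen_eig T \<nu> \<inter> M. shiftK T \<mu> u = s"
proof -
  obtain n where "(shiftK T \<nu> ^^ n) s = 0" using s(1) by (auto simp: gen_eig_def)
  then show ?thesis using s(2)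
  proof (induction n arbitrary: s)
    case 0
    then show ?case
      using K.subspace_0[OF gen_eig_subspace[OF T]] K.subspace_0[OF M(1)] clinearKD(4)[OF clinearK_shiftK[OF T]]
      by (intro bexI[of _ 0]) auto
  next
    case (Suc n)
    define s1 where "s1 = shiftK T \<nu> s"
    have "(shiftK T \<nu> ^^ n) s1 = 0" using Suc.prems(1) by (simp add: s1_def funpow_swap1)
    moreover have "s1 \<in> M"
      unfolding s1_def shiftK_def using M Suc.prems(2) by (intro K.subspace_diff K.subspace_scale) auto
    ultimately obtain u1 where u1: "u1 \<in> gen_eig T \<nu>" "u1 \<in> M" "shiftK T \<mu> u1 = s1" using Suc.IH by blast
    have sg: "s \<in> gen_eig T \<nu>" using Suc.prems(1) unfolding gen_eig_def by blast
    define u where "u = scaleK (1 / (\<mu> - \<nu>)) (s - u1)"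
    have "u \<in> gen_eig T \<nu> \<inter> M"
      unfolding u_def using u1 sg Suc.prems(2) M(1) gen_eig_subspace[OF T]
      by (intro IntI K.subspace_scale K.subspace_diff) auto
    moreover have "shiftK T \<mu> s - s1 = scaleK (\<mu> - \<nu>) s"
      by (simp add: s1_def shiftK_def K.scale_left_diff_distrib)
    then have "shiftK T \<mu> u = s"
      using ne by (simp add: u_def clinearKD[OF clinearK_shiftK[OF T]] u1(3))
    ultimately show ?case by blast
  qed
qed

definition gen_span :: "('h::chilbert \<times> 'h \<Rightarrow> 'h \<times> 'h) \<Rightarrow> ('h \<times> 'h) set \<Rightarrow> complex set \<Rightarrow> ('h \<times> 'h) set" where
  "gen_span T M Z = K.span (\<Union>\<nu>\<in>Z. gen_eig T \<nu> \<inter> M)"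

text \<open>Cancels one linear factor. All components of (\<mu> - T) v with eigenvalue other than
  \<mu> are images of some \<open>u\<close> in the span; what remains puts \<open>v - u\<close> into
  the generalized eigenspace of \<mu>.\<close>

lemma shiftK_mem_gen_span:
  assumes T: "clinearK T" and M: "K.subspace M" "\<And>x. x \<in> M \<Longrightarrow> T x \<in> M"
    and v: "v \<in> M" "shiftK T \<mu> v \<in> gen_span T M UNIV"
  shows "v \<in> gen_span T M UNIV"
proof -
  note lin = clinearKD[OF clinearK_shiftK[OF T]]
  have Mspan: "gen_span T M UNIV \<subseteq> M"
    unfolding gen_span_def by (rule K.span_minimal[OF _ M(1)]) auto
  define U where "U = gen_span T M UNIV"
  \<comment> \<open>The vectors that \<mu> - T reaches from the span, up to an error in the
    generalized eigenspace of \<mu>. Being a subspace, \<open>W\<close> need only be checked on the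
    generators.\<close>
  define W where "W = {s. \<exists>u\<in>U. s - shiftK T \<mu> u \<in> gen_eig T \<mu>}"
  have U: "K.subspace U" unfolding U_def gen_span_def by (rule K.subspace_span)
  note G = gen_eig_subspace[OF T, of \<mu>]
  have W: "K.subspace W"
  proof (rule K.subspaceI)
    show "0 \<in> W"
      using K.subspace_0[OF G] K.subspace_0[OF U] unfolding W_def by (auto simp: lin intro!: bexI[of _ 0])
  next
    fix x y assume "x \<in> W" "y \<in> W"
    then obtain u u' where u: "u \<in> U" "x - shiftK T \<mu> u \<in> gen_eig T \<mu>"
      "u' \<in> U" "y - shiftK T \<mu> u' \<in> gen_eig T \<mu>" unfolding W_def by blast
    have "x + y - shiftK T \<mu> (u + u') = (x - shiftK T \<mu> u) + (y - shiftK T \<mu> u')" by (simp add: lin)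
    also have "\<dots> \<in> gen_eig T \<mu>" by (rule K.subspace_add[OF G u(2,4)])
    finally show "x + y \<in> W" using K.subspace_add[OF U u(1,3)] unfolding W_def by blast
  next
    fix c x assume "x \<in> W"
    then obtain u where u: "u \<in> U" "x - shiftK T \<mu> u \<in> gen_eig T \<mu>" unfolding W_def by blast
    have "scaleK c x - shiftK T \<mu> (scaleK c u) = scaleK c (x - shiftK T \<mu> u)"
      by (simp add: lin K.scale_right_diff_distrib)
    also have "\<dots> \<in> gen_eig T \<mu>" by (rule K.subspace_scale[OF G u(2)])
    finally show "scaleK c x \<in> W" using K.subspace_scale[OF U u(1)] unfolding W_def by blast
  qed
  have "s \<in> W" if s: "s \<in> gen_eig T \<nu>" "s \<in> M" for s \<nu>
  proof (cases "\<nu> = \<mu>")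
    case True
    then show ?thesis
      using s(1) K.subspace_0[OF U] unfolding W_def by (auto simp: lin intro!: bexI[of _ 0])
  next
    case False
    then obtain u where u: "u \<in> gen_eig T \<nu> \<inter> M" "shiftK T \<mu> u = s"
      using shiftK_onto_gen_eig[OF T M _ s] by blast
    then have "u \<in> U" unfolding U_def gen_span_def by (intro K.span_base) blast
    moreover have "s - shiftK T \<mu> u \<in> gen_eig T \<mu>" using u(2) K.subspace_0[OF G] by simp
    ultimately show ?thesis unfolding W_def by blast
  qed
  then have "gen_span T M UNIV \<subseteq> W"
    unfolding gen_span_def by (intro K.span_minimal[OF _ W]) blast
  then obtain u where u: "u \<in> gen_span T M UNIV" "shiftK T \<mu> v - shiftK T \<mu> u \<in> gen_eig T \<mu>"
    using v(2) unfolding W_def U_def by blast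
  then have "v - u \<in> gen_eig T \<mu>" using gen_eig_shiftD[of T \<mu> "v - u"] by (simp add: lin)
  moreover have "v - u \<in> M" using u(1) Mspan v(1) K.subspace_diff[OF M(1)] by blast
  ultimately have "v - u \<in> gen_span T M UNIV" unfolding gen_span_def by (intro K.span_base) auto
  then have "v - u + u \<in> gen_span T M UNIV" using u(1) unfolding gen_span_def by (rule K.span_add)
  then show ?thesis by simp
qed

text \<open>Primary decomposition for a single vector with p(T) v = 0, by splitting off one complex
  root of \<open>p\<close> at a time.\<close>

lemma annihilated_mem_gen_span:
  assumes T: "clinearK T" and M: "K.subspace M" "\<And>x. x \<in> M \<Longrightarrow> T x \<in> M"
    and p: "p \<noteq> 0" "degree p \<le> n" and v: "v \<in> M" "(\<Sum>i\<le>n. scaleK (coeff p i) ((T ^^ i) v)) = 0"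
  shows "v \<in> gen_span T M UNIV"
  using p v
proof (induction n arbitrary: p v)
  case 0
  then obtain c where "p = [:c:]" "c \<noteq> 0" by (metis degree_eq_zeroE le_zero_eq pCons_0_0)
  with 0 have "v = 0" by simp
  then show ?case by (simp add: gen_span_def K.span_zero)
next
  case (Suc n)
  show ?case
  proof (cases "degree p = 0")
    case True
    then obtain c where p: "p = [:c:]" "c \<noteq> 0" using Suc.prems(1) by (metis degree_eq_zeroE pCons_0_0)
    have "(\<Sum>i\<le>Suc n. scaleK (coeff p i) ((T ^^ i) v)) = (\<Sum>i\<le>Suc n. if i = 0 then scaleK c v else 0)"
      by (intro sum.cong) (auto simp: p coeff_pCons split: nat.splits)
    with Suc.prems(4) p have "v = 0" by simp
    then show ?thesis by (simp add: gen_span_def K.span_zero)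
  next
    case False
    then obtain \<mu> where "poly p \<mu> = 0" using fundamental_theorem_of_algebra constant_degree by metis
    then obtain p' where p': "p = [:- \<mu>, 1:] * p'" by (auto simp: poly_eq_0_iff_dvd)
    have p'0: "p' \<noteq> 0" using Suc.prems(1) p' by auto
    have deg: "degree p' \<le> n" using Suc.prems(2) p'0 unfolding p' by (subst (asm) degree_mult_eq) auto
    have c0: "coeff p' (Suc n) = 0" using deg by (simp add: coeff_eq_0)
    define v' where "v' = shiftK T \<mu> v"
    have v': "v' \<in> M"
      unfolding v'_def shiftK_def using M Suc.prems(3) by (intro K.subspace_diff K.subspace_scale) auto
    have cp: "coeff p i = (case i of 0 \<Rightarrow> 0 | Suc j \<Rightarrow> coeff p' j) - \<mu> * coeff p' i" for i
      by (simp add: p' coeff_pCons split: nat.splits)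
    have Tpow: "(T ^^ i) v' = scaleK \<mu> ((T ^^ i) v) - (T ^^ Suc i) v" for i
      by (simp add: v'_def shiftK_def clinearKD[OF clinearK_funpow[OF T]] funpow_swap1)
    \<comment> \<open>Since p = (X - \<mu>) p' while \<open>v'\<close> is (\<mu> - T) v, this
      computes p'(T) v' = - p(T) v. The vanishing coefficient \<open>c0\<close> allows both sums to
      run to \<open>Suc n\<close>.\<close>
    have "(\<Sum>i\<le>n. scaleK (coeff p' i) ((T ^^ i) v'))
        = (\<Sum>i\<le>n. scaleK (\<mu> * coeff p' i) ((T ^^ i) v)) - (\<Sum>i\<le>n. scaleK (coeff p' i) ((T ^^ Suc i) v))"
      by (simp add: Tpow K.scale_right_diff_distrib sum_subtractf mult.commute)
    also have "(\<Sum>i\<le>n. scaleK (\<mu> * coeff p' i) ((T ^^ i) v)) = (\<Sum>i\<le>Suc n. scaleK (\<mu> * coeff p' i) ((T ^^ i) v))"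
      by (simp add: c0)
    also have "(\<Sum>i\<le>n. scaleK (coeff p' i) ((T ^^ Suc i) v))
        = (\<Sum>i\<le>Suc n. scaleK (case i of 0 \<Rightarrow> 0 | Suc j \<Rightarrow> coeff p' j) ((T ^^ i) v))"
      by (subst sum.atMost_Suc_shift) simp
    also have "(\<Sum>i\<le>Suc n. scaleK (\<mu> * coeff p' i) ((T ^^ i) v)) - \<dots>
        = - (\<Sum>i\<le>Suc n. scaleK (coeff p i) ((T ^^ i) v))"
      unfolding cp K.scale_left_diff_distrib sum_subtractf by simp
    also have "\<dots> = 0" using Suc.prems(4) by simp
    finally have "v' \<in> gen_span T M UNIV" by (intro Suc.IH[OF p'0 deg v'])
    then show ?thesis using shiftK_mem_gen_span[OF T M Suc.prems(3)] by (simp add: v'_def)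
  qed
qed

text \<open>There are card F + 1 indices. Dependence of sets does not see repeated vectors, so a
  coincidence \<open>x i = x j\<close> is treated apart, with coefficients 1 and -1.\<close>

lemma (in vector_space) dependent_family:
  fixes x :: "nat \<Rightarrow> 'b"
  assumes F: "finite F" and x: "\<And>i. i \<le> card F \<Longrightarrow> x i \<in> span F"
  shows "\<exists>c. (\<exists>i\<le>card F. c i \<noteq> 0) \<and> (\<Sum>i\<le>card F. scale (c i) (x i)) = 0"
proof (cases "inj_on x {..card F}")
  case True
  have "dependent (x ` {..card F})"
  proof (rule ccontr)
    assume "independent (x ` {..card F})"
    from independent_span_bound[OF F this] x have "card (x ` {..card F}) \<le> card F" by auto
    then show False by (simp add: card_image[OF True])
  qed
  then obtain u where u: "\<exists>v\<in>x ` {..card F}. u v \<noteq> 0" "(\<Sum>v\<in>x ` {..card F}. scale (u v) v) = 0"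
    by (auto simp: dependent_finite)
  then show ?thesis
    by (intro exI[of _ "u \<circ> x"]) (auto simp: sum.reindex[OF True])
next
  case False
  then obtain i j where ij: "i \<le> card F" "j \<le> card F" "i \<noteq> j" "x i = x j" by (auto simp: inj_on_def)
  define c where "c k = (if k = i then 1 else if k = j then - 1 else 0 :: 'a)" for k
  have "(\<Sum>k\<le>card F. scale (c k) (x k)) = (\<Sum>k\<in>{i, j}. scale (c k) (x k))"
    by (rule sum.mono_neutral_right) (use ij in \<open>auto simp: c_def\<close>)
  also have "\<dots> = 0" using ij by (simp add: c_def)
  finally show ?thesis using ij(1) by (intro exI[of _ c]) (auto simp: c_def)
qed

text \<open>In finite dimension the iterates of \<open>T\<close> on a vector are dependent, and the
  dependence is a nonzero polynomial annihilating that vector.\<close>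

lemma invariant_subspace_gen_span:
  assumes T: "clinearK T" and M: "K.subspace M" "\<And>x. x \<in> M \<Longrightarrow> T x \<in> M"
    and F: "finite F" "M \<subseteq> K.span F"
  shows "M = gen_span T M UNIV"
proof
  show "gen_span T M UNIV \<subseteq> M"
    unfolding gen_span_def by (rule K.span_minimal[OF _ M(1)]) auto
  show "M \<subseteq> gen_span T M UNIV"
  proof
    fix v assume v: "v \<in> M"
    have Tv: "(T ^^ i) v \<in> M" for i by (induction i) (use v M in auto)
    obtain c where c: "\<exists>i\<le>card F. c i \<noteq> 0" "(\<Sum>i\<le>card F. scaleK (c i) ((T ^^ i) v)) = 0"
      using K.dependent_family[OF F(1), of "\<lambda>i. (T ^^ i) v"] Tv F(2) by blast
    define p where "p = (\<Sum>i\<le>card F. monom (c i) i)"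
    have cp: "coeff p i = (if i \<le> card F then c i else 0)" for i
      by (simp add: p_def coeff_sum)
    show "v \<in> gen_span T M UNIV"
    proof (rule annihilated_mem_gen_span[OF T M _ _ v])
      show "p \<noteq> 0" using c(1) cp by (metis coeff_0)
      show "degree p \<le> card F" by (rule degree_le) (simp add: cp)
      show "(\<Sum>i\<le>card F. scaleK (coeff p i) ((T ^^ i) v)) = 0" using c(2) by (simp add: cp)
    qed
  qed
qed

text \<open>Expanding the invariance of the form with T v = \<nu> v - v1 and T w = \<mu> w - w1
  leaves the factor 1 - cnj \<nu> * \<mu> times the pairing. All other terms have smaller total
  height and vanish by induction.\<close>

lemma gen_eig_orthogonal:
  assumes T: "clinearK T" and form: "\<And>x y. cinnerK (T x) (Jop (T y)) = cinnerK x (Jop y)"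
    and ne: "cnj \<nu> * \<mu> \<noteq> 1" and v: "v \<in> gen_eig T \<nu>" and w: "w \<in> gen_eig T \<mu>"
  shows "cinnerK v (Jop w) = 0"
proof -
  obtain m n where "(shiftK T \<nu> ^^ m) v = 0" "(shiftK T \<mu> ^^ n) w = 0" using v w by (auto simp: gen_eig_def)
  then show ?thesis
  proof (induction "m + n" arbitrary: m n v w rule: less_induct)
    case less
    show ?case
    proof (cases "m = 0 \<or> n = 0")
      case True
      then show ?thesis using less.prems J.B_zero_left J.B_zero_right by auto
    next
      case False
      then obtain m' n' where mn: "m = Suc m'" "n = Suc n'" by (metis not0_implies_Suc)
      define v1 w1 where "v1 = shiftK T \<nu> v" and "w1 = shiftK T \<mu> w"
      have v1: "(shiftK T \<nu> ^^ m') v1 = 0" and w1: "(shiftK T \<mu> ^^ n') w1 = 0"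
        using less.prems by (simp_all add: mn v1_def w1_def funpow_swap1)
      have z: "cinnerK v1 (Jop w) = 0" "cinnerK v (Jop w1) = 0" "cinnerK v1 (Jop w1) = 0"
        using less.hyps[OF _ v1 less.prems(2)] less.hyps[OF _ less.prems(1) w1] less.hyps[OF _ v1 w1] mn by auto
      have Tv: "T v = scaleK \<nu> v - v1" "T w = scaleK \<mu> w - w1" by (simp_all add: v1_def w1_def shiftK_def)
      have "cinnerK v (Jop w) = cinnerK (T v) (Jop (T w))" by (rule form[symmetric])
      also have "\<dots> = cnj \<nu> * \<mu> * cinnerK v (Jop w)"
        unfolding Tv J.B_diff_left J.B_diff_right J.B_scale_left J.B_scale_right by (simp add: z)
      finally show ?thesis using ne by (simp add: mult_cancel_right1)
    qed
  qed
qed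

section \<open>Ranges of Riesz projections as generalized eigenspaces\<close>

text \<open>The defect \<open>v - P v\<close> is again a generalized eigenvector. The eigenvector at
  the end of its chain would be fixed by \<open>P\<close>, yet it is killed by \<open>P\<close>
  because \<open>P\<close> is idempotent.\<close>

lemma (in riesz_circle) gen_eig_inside:
  assumes v: "v \<in> gen_eig T \<nu>" and nu: "cmod (\<nu> - \<mu>) < r"
  shows "P v = v"
proof (rule ccontr)
  assume "P v \<noteq> v"
  then have u0: "v - P v \<noteq> 0" by simp
  have "P v \<in> gen_eig T \<nu>" by (rule gen_eig_commute[of P T, OF P_linear P_T v])
  then have u: "v - P v \<in> gen_eig T \<nu>" using K.subspace_diff[OF gen_eig_subspace[OF linT] v] by blast
  obtain k where k: "(shiftK T \<nu> ^^ k) (v - P v) \<noteq> 0"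
    "T ((shiftK T \<nu> ^^ k) (v - P v)) = scaleK \<nu> ((shiftK T \<nu> ^^ k) (v - P v))"
    using gen_eig_eigenvector[OF u u0] by blast
  have "P ((shiftK T \<nu> ^^ k) (v - P v)) = (shiftK T \<nu> ^^ k) (P (v - P v))"
    by (rule funpow_commute[symmetric]) (rule shiftK_commute[of P T, OF P_linear P_T, symmetric])
  also have "P (v - P v) = 0" by (simp add: clinearKD[OF P_linear] P_idem)
  finally show False
    using P_eigenvector_inside[OF k(2) nu] k(1) clinearKD(4)[OF clinearK_funpow[OF clinearK_shiftK[OF linT]]] by simp
qed

lemma (in riesz_circle) range_P_subspace: "K.subspace (range P)"
proof (rule K.subspaceI)
  show "0 \<in> range P" using rangeI[of P 0] by (simp add: clinearKD[OF P_linear])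
  fix x y c assume "x \<in> range P"
  then obtain a where a: "x = P a" by blast
  show "scaleK c x \<in> range P" unfolding a clinearKD(2)[OF P_linear, symmetric] by (rule rangeI)
  assume "y \<in> range P"
  then obtain b where b: "y = P b" by blast
  show "x + y \<in> range P" unfolding a b clinearKD(1)[OF P_linear, symmetric] by (rule rangeI)
qed

text \<open>The finite-dimensional range splits into generalized eigenspaces. An eigenvalue other
  than \<mu> lies outside the disc, where \<open>P\<close> kills eigenvectors, so it contributes
  nothing to the range.\<close>

lemma (in riesz_circle) range_P_gen_eig:
  assumes sp: "cball \<mu> r \<inter> spectrumK T \<subseteq> {\<mu>}" and F: "finite F" "range P \<subseteq> K.span F"
  shows "range P = gen_eig T \<mu>"
proof
  show "gen_eig T \<mu> \<subseteq> range P"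
  proof
    fix v assume "v \<in> gen_eig T \<mu>"
    then have "P v = v" using gen_eig_inside[of v \<mu>] r by simp
    then show "v \<in> range P" by (metis rangeI)
  qed
  have inv: "T x \<in> range P" if "x \<in> range P" for x
    using that P_T by (metis rangeE rangeI)
  have zero: "v = 0" if v: "v \<in> gen_eig T \<nu>" "v \<in> range P" and ne: "\<nu> \<noteq> \<mu>" for v \<nu>
  proof (rule ccontr)
    assume "v \<noteq> 0"
    then obtain k where k: "(shiftK T \<nu> ^^ k) v \<noteq> 0" "T ((shiftK T \<nu> ^^ k) v) = scaleK \<nu> ((shiftK T \<nu> ^^ k) v)"
      using gen_eig_eigenvector[OF v(1)] by blast
    then have "\<nu> \<in> spectrumK T" using eigenvalue_in_spectrumK[OF linT] by blast
    then have "\<nu> \<notin> cball \<mu> r" using sp ne by blast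
    then have "cmod (\<nu> - \<mu>) > r" by (simp add: dist_norm norm_minus_commute)
    then have "P ((shiftK T \<nu> ^^ k) v) = 0" by (rule P_eigenvector_outside[OF k(2)])
    moreover have "P ((shiftK T \<nu> ^^ k) v) = (shiftK T \<nu> ^^ k) (P v)"
      by (rule funpow_commute[symmetric]) (rule shiftK_commute[of P T, OF P_linear P_T, symmetric])
    moreover have "P v = v" using v(2) P_idem by auto
    ultimately show False using k(1) by simp
  qed
  have "gen_span T (range P) UNIV \<subseteq> gen_eig T \<mu>"
    unfolding gen_span_def
  proof (rule K.span_minimal[OF _ gen_eig_subspace[OF linT]])
    show "(\<Union>\<nu>\<in>UNIV. gen_eig T \<nu> \<inter> range P) \<subseteq> gen_eig T \<mu>"
    proof
      fix v assume "v \<in> (\<Union>\<nu>\<in>UNIV. gen_eig T \<nu> \<inter> range P)"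
      then obtain \<nu> where "v \<in> gen_eig T \<nu>" "v \<in> range P" by auto
      then show "v \<in> gen_eig T \<mu>"
        using zero[of v \<nu>] K.subspace_0[OF gen_eig_subspace[OF linT]] by (cases "\<nu> = \<mu>") simp_all
    qed
  qed
  then show "range P \<subseteq> gen_eig T \<mu>"
    by (subst invariant_subspace_gen_span[OF linT range_P_subspace inv F])
qed

lemma discrete_spectrum_riesz:
  assumes T: "boundedK T" and \<mu>: "\<mu> \<in> discrete_spectrumK T"
  obtains r C where "riesz_circle T \<mu> r C" "cball \<mu> r \<inter> spectrumK T = {\<mu>}"
    "riesz_proj T \<mu> = riesz_proj_r T \<mu> r" "range (riesz_proj T \<mu>) = gen_eig T \<mu>"
    "\<exists>F. finite F \<and> gen_eig T \<mu> \<subseteq> K.span F"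
proof -
  define r where "r = (SOME r. r > 0 \<and> cball \<mu> r \<inter> spectrumK T = {\<mu>})"
  have "\<exists>r. r > 0 \<and> cball \<mu> r \<inter> spectrumK T = {\<mu>}"
    using \<mu> by (simp add: discrete_spectrumK_def isolated_in_spectrum_def)
  from someI_ex[OF this] have r0: "r > 0" "cball \<mu> r \<inter> spectrumK T = {\<mu>}"
    by (simp_all only: r_def[symmetric])
  have "sphere \<mu> r \<inter> spectrumK T = {}"
  proof -
    have "sphere \<mu> r \<inter> spectrumK T \<subseteq> {\<mu>}" using r0(2) sphere_cball by blast
    moreover have "\<mu> \<notin> sphere \<mu> r" using r0(1) by simp
    ultimately show ?thesis by blast
  qed
  then have "\<exists>C>0. \<forall>z\<in>sphere \<mu> r. \<forall>x. norm x \<le> C * norm (shiftK T z x)"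
    by (rule resolvent_bound_compact[OF T compact_sphere])
  then obtain C where C: "C > 0" "\<And>z x. z \<in> sphere \<mu> r \<Longrightarrow> norm x \<le> C * norm (shiftK T z x)"
    by blast
  have pt: "\<mu> + of_real r * cis t \<in> sphere \<mu> r" for t
    using r0(1) by (simp add: dist_norm norm_mult)
  interpret riesz_circle T \<mu> r C
  proof
    show "bounded_invertibleK (shiftK T (\<mu> + of_real r * cis t))" for t
      using pt \<open>sphere \<mu> r \<inter> spectrumK T = {}\<close> by (force simp: spectrumK_def)
  qed (use T r0 C pt in auto)
  have rp: "riesz_proj T \<mu> = riesz_proj_r T \<mu> r" by (simp add: riesz_proj_def r_def)
  obtain F where F: "finite F" "range P \<subseteq> K.span F"
    using \<mu> by (auto simp: discrete_spectrumK_def cdimK_finite_def rp cspanK_eq_span)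
  have range: "range P = gen_eig T \<mu>" using range_P_gen_eig[OF _ F] r0(2) by blast
  show thesis
    by (rule that[of r C]) (use riesz_circle_axioms r0 rp range F in auto)
qed

section \<open>Local constancy of the signature\<close>

definition unit_eigenspace :: "('h::chilbert \<times> 'h \<Rightarrow> 'h \<times> 'h) \<Rightarrow> ('h \<times> 'h) set" where
  "unit_eigenspace T = K.span (\<Union>\<nu>\<in>sphere 0 1. gen_eig T \<nu>)"

definition nondegenerate :: "('h::chilbert \<times> 'h) set \<Rightarrow> bool" where
  "nondegenerate M \<longleftrightarrow> (\<forall>x\<in>M. (\<forall>y\<in>M. cinnerK x (Jop y) = 0) \<longrightarrow> x = 0)"

lemma J_unitaryD:
  assumes "J_unitary T"
  shows "boundedK T" "clinearK T" "surj T" "cinnerK (T x) (Jop (T y)) = cinnerK x (Jop y)"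
  using assms J_unitary_form[OF assms] bounded_invertibleKD(2)[of T]
  by (auto simp: J_unitary_def bounded_invertibleK_def boundedK_def bij_is_surj)

lemma gen_span_subset: "K.subspace M \<Longrightarrow> gen_span T M Z \<subseteq> M"
  unfolding gen_span_def by (rule K.span_minimal) auto

lemma gen_span_orthogonal:
  assumes T: "clinearK T" and form: "\<And>x y. cinnerK (T x) (Jop (T y)) = cinnerK x (Jop y)"
    and ne: "\<And>\<nu> \<mu>. \<nu> \<in> Z \<Longrightarrow> \<mu> \<in> Z' \<Longrightarrow> cnj \<nu> * \<mu> \<noteq> 1"
    and x: "x \<in> gen_span T M Z" and y: "y \<in> gen_span T M Z'"
  shows "cinnerK x (Jop y) = 0"
  by (rule J.B_span_zero[OF _ x[unfolded gen_span_def] y[unfolded gen_span_def]])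
    (use gen_eig_orthogonal[OF T form ne] in blast)

text \<open>The generalized eigenspaces off the unit circle contribute a hyperbolic summand: those inside
the circle span an isotropic subspace, and so do those outside.\<close>
lemma inertia_extend:
  assumes J: "J_unitary T" and M: "K.subspace M" "\<And>x. x \<in> M \<Longrightarrow> T x \<in> M"
    and F: "finite F" "M \<subseteq> K.span F"
    and unit: "\<And>\<nu>. cmod \<nu> = 1 \<Longrightarrow> gen_eig T \<nu> \<subseteq> M"
    and nondeg: "nondegenerate (unit_eigenspace T)"
    and inertia: "J.has_inertia (unit_eigenspace T) a b"
  shows "\<exists>c. J.has_inertia M (a + c) (b + c)"
proof -
  note T = J_unitaryD(2)[OF J] and form = J_unitaryD(4)[OF J]
  define E1 where "E1 = gen_span T M (sphere 0 1)"
  define Ep where "Ep = gen_span T M {\<nu>. cmod \<nu> > 1}"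
  define Em where "Em = gen_span T M {\<nu>. cmod \<nu> < 1}"
  have sub: "K.subspace E1" "K.subspace Ep" "K.subspace Em"
    by (simp_all add: E1_def Ep_def Em_def gen_span_def)
  have leM: "Ep \<subseteq> M" "Em \<subseteq> M" unfolding Ep_def Em_def by (rule gen_span_subset[OF M(1)])+
  have E1: "E1 = unit_eigenspace T"
    unfolding E1_def gen_span_def unit_eigenspace_def
    by (rule arg_cong[of _ _ K.span], rule SUP_cong) (use unit in \<open>auto simp: dist_norm\<close>)
  have norm_ne: "cnj \<nu> * \<mu> \<noteq> 1" if "cmod \<nu> * cmod \<mu> \<noteq> 1" for \<nu> \<mu>
    using that by (metis complex_mod_cnj norm_mult norm_one)
  have nep: "cnj \<nu> * \<mu> \<noteq> 1" if "\<nu> \<in> {\<nu>. cmod \<nu> > 1}" "\<mu> \<in> {\<nu>. cmod \<nu> > 1}" for \<nu> \<mu>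
    using that less_1_mult[of "cmod \<nu>" "cmod \<mu>"] by (intro norm_ne) simp
  have nem: "cnj \<nu> * \<mu> \<noteq> 1" if "\<nu> \<in> {\<nu>. cmod \<nu> < 1}" "\<mu> \<in> {\<nu>. cmod \<nu> < 1}" for \<nu> \<mu>
    using that mult_left_le[of "cmod \<mu>" "cmod \<nu>"] by (intro norm_ne) simp
  have hyp: "cinnerK x (Jop y) = 0" if "x \<in> Ep" "y \<in> Ep" for x y
    using gen_span_orthogonal[OF T form nep] that unfolding Ep_def by blast
  have hym: "cinnerK x (Jop y) = 0" if "x \<in> Em" "y \<in> Em" for x y
    using gen_span_orthogonal[OF T form nem] that unfolding Em_def by blast
  have ne1p: "cnj \<nu> * \<mu> \<noteq> 1" if "\<nu> \<in> sphere 0 1" "\<mu> \<in> {\<nu>. cmod \<nu> > 1}" for \<nu> \<mu>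
    using that by (intro norm_ne) (simp add: dist_norm)
  have ne1m: "cnj \<nu> * \<mu> \<noteq> 1" if "\<nu> \<in> sphere 0 1" "\<mu> \<in> {\<nu>. cmod \<nu> < 1}" for \<nu> \<mu>
    using that by (intro norm_ne) (simp add: dist_norm)
  obtain c where c: "J.has_inertia (K.span (Ep \<union> Em)) c c"
    using J.has_inertia_hyperbolic[OF sub(2,3) F(1) order_trans[OF leM(1) F(2)] order_trans[OF leM(2) F(2)] hyp hym]
    by blast
  have "cinnerK x (Jop y) = 0" if x: "x \<in> E1" and y: "y \<in> K.span (Ep \<union> Em)" for x y
  proof (rule J.B_span_zero[OF _ _ y])
    show "x \<in> K.span E1" using x by (rule K.span_base)
    fix x y assume x: "x \<in> E1" and y: "y \<in> Ep \<union> Em"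
    from y show "cinnerK x (Jop y) = 0"
    proof
      assume "y \<in> Ep"
      with x show ?thesis
        using gen_span_orthogonal[OF T form ne1p] unfolding E1_def Ep_def by blast
    next
      assume "y \<in> Em"
      with x show ?thesis
        using gen_span_orthogonal[OF T form ne1m] unfolding E1_def Em_def by blast
    qed
  qed
  then have sum: "J.has_inertia (K.span (E1 \<union> K.span (Ep \<union> Em))) (a + c) (b + c)"
    by (intro J.has_inertia_orthogonal_sum c) (use inertia nondeg in \<open>auto simp: E1 nondegenerate_def\<close>)
  have "K.span (E1 \<union> K.span (Ep \<union> Em)) = M"
  proof
    show "K.span (E1 \<union> K.span (Ep \<union> Em)) \<subseteq> M"
      using gen_span_subset[OF M(1)] leM by (intro K.span_minimal M(1) Un_least) (auto simp: E1_def)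
    have "M = gen_span T M UNIV" by (rule invariant_subspace_gen_span[OF T M F])
    also have "\<dots> \<subseteq> K.span (E1 \<union> K.span (Ep \<union> Em))"
      unfolding gen_span_def
    proof (rule K.span_minimal[OF _ K.subspace_span], rule UN_least)
      fix \<nu> :: complex
      have mem: "gen_eig T \<nu> \<inter> M \<subseteq> gen_span T M Z" if "\<nu> \<in> Z" for Z
        unfolding gen_span_def using that K.span_superset[of "\<Union>\<nu>\<in>Z. gen_eig T \<nu> \<inter> M"] by blast
      consider "\<nu> \<in> sphere 0 1" | "\<nu> \<in> {\<nu>. cmod \<nu> > 1}" | "\<nu> \<in> {\<nu>. cmod \<nu> < 1}"
        using less_linear[of "cmod \<nu>" 1] by auto
      then have "gen_eig T \<nu> \<inter> M \<subseteq> E1 \<union> (Ep \<union> Em)"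
        unfolding E1_def Ep_def Em_def by cases (drule mem, blast)+
      then show "gen_eig T \<nu> \<inter> M \<subseteq> K.span (E1 \<union> K.span (Ep \<union> Em))"
        using K.span_superset[of "E1 \<union> K.span (Ep \<union> Em)"] K.span_superset[of "Ep \<union> Em"] by blast
    qed
    finally show "M \<subseteq> K.span (E1 \<union> K.span (Ep \<union> Em))" .
  qed
  with sum show ?thesis by auto
qed

text \<open>Write v = T v' and w = (T - \<mu>) u with \<open>u\<close> in the kernel of
  \<open>P\<close>. Invariance of the form and cnj \<mu> * \<mu> = 1 reduce the pairing of
  \<open>v\<close> with \<open>w\<close> to \<mu> times that of (\<mu> - T) v' with
  \<open>u\<close>, where the height has dropped by one.\<close>

lemma (in riesz_circle) complement_orthogonal:
  assumes bij: "bij T" and form: "\<And>x y. cinnerK (T x) (Jop (T y)) = cinnerK x (Jop y)"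
    and mu: "cmod \<mu> = 1" and v: "v \<in> gen_eig T \<mu>" and w: "P w = 0"
  shows "cinnerK v (Jop w) = 0"
proof -
  obtain n where "(shiftK T \<mu> ^^ n) v = 0" using v by (auto simp: gen_eig_def)
  then show ?thesis using w
  proof (induction n arbitrary: v w)
    case 0
    then show ?case using J.B_zero_left by simp
  next
    case (Suc n)
    obtain u where u: "P u = 0" "T u - scaleK \<mu> u = w" using complement_solvable[OF Suc.prems(2)] by blast
    obtain v' where v': "v = T v'" using bij by (metis bij_pointE)
    have mu1: "cnj \<mu> * \<mu> = 1"
      using mu complex_norm_square[of \<mu>] by (simp add: mult.commute)
    have comm: "T (shiftK T \<mu> x) = shiftK T \<mu> (T x)" for x
      by (simp add: shiftK_def clinearKD[OF linT])
    have "T ((shiftK T \<mu> ^^ n) (shiftK T \<mu> v')) = (shiftK T \<mu> ^^ n) (T (shiftK T \<mu> v'))"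
      by (rule funpow_commute[of "shiftK T \<mu>" T, OF comm[symmetric], symmetric])
    also have "\<dots> = T 0"
      using Suc.prems(1) by (simp add: comm v' funpow_swap1 clinearKD[OF linT])
    finally have "(shiftK T \<mu> ^^ n) (shiftK T \<mu> v') = 0" using bij by (meson bij_is_inj injD)
    then have IH: "cinnerK (shiftK T \<mu> v') (Jop u) = 0" by (rule Suc.IH) (rule u(1))
    have "v' = scaleK (cnj \<mu>) (scaleK \<mu> v')" by (simp add: mu1)
    then have v'': "v' = scaleK (cnj \<mu>) (shiftK T \<mu> v' + T v')" by (simp add: shiftK_def)
    have "cinnerK v (Jop w) = cinnerK (T v') (Jop (T u)) - \<mu> * cinnerK v (Jop u)"
      unfolding u(2)[symmetric] by (simp only: J.B_diff_right J.B_scale_right v')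
    also have "cinnerK (T v') (Jop (T u)) = cinnerK v' (Jop u)" by (rule form)
    also have "\<dots> = \<mu> * cinnerK (T v') (Jop u)"
      by (subst v'') (simp only: J.B_scale_left J.B_add_left IH complex_cnj_cnj add_0)
    finally show ?case by (simp add: v')
  qed
qed

text \<open>An accumulation point would belong to the closed spectrum and hence be isolated in
  it.\<close>

lemma finite_discrete_subset:
  assumes T: "boundedK T" and Z: "compact Z" "Z \<inter> spectrumK T \<subseteq> discrete_spectrumK T"
  shows "finite (Z \<inter> spectrumK T)"
proof (rule ccontr)
  assume inf: "infinite (Z \<inter> spectrumK T)"
  have "compact (Z \<inter> spectrumK T)" by (intro compact_Int_closed Z closed_spectrumK T)
  then obtain x where x: "x \<in> Z \<inter> spectrumK T" "x islimpt (Z \<inter> spectrumK T)"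
    using Heine_Borel_imp_Bolzano_Weierstrass[OF _ inf order_refl] by blast
  then obtain r where r: "r > 0" "cball x r \<inter> spectrumK T = {x}"
    using Z(2) by (auto simp: discrete_spectrumK_def isolated_in_spectrum_def)
  obtain y where y: "y \<in> Z \<inter> spectrumK T" "y \<noteq> x" "dist y x < r"
    using x(2) r(1) unfolding islimpt_approachable by blast
  then have "y \<in> cball x r \<inter> spectrumK T" by (simp add: dist_commute)
  with r(2) y(2) show False by blast
qed

section \<open>Perturbation of definite subspaces and of projections\<close>

lemma clinearK_sum:
  assumes "\<And>i. i \<in> I \<Longrightarrow> clinearK (f i)" shows "clinearK (\<lambda>x. \<Sum>i\<in>I. f i x)"
proof (rule clinearKI)
  fix x y and c
  have "(\<Sum>i\<in>I. f i (x + y)) = (\<Sum>i\<in>I. f i x + f i y)" by (rule sum.cong) (use assms clinearKD(1) in blast)+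
  then show "(\<Sum>i\<in>I. f i (x + y)) = (\<Sum>i\<in>I. f i x) + (\<Sum>i\<in>I. f i y)" by (simp add: sum.distrib)
  have "(\<Sum>i\<in>I. f i (scaleK c x)) = (\<Sum>i\<in>I. scaleK c (f i x))" by (rule sum.cong) (use assms clinearKD(2) in blast)+
  then show "(\<Sum>i\<in>I. f i (scaleK c x)) = scaleK c (\<Sum>i\<in>I. f i x)" by (simp add: K.scale_sum_right)
qed

lemma J_q_difference:
  "\<bar>J.q y - J.q x\<bar> \<le> norm (y - x) * (norm y + norm x)" for x y :: "'h::chilbert \<times> 'h"
proof -
  have "J.q y - J.q x = Re (cinnerK (y - x) (Jop y) + cinnerK x (Jop (y - x)))"
    by (simp add: J.q_def J.B_diff_left J.B_diff_right)
  also have "\<bar>\<dots>\<bar> \<le> cmod (cinnerK (y - x) (Jop y) + cinnerK x (Jop (y - x)))"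
    by (rule abs_Re_le_cmod)
  also have "\<dots> \<le> cmod (cinnerK (y - x) (Jop y)) + cmod (cinnerK x (Jop (y - x)))"
    by (rule norm_triangle_ineq)
  also have "\<dots> \<le> norm (y - x) * norm y + norm x * norm (y - x)"
    using cinnerK_Cauchy_Schwarz[of "y - x" "Jop y"] cinnerK_Cauchy_Schwarz[of x "Jop (y - x)"]
    by (simp add: norm_Jop)
  finally show ?thesis by (simp add: algebra_simps)
qed

text \<open>Definiteness becomes coercive on a finite-dimensional span. The constant comes from the
  Cauchy-Schwarz inequality for sums with weights \<open>sqrt (s * J.q w)\<close>; the sign
  \<open>s\<close> serves the positive and the negative case at once.\<close>

lemma definite_norm_bound:
  fixes A :: "('h::chilbert \<times> 'h) set" and s :: real
  assumes A: "finite A" and orth: "\<And>x y. x \<in> A \<Longrightarrow> y \<in> A \<Longrightarrow> x \<noteq> y \<Longrightarrow> cinnerK x (Jop y) = 0"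
    and s: "\<And>w. w \<in> A \<Longrightarrow> s * J.q w > 0"
  shows "\<exists>\<kappa>\<ge>0. \<forall>x\<in>K.span A. (norm x)\<^sup>2 \<le> \<kappa> * (s * J.q x)"
proof (intro exI conjI ballI)
  let ?k = "\<Sum>w\<in>A. (norm w / sqrt (s * J.q w))\<^sup>2"
  show "0 \<le> ?k" by (intro sum_nonneg) simp
  fix x assume "x \<in> K.span A"
  then obtain c where x: "x = (\<Sum>w\<in>A. scaleK (c w) w)" unfolding K.span_finite[OF A] by auto
  have qx: "s * J.q x = (\<Sum>w\<in>A. (cmod (c w) * sqrt (s * J.q w))\<^sup>2)"
  proof -
    have "J.q x = (\<Sum>w\<in>A. (cmod (c w))\<^sup>2 * J.q w)"
      unfolding x by (rule J.q_sum_orthogonal[OF A]) (use orth in auto)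
    then have "s * J.q x = (\<Sum>w\<in>A. (cmod (c w))\<^sup>2 * (s * J.q w))"
      by (simp add: sum_distrib_left mult.left_commute)
    also have "\<dots> = (\<Sum>w\<in>A. (cmod (c w) * sqrt (s * J.q w))\<^sup>2)"
      by (rule sum.cong) (use s in \<open>auto simp: power_mult_distrib less_imp_le\<close>)
    finally show ?thesis .
  qed
  have "norm x \<le> (\<Sum>w\<in>A. norm (scaleK (c w) w))" unfolding x by (rule norm_sum)
  also have "\<dots> = (\<Sum>w\<in>A. (cmod (c w) * sqrt (s * J.q w)) * (norm w / sqrt (s * J.q w)))"
    by (rule sum.cong) (use s in \<open>force simp: norm_scaleK\<close>)+
  finally have "(norm x)\<^sup>2 \<le> (\<Sum>w\<in>A. (cmod (c w) * sqrt (s * J.q w)) * (norm w / sqrt (s * J.q w)))\<^sup>2"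
    by (rule power_mono) simp
  also have "\<dots> \<le> (s * J.q x) * ?k"
    unfolding qx by (rule Cauchy_Schwarz_ineq_sum)
  finally show "(norm x)\<^sup>2 \<le> ?k * (s * J.q x)" by (simp add: mult.commute)
qed

text \<open>Here \<open>s\<close> is 1 or -1 for positive or negative definiteness, and
  \<open>e\<close> is a tolerance valid for every linear \<open>Q\<close> near the identity on the
  span, since the later \<open>Q\<close> depends on the perturbed operator.\<close>

definition keeps_definite :: "real \<Rightarrow> ('h::chilbert \<times> 'h) set \<Rightarrow> real \<Rightarrow> bool" where
  "keeps_definite s A e \<longleftrightarrow> (\<forall>Q. clinearK Q \<longrightarrow> (\<forall>x\<in>K.span A. norm (Q x - x) \<le> e * norm x) \<longrightarrow>
    K.independent (Q ` A) \<and> card (Q ` A) = card A \<and> (\<forall>y\<in>K.span (Q ` A). y \<noteq> 0 \<longrightarrow> s * J.q y > 0))"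

lemma keeps_definiteD:
  assumes "keeps_definite s A e" "clinearK Q" "\<forall>x\<in>K.span A. norm (Q x - x) \<le> e * norm x"
  shows "K.independent (Q ` A)" "card (Q ` A) = card A" "\<And>y. y \<in> K.span (Q ` A) \<Longrightarrow> y \<noteq> 0 \<Longrightarrow> s * J.q y > 0"
  using assms unfolding keeps_definite_def by blast+

lemma keeps_definite_mono:
  assumes "keeps_definite s A e" "e' \<le> e" shows "keeps_definite s A e'"
  unfolding keeps_definite_def
proof (intro allI impI)
  fix Q assume Q: "clinearK Q" "\<forall>x\<in>K.span A. norm (Q x - x) \<le> e' * norm x"
  have "\<forall>x\<in>K.span A. norm (Q x - x) \<le> e * norm x"
    using Q(2) mult_right_mono[OF assms(2) norm_ge_zero] by (meson order_trans)
  from keeps_definiteD[OF assms(1) Q(1) this]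
  show "K.independent (Q ` A) \<and> card (Q ` A) = card A \<and> (\<forall>y\<in>K.span (Q ` A). y \<noteq> 0 \<longrightarrow> s * J.q y > 0)"
    by blast
qed

lemma definite_perturb:
  fixes A :: "('h::chilbert \<times> 'h) set" and s :: real
  assumes A: "finite A" "K.independent A"
    and orth: "\<And>x y. x \<in> A \<Longrightarrow> y \<in> A \<Longrightarrow> x \<noteq> y \<Longrightarrow> cinnerK x (Jop y) = 0"
    and s: "\<bar>s\<bar> = 1" "\<And>w. w \<in> A \<Longrightarrow> s * J.q w > 0"
  shows "\<exists>e>0. keeps_definite s A e"
proof -
  obtain k where k: "0 \<le> k" "\<And>x. x \<in> K.span A \<Longrightarrow> (norm x)\<^sup>2 \<le> k * (s * J.q x)"
    using definite_norm_bound[OF A(1) orth s(2)] by blast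
  \<comment> \<open>Chosen so that \<open>e \<le> 1\<close>, which bounds
    \<open>norm (Q x) + norm x\<close> by 3 times \<open>norm x\<close>, and so that
    \<open>3 * e * k < 1\<close>, which makes the change of the form smaller than the form
    itself.\<close>
  define e where "e = 1 / (3 * k + 3)"
  have e: "0 < e" "e \<le> 1" "3 * e * k < 1" using k(1) by (auto simp: e_def field_simps)
  have "K.independent (Q ` A) \<and> card (Q ` A) = card A \<and> (\<forall>y\<in>K.span (Q ` A). y \<noteq> 0 \<longrightarrow> s * J.q y > 0)"
    if Q: "clinearK Q" "\<forall>x\<in>K.span A. norm (Q x - x) \<le> e * norm x" for Q
  proof -
    interpret Q: Vector_Spaces.linear scaleK scaleK Q using Q(1) by (simp add: clinearK_iff_linear)
    have pos: "s * J.q (Q x) > 0" if x: "x \<in> K.span A" "x \<noteq> 0" for x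
    proof -
      have nx: "0 < (norm x)\<^sup>2" using x(2) by simp
      have "0 < k * (s * J.q x)" using nx k(2)[OF x(1)] by linarith
      then have qx: "0 < s * J.q x" using k(1) by (simp add: zero_less_mult_iff)
      have d: "norm (Q x - x) \<le> e * norm x" using Q(2) x(1) by blast
      also have "\<dots> \<le> 1 * norm x" using e(2) by (intro mult_right_mono) auto
      finally have Qx: "norm (Q x) + norm x \<le> 3 * norm x"
        using norm_triangle_sub[of "Q x" x] by linarith
      have "s * J.q x - s * J.q (Q x) \<le> \<bar>s * (J.q (Q x) - J.q x)\<bar>" by (simp add: right_diff_distrib)
      also have "\<dots> = \<bar>J.q (Q x) - J.q x\<bar>" by (simp add: abs_mult s(1))
      also have "\<dots> \<le> norm (Q x - x) * (norm (Q x) + norm x)" by (rule J_q_difference)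
      also have "\<dots> \<le> (e * norm x) * (3 * norm x)"
        using d Qx e(1) by (intro mult_mono) auto
      also have "\<dots> = 3 * e * (norm x)\<^sup>2" by (simp add: power2_eq_square)
      also have "\<dots> \<le> 3 * e * (k * (s * J.q x))" using k(2)[OF x(1)] e(1) by (intro mult_left_mono) auto
      also have "\<dots> = (3 * e * k) * (s * J.q x)" by simp
      also have "\<dots> < 1 * (s * J.q x)" by (rule mult_strict_right_mono[OF e(3) qx])
      finally show ?thesis by simp
    qed
    have inj: "inj_on Q (K.span A)"
    proof (rule inj_onI)
      fix x y assume xy: "x \<in> K.span A" "y \<in> K.span A" "Q x = Q y"
      show "x = y"
      proof (rule ccontr)
        assume "x \<noteq> y"
        then have "s * J.q (Q (x - y)) > 0" using xy by (intro pos K.span_diff) auto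
        then show False using xy(3) by (simp add: Q.diff)
      qed
    qed
    have "K.independent (Q ` A)" by (rule Q.independent_injective_image[OF A(2) inj])
    moreover have "card (Q ` A) = card A"
      by (rule card_image) (rule inj_on_subset[OF inj K.span_superset])
    moreover have "s * J.q y > 0" if "y \<in> K.span (Q ` A)" "y \<noteq> 0" for y
    proof -
      from that(1) obtain x where x: "x \<in> K.span A" "y = Q x" unfolding Q.span_image by blast
      with that(2) have "x \<noteq> 0" by auto
      with x show ?thesis using pos[of x] by simp
    qed
    ultimately show ?thesis by blast
  qed
  then have "keeps_definite s A e" unfolding keeps_definite_def by blast
  with e(1) show ?thesis by blast
qed

text \<open>\<open>P\<close> is injective on the range of \<open>P'\<close>: there x = P' x, so P x
  = 0 would give norm x \<le> norm x / 2. Hence the perturbed range has no larger dimension.\<close>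

lemma close_projection_range:
  assumes P: "clinearK P" and P': "clinearK P'" "\<And>v. P' (P' v) = P' v"
    and close: "\<And>v. norm (P' v - P v) \<le> 1 / 2 * norm v"
    and B: "finite B" "range P \<subseteq> K.span B"
  shows "\<exists>F. finite F \<and> card F \<le> card B \<and> range P' \<subseteq> K.span F"
proof -
  interpret P: Vector_Spaces.linear scaleK scaleK P using P by (simp add: clinearK_iff_linear)
  interpret P': Vector_Spaces.linear scaleK scaleK P' using P'(1) by (simp add: clinearK_iff_linear)
  obtain F where F: "F \<subseteq> range P'" "K.independent F" "range P' \<subseteq> K.span F"
    using K.maximal_independent_subset[of "range P'"] by blast
  have "K.subspace (range P')" using P'.subspace_image[OF K.subspace_UNIV] .
  then have FP': "K.span F \<subseteq> range P'" using F(1) by (intro K.span_minimal)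
  have inj: "inj_on P (K.span F)"
  proof (rule inj_onI)
    fix x y assume xy: "x \<in> K.span F" "y \<in> K.span F" "P x = P y"
    then have "x - y \<in> range P'" using FP' K.span_diff by blast
    then have "P' (x - y) = x - y" using P'(2) by auto
    then have "norm (x - y) \<le> 1 / 2 * norm (x - y)" using close[of "x - y"] xy(3) by (simp add: P.diff)
    then show "x = y" by simp
  qed
  have "K.independent (P ` F)" by (rule P.independent_injective_image[OF F(2) inj])
  then have "finite (P ` F)" "card (P ` F) \<le> card B"
    using K.independent_span_bound[OF B(1)] B(2) by blast+
  moreover have injF: "inj_on P F" by (rule inj_on_subset[OF inj K.span_superset])
  ultimately have "finite F" "card F \<le> card B"
    using finite_imageD by (blast, simp add: card_image)
  with F(3) show ?thesis by blast
qed

section \<open>The unit spectrum of an essentially gapped J-unitary\<close>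

locale ess_gapped_J_unitary =
  fixes T :: "'h::chilbert \<times> 'h \<Rightarrow> 'h \<times> 'h"
  assumes J: "J_unitary T" and gapped: "ess_S1_gapped T"
begin

definition Z :: "complex set" where "Z = sphere 0 1 \<inter> spectrumK T"

lemma T: "boundedK T" "clinearK T" "bij T" "cinnerK (T x) (Jop (T y)) = cinnerK x (Jop y)"
  using J_unitaryD[OF J] bounded_invertibleKD(2) J by (auto simp: J_unitary_def)

lemma Z_discrete: "Z \<subseteq> discrete_spectrumK T"
  using gapped by (auto simp: Z_def ess_S1_gapped_def essential_spectrumK_def)

lemma finite_Z: "finite Z"
  unfolding Z_def by (rule finite_discrete_subset[OF T(1)]) (use Z_discrete in \<open>auto simp: Z_def\<close>)

lemma Z_norm: "i \<in> Z \<Longrightarrow> cmod i = 1"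
  by (simp add: Z_def dist_norm)

lemma unit_eigenspace_Z: "unit_eigenspace T = K.span (\<Union>i\<in>Z. gen_eig T i)"
proof
  show "unit_eigenspace T \<subseteq> K.span (\<Union>i\<in>Z. gen_eig T i)"
    unfolding unit_eigenspace_def
  proof (rule K.span_minimal[OF _ K.subspace_span], rule UN_least)
    fix \<nu> :: complex assume nu: "\<nu> \<in> sphere 0 1"
    show "gen_eig T \<nu> \<subseteq> K.span (\<Union>i\<in>Z. gen_eig T i)"
    proof (cases "\<nu> \<in> spectrumK T")
      case True
      then have "\<nu> \<in> Z" using nu by (simp add: Z_def)
      then show ?thesis using K.span_superset[of "\<Union>i\<in>Z. gen_eig T i"] by blast
    next
      case False
      from gen_eig_outside_spectrum[OF T(2) this] show ?thesis
        using K.span_zero[of "\<Union>i\<in>Z. gen_eig T i"] by blast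
    qed
  qed
  show "K.span (\<Union>i\<in>Z. gen_eig T i) \<subseteq> unit_eigenspace T"
    unfolding unit_eigenspace_def by (rule K.span_mono) (auto simp: Z_def)
qed

definition rad :: "complex \<Rightarrow> real" where
  "rad i = (SOME r. (\<exists>C. riesz_circle T i r C) \<and> cball i r \<inter> spectrumK T = {i} \<and> range (riesz_proj_r T i r) = gen_eig T i)"

lemma rad:
  assumes "i \<in> Z"
  shows "\<exists>C. riesz_circle T i (rad i) C" "cball i (rad i) \<inter> spectrumK T = {i}"
    "range (riesz_proj_r T i (rad i)) = gen_eig T i"
proof -
  have "i \<in> discrete_spectrumK T" using assms Z_discrete by blast
  then obtain r C where "riesz_circle T i r C" "cball i r \<inter> spectrumK T = {i}"
    "riesz_proj T i = riesz_proj_r T i r" "range (riesz_proj T i) = gen_eig T i"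
    "\<exists>F. finite F \<and> gen_eig T i \<subseteq> K.span F"
    by (rule discrete_spectrum_riesz[OF T(1)])
  then have "\<exists>r. (\<exists>C. riesz_circle T i r C) \<and> cball i r \<inter> spectrumK T = {i} \<and> range (riesz_proj_r T i r) = gen_eig T i"
    by (intro exI[of _ r] conjI exI[of _ C]) simp_all
  from someI_ex[OF this, folded rad_def] show "\<exists>C. riesz_circle T i (rad i) C" "cball i (rad i) \<inter> spectrumK T = {i}"
    "range (riesz_proj_r T i (rad i)) = gen_eig T i"
    by blast+
qed

abbreviation P :: "complex \<Rightarrow> 'h \<times> 'h \<Rightarrow> 'h \<times> 'h" where "P i \<equiv> riesz_proj_r T i (rad i)"

lemma P_facts:
  assumes i: "i \<in> Z"
  shows "clinearK (P i)" "P i v \<in> gen_eig T i" "v \<in> gen_eig T i \<Longrightarrow> P i v = v"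
    "j \<noteq> i \<Longrightarrow> v \<in> gen_eig T j \<Longrightarrow> P i v = 0"
    "v \<in> gen_eig T i \<Longrightarrow> P i w = 0 \<Longrightarrow> cinnerK v (Jop w) = 0"
proof -
  obtain C where "riesz_circle T i (rad i) C" using rad(1)[OF i] by blast
  then interpret R: riesz_circle T i "rad i" C .
  show lin: "clinearK (P i)" by (rule R.P_linear)
  show mem: "P i v \<in> gen_eig T i" for v using rad(3)[OF i] by blast
  show "P i v = v" if "v \<in> gen_eig T i" using R.gen_eig_inside[OF that] R.r by simp
  show "P i v = 0" if "j \<noteq> i" "v \<in> gen_eig T j"
    by (rule gen_eig_disjoint[OF T(2) _ mem that(1)])
      (rule gen_eig_commute[of "P i" T, OF lin R.P_T that(2)])
  show "cinnerK v (Jop w) = 0" if "v \<in> gen_eig T i" "P i w = 0"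
    by (rule R.complement_orthogonal[OF T(3,4) Z_norm[OF i] that])
qed

definition B :: "complex \<Rightarrow> ('h \<times> 'h) set" where
  "B i = (SOME C. finite C \<and> C \<subseteq> gen_eig T i \<and> K.independent C \<and> gen_eig T i \<subseteq> K.span C)"

lemma B:
  assumes i: "i \<in> Z"
  shows "finite (B i)" "B i \<subseteq> gen_eig T i" "K.independent (B i)" "gen_eig T i \<subseteq> K.span (B i)"
proof -
  have "i \<in> discrete_spectrumK T" using i Z_discrete by blast
  then have "\<exists>F. finite F \<and> gen_eig T i \<subseteq> K.span F"
    by (rule discrete_spectrum_riesz[OF T(1)])
  then obtain F where F: "finite F" "gen_eig T i \<subseteq> K.span F" by blast
  have "\<exists>C. finite C \<and> C \<subseteq> gen_eig T i \<and> K.independent C \<and> gen_eig T i \<subseteq> K.span C"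
    by (rule K.finite_basis_exists[OF F]) blast
  from someI_ex[OF this, folded B_def] show "finite (B i)" "B i \<subseteq> gen_eig T i" "K.independent (B i)" "gen_eig T i \<subseteq> K.span (B i)"
    by blast+
qed

lemma sum_P:
  assumes "v \<in> unit_eigenspace T" shows "(\<Sum>i\<in>Z. P i v) = v"
  using assms unfolding unit_eigenspace_Z
proof (induction rule: K.span_induct)
  case base
  show ?case
    by (rule K.subspaceI)
      (simp_all add: clinearKD[OF P_facts(1)] sum.distrib K.scale_sum_right[symmetric])
next
  case (step v)
  then obtain j where j: "j \<in> Z" "v \<in> gen_eig T j" by blast
  have "(\<Sum>i\<in>Z. P i v) = (\<Sum>i\<in>Z. if i = j then v else 0)"
  proof (rule sum.cong[OF refl])
    fix i assume "i \<in> Z"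
    then show "P i v = (if i = j then v else 0)"
      using P_facts(3)[of i v] P_facts(4)[of i j v] j(2) by auto
  qed
  then show ?case using j(1) finite_Z by simp
qed

text \<open>Split any \<open>w\<close> into the sum \<open>s\<close> of its projections and a
  remainder killed by all of them. A vector orthogonal to the unit eigenspace is orthogonal to
  \<open>s\<close>, and by \<open>complement_orthogonal\<close> to the remainder, hence to
  everything; testing with \<open>w = Jop v\<close> gives 0.\<close>

lemma nondegenerate_unit_eigenspace: "nondegenerate (unit_eigenspace T)"
  unfolding nondegenerate_def
proof (intro ballI impI)
  fix v assume v: "v \<in> unit_eigenspace T" and orth: "\<forall>y\<in>unit_eigenspace T. cinnerK v (Jop y) = 0"
  have all: "cinnerK v (Jop w) = 0" for w
  proof -
    define s where "s = (\<Sum>i\<in>Z. P i w)"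
    have "P i w \<in> unit_eigenspace T" if "i \<in> Z" for i
      unfolding unit_eigenspace_Z using P_facts(2)[OF that, of w] that by (intro K.span_base) blast
    then have s: "s \<in> unit_eigenspace T"
      unfolding s_def unit_eigenspace_Z by (intro K.span_sum) auto
    have P0: "P j (w - s) = 0" if j: "j \<in> Z" for j
    proof -
      have "P j s = (\<Sum>i\<in>Z. P j (P i w))" by (simp add: s_def clinearKD[OF P_facts(1)[OF j]])
      also have "\<dots> = (\<Sum>i\<in>Z. if i = j then P j w else 0)"
      proof (rule sum.cong[OF refl])
        fix i assume "i \<in> Z"
        from P_facts(2)[OF this, of w] show "P j (P i w) = (if i = j then P j w else 0)"
          using P_facts(3)[OF j, of "P i w"] P_facts(4)[OF j, of i "P i w"] by auto
      qed
      also have "\<dots> = P j w" using j finite_Z by simp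
      finally show ?thesis by (simp add: clinearKD[OF P_facts(1)[OF j]])
    qed
    have "cinnerK v (Jop (w - s)) = 0"
    proof (rule J.B_span_zero[of "\<Union>i\<in>Z. gen_eig T i" "{w - s}"])
      show "v \<in> K.span (\<Union>i\<in>Z. gen_eig T i)" using v by (simp add: unit_eigenspace_Z)
      show "w - s \<in> K.span {w - s}" by (rule K.span_base) simp
      show "cinnerK x (Jop y) = 0" if "x \<in> (\<Union>i\<in>Z. gen_eig T i)" "y \<in> {w - s}" for x y
        using that P_facts(5) P0 by blast
    qed
    moreover have "cinnerK v (Jop s) = 0" using orth s by blast
    ultimately show ?thesis using J.B_diff_right[of v w s] by simp
  qed
  have "Jop (Jop v) = v" by (simp add: Jop_def)
  then have "cinnerK v v = 0" using all[of "Jop v"] by simp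
  then show "v = 0" by (simp add: cinnerK_self)
qed

lemma unit_basis:
  "finite (\<Union>i\<in>Z. B i)" "K.independent (\<Union>i\<in>Z. B i)" "K.span (\<Union>i\<in>Z. B i) = unit_eigenspace T"
  "card (\<Union>i\<in>Z. B i) = (\<Sum>i\<in>Z. card (B i))"
proof -
  show fin: "finite (\<Union>i\<in>Z. B i)" using finite_Z B(1) by blast
  have disj: "B i \<inter> B j = {}" if "i \<in> Z" "j \<in> Z" "i \<noteq> j" for i j
  proof (rule ccontr)
    assume "B i \<inter> B j \<noteq> {}"
    then obtain x where x: "x \<in> B i" "x \<in> B j" by blast
    then have "x = 0" using gen_eig_disjoint[OF T(2) _ _ that(3)] B(2) that by blast
    with x(1) B(3)[OF that(1)] show False using K.dependent_zero by blast
  qed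
  show "card (\<Union>i\<in>Z. B i) = (\<Sum>i\<in>Z. card (B i))"
    by (rule card_UN_disjoint) (use finite_Z B(1) disj in auto)
  show "K.independent (\<Union>i\<in>Z. B i)"
  proof (rule K.independent_if_scalars_zero[OF fin])
    fix f x assume sum: "(\<Sum>x\<in>(\<Union>i\<in>Z. B i). scaleK (f x) x) = 0" and x: "x \<in> (\<Union>i\<in>Z. B i)"
    then obtain j where j: "j \<in> Z" "x \<in> B j" by blast
    have "0 = P j (\<Sum>x\<in>(\<Union>i\<in>Z. B i). scaleK (f x) x)"
      unfolding sum by (simp add: clinearKD[OF P_facts(1)[OF j(1)]])
    also have "\<dots> = (\<Sum>x\<in>(\<Union>i\<in>Z. B i). scaleK (f x) (P j x))"
      by (simp add: clinearKD[OF P_facts(1)[OF j(1)]])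
    also have "\<dots> = (\<Sum>x\<in>B j. scaleK (f x) x)"
    proof (rule sum.mono_neutral_cong_right[OF fin])
      show "B j \<subseteq> (\<Union>i\<in>Z. B i)" using j by blast
      show "\<forall>y\<in>(\<Union>i\<in>Z. B i) - B j. scaleK (f y) (P j y) = 0"
      proof
        fix y assume "y \<in> (\<Union>i\<in>Z. B i) - B j"
        then obtain i where "i \<in> Z" "y \<in> B i" "i \<noteq> j" by blast
        then have "P j y = 0" using P_facts(4)[OF j(1)] B(2) by blast
        then show "scaleK (f y) (P j y) = 0" by simp
      qed
      show "scaleK (f y) (P j y) = scaleK (f y) y" if "y \<in> B j" for y
      proof -
        have "y \<in> gen_eig T j" using that B(2)[OF j(1)] by blast
        then show ?thesis using P_facts(3)[OF j(1)] by simp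
      qed
    qed
    finally show "f x = 0"
      using K.independentD[OF B(3)[OF j(1)] B(1)[OF j(1)] order_refl _ j(2), of f] by simp
  qed
  show "K.span (\<Union>i\<in>Z. B i) = unit_eigenspace T"
    unfolding unit_eigenspace_Z K.span_eq
  proof
    show "(\<Union>i\<in>Z. B i) \<subseteq> K.span (\<Union>i\<in>Z. gen_eig T i)"
      using B(2) K.span_superset[of "\<Union>i\<in>Z. gen_eig T i"] by blast
    show "(\<Union>i\<in>Z. gen_eig T i) \<subseteq> K.span (\<Union>i\<in>Z. B i)"
    proof (rule UN_least)
      fix i assume i: "i \<in> Z"
      have "K.span (B i) \<subseteq> K.span (\<Union>i\<in>Z. B i)" using i by (intro K.span_mono) blast
      then show "gen_eig T i \<subseteq> K.span (\<Union>i\<in>Z. B i)" using B(4)[OF i] by blast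
    qed
  qed
qed

lemma unit_inertia_exists: "\<exists>a b. J.has_inertia (unit_eigenspace T) a b"
  by (rule J.has_inertia_exists[OF _ unit_basis(1)])
    (simp_all add: unit_basis(3) unit_eigenspace_def)

text \<open>By nondegeneracy an orthogonal basis contains no null vector, so positive and negative
  vectors exhaust the dimension.\<close>

lemma card_unit_basis:
  assumes W: "J.ortho_basis W (unit_eigenspace T)"
  shows "(\<Sum>i\<in>Z. card (B i)) = card {w\<in>W. J.q w > 0} + card {w\<in>W. J.q w < 0}"
proof -
  have Wd: "finite W" "K.independent W" "K.span W = unit_eigenspace T"
    "\<And>x y. x \<in> W \<Longrightarrow> y \<in> W \<Longrightarrow> x \<noteq> y \<Longrightarrow> cinnerK x (Jop y) = 0"
    using W by (auto simp: J.ortho_basis_def)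
  have q0: "J.q w \<noteq> 0" if w: "w \<in> W" for w
  proof
    assume "J.q w = 0"
    then have "cinnerK w (Jop w) = 0" using J.B_self[of w] by simp
    then have orth: "cinnerK w (Jop y) = 0" if "y \<in> W" for y using Wd(4)[OF w that] by (cases "w = y") auto
    have "cinnerK w (Jop y) = 0" if "y \<in> unit_eigenspace T" for y
      by (rule J.B_span_zero[of "{w}" W]) (use orth that Wd(3) in \<open>auto intro: K.span_base\<close>)
    moreover have "w \<in> unit_eigenspace T" using w Wd(3) K.span_superset[of W] by blast
    ultimately have "w = 0" using nondegenerate_unit_eigenspace unfolding nondegenerate_def by blast
    with w Wd(2) show False using K.dependent_zero by blast
  qed
  have "(\<Sum>i\<in>Z. card (B i)) = card W"
    using K.dim_span_eq_card_independent[OF unit_basis(2)] K.dim_span_eq_card_independent[OF Wd(2)]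
    by (simp add: unit_basis(3,4) Wd(3))
  also have "W = {w\<in>W. J.q w > 0} \<union> {w\<in>W. J.q w < 0}" using q0 by (auto simp: neq_iff)
  also have "card \<dots> = card {w\<in>W. J.q w > 0} + card {w\<in>W. J.q w < 0}"
    by (rule card_Un_disjoint) (use Wd(1) in auto)
  finally show ?thesis .
qed

lemma rad_pos: "i \<in> Z \<Longrightarrow> 0 < rad i"
  using rad(1) by (auto simp: riesz_circle_def)

text \<open>Serves two purposes: the small circles carry the Riesz integrals, and a resolvent bound
  on the rest of the unit circle confines the unit spectrum of nearby operators to the
  discs.\<close>

definition contour :: "complex set" where
  "contour = (sphere 0 1 - (\<Union>i\<in>Z. ball i (rad i))) \<union> (\<Union>i\<in>Z. sphere i (rad i))"

lemma compact_contour: "compact contour"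
  unfolding contour_def
  by (intro compact_Un compact_UN finite_Z compact_diff open_UN ballI compact_sphere open_ball)

lemma contour_resolvent: "contour \<inter> spectrumK T = {}"
proof -
  have "z \<notin> spectrumK T" if "z \<in> sphere 0 1" "z \<notin> (\<Union>i\<in>Z. ball i (rad i))" for z
  proof
    assume "z \<in> spectrumK T"
    then have "z \<in> Z" using that(1) by (simp add: Z_def)
    then show False using that(2) rad_pos[of z] by auto
  qed
  moreover have "z \<notin> spectrumK T" if "i \<in> Z" "z \<in> sphere i (rad i)" for i z
  proof
    assume "z \<in> spectrumK T"
    then have "z \<in> {i}" using rad(2)[OF that(1)] that(2) sphere_cball by blast
    then show False using that rad_pos[OF that(1)] by simp
  qed
  ultimately show ?thesis unfolding contour_def by blast
qed

text \<open>The Riesz projections of T' for the circles around the unit eigenvalues of T need not be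
spectral projections of single eigenvalues, but their ranges together contain every unit generalized
eigenvector of T' and are small perturbations of those of T.\<close>
lemma inertia_perturb:
  assumes C: "0 < C" "\<And>z x. z \<in> contour \<Longrightarrow> norm x \<le> C * norm (shiftK T z x)"
    and T': "J_unitary T'" "ess_S1_gapped T'"
    and d: "\<And>x. norm (T' x - T x) \<le> d * norm x" "0 \<le> d" "C * d \<le> 1 / 2"
    and \<eta>: "\<And>i. i \<in> Z \<Longrightarrow> rad i * (C * d * (2 * C)) \<le> \<eta>" "\<eta> \<le> 1 / 2"
    and W: "J.ortho_basis W (unit_eigenspace T)"
    and pos: "keeps_definite 1 {w\<in>W. J.q w > 0} (real (card Z) * \<eta>)"
    and neg: "keeps_definite (- 1) {w\<in>W. J.q w < 0} (real (card Z) * \<eta>)"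
    and a': "J.has_inertia (unit_eigenspace T') a' b'"
  shows "\<exists>c. card {w\<in>W. J.q w > 0} = a' + c \<and> card {w\<in>W. J.q w < 0} = b' + c"
proof -
  interpret T': ess_gapped_J_unitary T' by unfold_locales (use T' in auto)
  have inv: "bounded_invertibleK (shiftK T z)" if "z \<in> contour" for z
    using that contour_resolvent by (auto simp: spectrumK_def)
  have inv': "bounded_invertibleK (shiftK T' z)" "norm x \<le> 2 * C * norm (shiftK T' z x)" if z: "z \<in> contour" for z x
    by (rule bounded_invertibleK_perturb[OF inv[OF z] C(2)[OF z] C(1) boundedK_shiftK[OF T'.T(1)] _ d(3)],
        use d(1) in \<open>simp add: shiftK_def norm_minus_commute\<close>)+
  have pt: "i + of_real (rad i) * cis t \<in> contour" if "i \<in> Z" for i t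
    using that rad_pos[OF that] by (auto simp: contour_def dist_norm norm_mult intro!: bexI[of _ i])
  have circle: "riesz_circle T i (rad i) C" if "i \<in> Z" for i
    using rad_pos C inv pt that T(1) by (intro riesz_circle.intro) auto
  have circle': "riesz_circle T' i (rad i) (2 * C)" if "i \<in> Z" for i
    using rad_pos C inv' pt that T'.T(1) by (intro riesz_circle.intro) auto
  define P' where "P' i = riesz_proj_r T' i (rad i)" for i
  have lin': "clinearK (P' i)" if "i \<in> Z" for i
    unfolding P'_def by (rule riesz_circle.P_linear[OF circle'[OF that]])
  have close: "norm (P' i v - P i v) \<le> \<eta> * norm v" if i: "i \<in> Z" for i v
    unfolding P'_def
    by (rule order_trans[OF riesz_proj_r_difference[OF circle[OF i] circle'[OF i] d(1,2)]])
      (intro mult_right_mono \<eta>(1) i norm_ge_zero)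
  \<comment> \<open>The discs may overlap, so \<open>Q\<close> need not be a projection; it only has
    to be close to the identity on the unit eigenspace of \<open>T\<close>, where the unperturbed
    projections add up to the identity.\<close>
  define Q where "Q v = (\<Sum>i\<in>Z. P' i v)" for v
  have Qlin: "clinearK Q" unfolding Q_def by (rule clinearK_sum) (rule lin')
  have Qclose: "norm (Q x - x) \<le> real (card Z) * \<eta> * norm x" if "x \<in> unit_eigenspace T" for x
  proof -
    have "Q x - x = (\<Sum>i\<in>Z. P' i x - P i x)"
      by (simp add: Q_def sum_subtractf sum_P[OF that])
    also have "norm \<dots> \<le> (\<Sum>i\<in>Z. \<eta> * norm x)" by (rule sum_norm_le) (rule close)
    finally show ?thesis by simp
  qed
  define M where "M = K.span (\<Union>i\<in>Z. range (P' i))"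
  have M: "K.subspace M" by (simp add: M_def)
  have P'M: "P' i v \<in> M" if "i \<in> Z" for i v
    unfolding M_def using that by (intro K.span_base) blast
  have QM: "Q v \<in> M" for v unfolding Q_def using P'M by (intro K.subspace_sum[OF M])
  have MT': "T' x \<in> M" if "x \<in> M" for x
  proof -
    interpret L: Vector_Spaces.linear scaleK scaleK T' using T'.T(2) by (simp add: clinearK_iff_linear)
    have "M \<subseteq> {x. T' x \<in> M}"
      unfolding M_def
    proof (rule K.span_minimal[OF _ L.subspace_linear_preimage[OF M, unfolded M_def]], rule UN_least, rule subsetI)
      fix i v assume i: "i \<in> Z" and "v \<in> range (P' i)"
      then obtain u where "v = P' i u" by blast
      then have "T' v = P' i (T' u)" unfolding P'_def using riesz_circle.P_T[OF circle'[OF i]] by simp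
      then show "v \<in> {x. T' x \<in> K.span (\<Union>i\<in>Z. range (P' i))}" using P'M[OF i] by (simp add: M_def)
    qed
    with that show ?thesis by blast
  qed
  have "\<exists>F. finite F \<and> card F \<le> card (B i) \<and> range (P' i) \<subseteq> K.span F" if i: "i \<in> Z" for i
  proof (rule close_projection_range[OF P_facts(1)[OF i] lin'[OF i] _ _ B(1)[OF i]])
    show "P' i (P' i v) = P' i v" for v unfolding P'_def by (rule riesz_circle.P_idem[OF circle'[OF i]])
    show "norm (P' i v - P i v) \<le> 1 / 2 * norm v" for v
      using close[OF i, of v] mult_right_mono[OF \<eta>(2), of "norm v"] by simp
    show "range (P i) \<subseteq> K.span (B i)" using P_facts(2)[OF i] B(4)[OF i] by blast
  qed
  then obtain F where F: "\<And>i. i \<in> Z \<Longrightarrow> finite (F i) \<and> card (F i) \<le> card (B i) \<and> range (P' i) \<subseteq> K.span (F i)"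
    by metis
  have fF: "finite (\<Union>i\<in>Z. F i)" using finite_Z F by blast
  have MF: "M \<subseteq> K.span (\<Union>i\<in>Z. F i)"
    unfolding M_def
  proof (rule K.span_minimal[OF _ K.subspace_span], rule UN_least)
    fix i assume i: "i \<in> Z"
    have "K.span (F i) \<subseteq> K.span (\<Union>i\<in>Z. F i)" using i by (intro K.span_mono) blast
    then show "range (P' i) \<subseteq> K.span (\<Union>i\<in>Z. F i)" using F[OF i] by blast
  qed
  have "card (\<Union>i\<in>Z. F i) \<le> (\<Sum>i\<in>Z. card (F i))" by (rule card_UN_le[OF finite_Z])
  also have "\<dots> \<le> (\<Sum>i\<in>Z. card (B i))" by (rule sum_mono) (use F in blast)
  finally have cF: "card (\<Union>i\<in>Z. F i) \<le> card {w\<in>W. J.q w > 0} + card {w\<in>W. J.q w < 0}"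
    by (simp add: card_unit_basis[OF W])
  have fW: "finite W" using W by (simp add: J.ortho_basis_def)
  obtain p n where pn: "J.has_inertia M p n" using J.has_inertia_exists[OF M fF MF] by blast
  have span: "K.span {w\<in>W. J.q w > 0} \<subseteq> unit_eigenspace T" "K.span {w\<in>W. J.q w < 0} \<subseteq> unit_eigenspace T"
    using W K.span_mono[of "{w\<in>W. J.q w > 0}" W] K.span_mono[of "{w\<in>W. J.q w < 0}" W]
    by (auto simp: J.ortho_basis_def)
  have "\<forall>x\<in>K.span {w\<in>W. J.q w > 0}. norm (Q x - x) \<le> real (card Z) * \<eta> * norm x"
    using Qclose span(1) by blast
  note posQ = keeps_definiteD[OF pos Qlin this]
  have "\<forall>x\<in>K.span {w\<in>W. J.q w < 0}. norm (Q x - x) \<le> real (card Z) * \<eta> * norm x"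
    using Qclose span(2) by blast
  note negQ = keeps_definiteD[OF neg Qlin this]
  \<comment> \<open>The images under \<open>Q\<close> of the definite parts give the lower bounds,
    and \<open>cF\<close> gives the matching upper bound for the dimension.\<close>
  have inertia: "J.has_inertia M (card {w\<in>W. J.q w > 0}) (card {w\<in>W. J.q w < 0})"
  proof (rule J.has_inertiaI_maximal[OF pn fF MF cF])
    show "finite (Q ` {w\<in>W. J.q w > 0})" "finite (Q ` {w\<in>W. J.q w < 0})" using fW by auto
    show "Q ` {w\<in>W. J.q w > 0} \<subseteq> M" "Q ` {w\<in>W. J.q w < 0} \<subseteq> M" using QM by auto
    show "J.q x > 0" if "x \<in> K.span (Q ` {w\<in>W. J.q w > 0})" "x \<noteq> 0" for x
      using posQ(3)[OF that] by simp
    show "J.q x < 0" if "x \<in> K.span (Q ` {w\<in>W. J.q w < 0})" "x \<noteq> 0" for x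
      using negQ(3)[OF that] by simp
  qed (rule posQ negQ)+
  \<comment> \<open>A unit spectral point of \<open>T'\<close> avoids the contour, so it lies in one
    of the discs, whose projection fixes its generalized eigenvectors.\<close>
  have unit: "gen_eig T' \<nu> \<subseteq> M" if nu: "cmod \<nu> = 1" for \<nu>
  proof (cases "\<nu> \<in> spectrumK T'")
    case True
    then have "\<nu> \<notin> contour" using inv'(1) by (auto simp: spectrumK_def)
    then obtain i where i: "i \<in> Z" "\<nu> \<in> ball i (rad i)" using nu by (auto simp: contour_def)
    then have "cmod (\<nu> - i) < rad i" by (simp add: dist_norm norm_minus_commute)
    then have "P' i v = v" if "v \<in> gen_eig T' \<nu>" for v
      unfolding P'_def using riesz_circle.gen_eig_inside[OF circle'[OF i(1)] that] by blast
    then show ?thesis using P'M[OF i(1)] by (metis subsetI)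
  next
    case False
    then show ?thesis using gen_eig_outside_spectrum[OF T'.T(2) False] K.subspace_0[OF M] by blast
  qed
  \<comment> \<open>The inertia of \<open>M\<close> is computed a second time, now from
    \<open>T'\<close>: c counts hyperbolic pairs formed by eigenvalues off the circle.\<close>
  obtain c where "J.has_inertia M (a' + c) (b' + c)"
    using inertia_extend[OF T'(1) M MT' fF MF unit T'.nondegenerate_unit_eigenspace a'] by blast
  with J.has_inertia_unique[OF inertia] show ?thesis by blast
qed

lemma inertia_locally_constant:
  assumes ab: "J.has_inertia (unit_eigenspace T) a b"
  shows "\<exists>d>0. \<forall>T'. J_unitary T' \<longrightarrow> ess_S1_gapped T' \<longrightarrow> (\<forall>x. norm (T' x - T x) \<le> d * norm x) \<longrightarrow>
    (\<forall>a' b'. J.has_inertia (unit_eigenspace T') a' b' \<longrightarrow> int a' - int b' = int a - int b)"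
proof -
  obtain W where W: "J.ortho_basis W (unit_eigenspace T)"
    and a: "a = card {w\<in>W. J.q w > 0}" and b: "b = card {w\<in>W. J.q w < 0}"
    using ab by (auto simp: J.has_inertia_def)
  have orth: "\<And>x y. x \<in> W \<Longrightarrow> y \<in> W \<Longrightarrow> x \<noteq> y \<Longrightarrow> cinnerK x (Jop y) = 0"
    using W by (simp add: J.ortho_basis_def)
  have "\<exists>e>0. keeps_definite 1 {w\<in>W. J.q w > 0} e"
    by (rule definite_perturb[OF J.positive_part(1,2)[OF W]]) (simp_all add: orth)
  then obtain e1 where e1: "0 < e1" "keeps_definite 1 {w\<in>W. J.q w > 0} e1" by blast
  have "\<exists>e>0. keeps_definite (- 1) {w\<in>W. J.q w < 0} e"
    by (rule definite_perturb[OF J.negative_part(1,2)[OF W]]) (simp_all add: orth)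
  then obtain e2 where e2: "0 < e2" "keeps_definite (- 1) {w\<in>W. J.q w < 0} e2" by blast
  have "\<exists>C>0. \<forall>z\<in>contour. \<forall>x. norm x \<le> C * norm (shiftK T z x)"
    by (rule resolvent_bound_compact[OF T(1) compact_contour contour_resolvent])
  then obtain C where C: "0 < C" "\<And>z x. z \<in> contour \<Longrightarrow> norm x \<le> C * norm (shiftK T z x)" by blast
  \<comment> \<open>The summands 1 in \<open>n\<close> and \<open>R\<close> keep both positive when
    there is no unit spectrum. \<eta> is the error allowed for each projection, so that the card Z
    errors stay below \<open>e1\<close> and \<open>e2\<close>. The first bound in \<open>d\<close>
    preserves invertibility on the contour with constant 2 C, the second makes each projection error
    at most \<eta>.\<close>
  define n where "n = real (card Z) + 1"
  define \<eta> where "\<eta> = min (1 / 2) (min e1 e2 / n)"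
  define R where "R = (\<Sum>i\<in>Z. rad i) + 1"
  define d where "d = min (1 / (2 * C)) (\<eta> / (2 * C * C * R))"
  have n: "0 < n" by (simp add: n_def)
  have \<eta>: "0 < \<eta>" "\<eta> \<le> 1 / 2" using e1(1) e2(1) n by (simp_all only: \<eta>_def min.cobounded1 min_less_iff_conj, simp)
  have "\<eta> \<le> min e1 e2 / n" by (simp add: \<eta>_def)
  then have "n * \<eta> \<le> min e1 e2" using n by (simp add: field_simps)
  moreover have "real (card Z) * \<eta> \<le> n * \<eta>" using \<eta>(1) by (intro mult_right_mono) (auto simp: n_def)
  ultimately have n\<eta>: "real (card Z) * \<eta> \<le> e1" "real (card Z) * \<eta> \<le> e2" by auto
  have R: "rad i \<le> R" if "i \<in> Z" for i
    using member_le_sum[OF that _ finite_Z, of rad] rad_pos by (force simp: R_def less_imp_le)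
  have "0 \<le> (\<Sum>i\<in>Z. rad i)" by (rule sum_nonneg) (rule less_imp_le[OF rad_pos])
  then have R0: "0 < R" by (simp add: R_def)
  have d: "0 < d" "C * d \<le> 1 / 2"
    using C(1) \<eta>(1) R0 by (auto simp: d_def min_def field_simps)
  have rd: "rad i * (C * d * (2 * C)) \<le> \<eta>" if i: "i \<in> Z" for i
  proof -
    have "rad i * (C * d * (2 * C)) \<le> R * (C * d * (2 * C))"
      using R[OF i] C(1) d(1) by (intro mult_right_mono) auto
    also have "\<dots> = (2 * C * C * R) * d" by simp
    also have "\<dots> \<le> (2 * C * C * R) * (\<eta> / (2 * C * C * R))"
      using C(1) R0 by (intro mult_left_mono) (auto simp: d_def)
    also have "\<dots> = \<eta>" using C(1) R0 by simp
    finally show ?thesis .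
  qed
  show ?thesis
  proof (rule exI[of _ d], intro conjI allI impI d(1))
    fix T' a' b' assume T': "J_unitary T'" "ess_S1_gapped T'" "\<forall>x. norm (T' x - T x) \<le> d * norm x"
      and a'b': "J.has_inertia (unit_eigenspace T') a' b'"
    have "\<exists>c. card {w\<in>W. J.q w > 0} = a' + c \<and> card {w\<in>W. J.q w < 0} = b' + c"
    proof (rule inertia_perturb[OF C T'(1,2) _ _ d(2) rd \<eta>(2) W _ _ a'b'])
      show "norm (T' x - T x) \<le> d * norm x" for x using T'(3) by blast
      show "0 \<le> d" using d(1) by simp
      show "keeps_definite 1 {w\<in>W. J.q w > 0} (real (card Z) * \<eta>)"
        "keeps_definite (- 1) {w\<in>W. J.q w < 0} (real (card Z) * \<eta>)"
        by (rule keeps_definite_mono[OF e1(2) n\<eta>(1)], rule keeps_definite_mono[OF e2(2) n\<eta>(2)])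
    qed
    then show "int a' - int b' = int a - int b" unfolding a b by auto
  qed
qed

end

section \<open>The signature and its homotopy invariance\<close>

definition unit_signature :: "('h::chilbert \<times> 'h \<Rightarrow> 'h \<times> 'h) \<Rightarrow> int" where
  "unit_signature T = (THE k. \<exists>a b. J.has_inertia (unit_eigenspace T) a b \<and> k = int a - int b)"

lemma unit_signatureI:
  assumes "J.has_inertia (unit_eigenspace T) a b" shows "unit_signature T = int a - int b"
  unfolding unit_signature_def
proof (rule the_equality)
  fix k assume "\<exists>a b. J.has_inertia (unit_eigenspace T) a b \<and> k = int a - int b"
  then obtain a' b' where "J.has_inertia (unit_eigenspace T) a' b'" "k = int a' - int b'" by blast
  then show "k = int a - int b" using J.has_inertia_unique[OF assms] by auto
qed (use assms in blast)

text \<open>A repeated list entry would have inner product with itself both 0 and 1, so distinctness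
  follows from the index-wise orthonormality.\<close>

lemma frame_independent:
  assumes "is_frame E \<Phi>" shows "distinct \<Phi>" "K.independent (set \<Phi>)"
proof -
  have orth: "cinnerK (\<Phi> ! i) (\<Phi> ! j) = (if i = j then 1 else 0)" if "i < length \<Phi>" "j < length \<Phi>" for i j
    using assms that by (simp add: is_frame_def)
  show dist: "distinct \<Phi>"
    unfolding distinct_conv_nth using orth by (metis zero_neq_one)
  have orth': "cinnerK x y = (if x = y then 1 else 0)" if "x \<in> set \<Phi>" "y \<in> set \<Phi>" for x y
    using that orth nth_eq_iff_index_eq[OF dist] by (auto simp: in_set_conv_nth)
  show "K.independent (set \<Phi>)"
  proof (rule K.independent_if_scalars_zero)
    fix f x assume sum: "(\<Sum>y\<in>set \<Phi>. scaleK (f y) y) = 0" and x: "x \<in> set \<Phi>"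
    have "0 = cinnerK x (\<Sum>y\<in>set \<Phi>. scaleK (f y) y)" by (simp only: sum H.B_zero_right)
    also have "\<dots> = (\<Sum>y\<in>set \<Phi>. f y * cinnerK x y)" by (simp only: H.B_sum_right H.B_scale_right)
    also have "\<dots> = (\<Sum>y\<in>set \<Phi>. if y = x then f x else 0)"
      by (rule sum.cong) (use orth' x in auto)
    also have "\<dots> = f x" using x by simp
    finally show "f x = 0" by simp
  qed simp
qed

text \<open>The space of any admissible annulus is invariant, finite-dimensional and contains the
  unit eigenspace, so its inertia is (a + c, b + c). The excess c may depend on the width but
  cancels in the difference.\<close>

lemma sig_frame_eq_unit_signature:
  assumes JT: "J_unitary T" "ess_S1_gapped T" and h: "admissible_width T h" and \<Phi>: "is_frame (E_eq T h) \<Phi>"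
  shows "sig_frame \<Phi> = unit_signature T"
proof -
  interpret ess_gapped_J_unitary T by unfold_locales (use assms in auto)
  define S where "S = spectrumK T \<inter> annulus h"
  have "range (riesz_proj T \<mu>) = gen_eig T \<mu>" if "\<mu> \<in> S" for \<mu>
    by (rule discrete_spectrum_riesz[OF JT(1)[THEN J_unitaryD(1)]])
      (use that h in \<open>auto simp: S_def admissible_width_def\<close>)
  then have M: "E_eq T h = K.span (\<Union>\<mu>\<in>S. gen_eig T \<mu>)"
    unfolding E_eq_def cspanK_eq_span S_def by simp
  have sub: "K.subspace (E_eq T h)" by (simp add: M)
  have F: "E_eq T h \<subseteq> K.span (set \<Phi>)" "K.span (set \<Phi>) = E_eq T h"
    using \<Phi> by (simp_all add: is_frame_def cspanK_eq_span)
  have inv: "T x \<in> E_eq T h" if "x \<in> E_eq T h" for x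
  proof -
    interpret L: Vector_Spaces.linear scaleK scaleK T
      using J_unitaryD(2)[OF JT(1)] by (simp add: clinearK_iff_linear)
    have "E_eq T h \<subseteq> {x. T x \<in> E_eq T h}"
      unfolding M
    proof (rule K.span_minimal[OF _ L.subspace_linear_preimage[OF K.subspace_span]], rule UN_least, rule subsetI)
      fix \<mu> v assume \<mu>: "\<mu> \<in> S" and "v \<in> gen_eig T \<mu>"
      then have "T v \<in> gen_eig T \<mu>" by (intro gen_eig_commute[of T T] J_unitaryD(2)[OF JT(1)]) auto
      then show "v \<in> {x. T x \<in> K.span (\<Union>\<mu>\<in>S. gen_eig T \<mu>)}" using \<mu> by (auto intro: K.span_base)
    qed
    with that show ?thesis by blast
  qed
  have unit: "gen_eig T \<nu> \<subseteq> E_eq T h" if nu: "cmod \<nu> = 1" for \<nu>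
  proof (cases "\<nu> \<in> spectrumK T")
    case True
    have "\<nu> \<in> annulus h" using nu h by (simp add: annulus_def admissible_width_def)
    with True have "\<nu> \<in> S" by (simp add: S_def)
    then show ?thesis unfolding M using K.span_superset[of "\<Union>\<mu>\<in>S. gen_eig T \<mu>"] by blast
  next
    case False
    then show ?thesis
      using gen_eig_outside_spectrum[OF J_unitaryD(2)[OF JT(1)] False] K.subspace_0[OF sub] by blast
  qed
  obtain a b where ab: "J.has_inertia (unit_eigenspace T) a b" using unit_inertia_exists by blast
  obtain c where c: "J.has_inertia (E_eq T h) (a + c) (b + c)"
    using inertia_extend[OF JT(1) sub inv _ F(1) unit nondegenerate_unit_eigenspace ab] by auto
  have "J.has_inertia (E_eq T h) (nu_pos (gram_J \<Phi>)) (nu_neg (gram_J \<Phi>))"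
    using J.has_inertia_gram[OF frame_independent[OF \<Phi>]] by (simp add: F(2) J.gram_def gram_J_def)
  from J.has_inertia_unique[OF this c] show ?thesis
    by (simp add: sig_frame_def unit_signatureI[OF ab])
qed

text \<open>The supremum in \<open>opnormK\<close> dominates its values only over a set bounded
  above, which boundedness of the two operators ensures.\<close>

lemma norm_le_opnormK:
  assumes "boundedK T" "boundedK T'"
  shows "norm (T' x - T x) \<le> opnormK (\<lambda>x. T' x - T x) * norm x"
proof -
  define D where "D x = T' x - T x" for x
  have D: "bounded_linear D"
    unfolding D_def by (intro bounded_linear_sub boundedK_bounded_linear assms)
  obtain K where K: "0 < K" "\<And>x. norm (D x) \<le> norm x * K"
    using bounded_linear.pos_bounded[OF D] by blast
  have bdd: "bdd_above ((\<lambda>x. norm (D x)) ` {x. norm x \<le> 1})"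
  proof (rule bdd_aboveI2)
    fix x :: "'a \<times> 'a" assume "x \<in> {x. norm x \<le> 1}"
    then have "norm x * K \<le> 1 * K" using K(1) by (intro mult_right_mono) auto
    then show "norm (D x) \<le> K" using K(2)[of x] by simp
  qed
  have "norm (D x) \<le> opnormK D * norm x"
  proof (cases "x = 0")
    case True
    then show ?thesis using D by (simp add: linear_simps)
  next
    case False
    have "norm (D ((1 / norm x) *\<^sub>R x)) \<le> opnormK D"
      unfolding opnormK_def by (rule cSUP_upper[OF _ bdd]) (use False in simp)
    then show ?thesis using False D by (simp add: linear_simps field_simps)
  qed
  then show ?thesis by (simp add: D_def[abs_def])
qed

theorem theorem5p5:
  assumes sep: "separable_space TYPE('h::chilbert)"
  shows
    "(\<forall>T :: 'h \<times> 'h \<Rightarrow> 'h \<times> 'h. \<forall>h h' \<Phi> \<Phi>'.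
        J_unitary T \<and> ess_S1_gapped T \<and>
        admissible_width T h \<and> admissible_width T h' \<and>
        is_frame (E_eq T h) \<Phi> \<and> is_frame (E_eq T h') \<Phi>' \<longrightarrow>
        sig_frame \<Phi> = sig_frame \<Phi>')
   \<and>
    (\<forall>Tp :: real \<Rightarrow> 'h \<times> 'h \<Rightarrow> 'h \<times> 'h.
        (\<forall>s\<in>{0..1}. J_unitary (Tp s) \<and> ess_S1_gapped (Tp s)) \<and>
        (\<forall>s\<in>{0..1}. \<forall>\<epsilon>>0. \<exists>\<delta>>0. \<forall>s'\<in>{0..1}. \<bar>s' - s\<bar> < \<delta> \<longrightarrow>
            opnormK (\<lambda>x. Tp s' x - Tp s x) < \<epsilon>) \<longrightarrow>
        (\<forall>s\<in>{0..1}. \<forall>s'\<in>{0..1}. \<forall>h h' \<Phi> \<Phi>'.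
            admissible_width (Tp s) h \<and> admissible_width (Tp s') h' \<and>
            is_frame (E_eq (Tp s) h) \<Phi> \<and> is_frame (E_eq (Tp s') h') \<Phi>' \<longrightarrow>
            sig_frame \<Phi> = sig_frame \<Phi>'))"
proof (intro conjI allI impI)
  fix T :: "'h \<times> 'h \<Rightarrow> 'h \<times> 'h" and h h' \<Phi> \<Phi>'
  assume "J_unitary T \<and> ess_S1_gapped T \<and> admissible_width T h \<and> admissible_width T h' \<and>
    is_frame (E_eq T h) \<Phi> \<and> is_frame (E_eq T h') \<Phi>'"
  then have "sig_frame \<Phi> = unit_signature T" "sig_frame \<Phi>' = unit_signature T"
    using sig_frame_eq_unit_signature by blast+
  then show "sig_frame \<Phi> = sig_frame \<Phi>'" by simp
next
  fix Tp :: "real \<Rightarrow> 'h \<times> 'h \<Rightarrow> 'h \<times> 'h"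
  assume path: "(\<forall>s\<in>{0..1}. J_unitary (Tp s) \<and> ess_S1_gapped (Tp s)) \<and>
    (\<forall>s\<in>{0..1}. \<forall>\<epsilon>>0. \<exists>\<delta>>0. \<forall>s'\<in>{0..1}. \<bar>s' - s\<bar> < \<delta> \<longrightarrow> opnormK (\<lambda>x. Tp s' x - Tp s x) < \<epsilon>)"
  then have Tp: "J_unitary (Tp s)" "ess_S1_gapped (Tp s)" if "s \<in> {0..1}" for s using that by blast+
  \<comment> \<open>The unit interval is connected, so it suffices that the unit signature is
    constant near each parameter.\<close>
  have const: "(\<lambda>s. unit_signature (Tp s)) constant_on {0..1}"
  proof (rule locally_constant_imp_constant)
    fix s :: real assume s: "s \<in> {0..1}"
    interpret ess_gapped_J_unitary "Tp s" by unfold_locales (use Tp s in auto)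
    obtain a b where ab: "J.has_inertia (unit_eigenspace (Tp s)) a b" using unit_inertia_exists by blast
    obtain d where d: "0 < d" "\<forall>T'. J_unitary T' \<longrightarrow> ess_S1_gapped T' \<longrightarrow> (\<forall>x. norm (T' x - Tp s x) \<le> d * norm x) \<longrightarrow>
        (\<forall>a' b'. J.has_inertia (unit_eigenspace T') a' b' \<longrightarrow> int a' - int b' = int a - int b)"
      using inertia_locally_constant[OF ab] by blast
    obtain \<delta> where \<delta>: "0 < \<delta>" "\<And>s'. s' \<in> {0..1} \<Longrightarrow> \<bar>s' - s\<bar> < \<delta> \<Longrightarrow> opnormK (\<lambda>x. Tp s' x - Tp s x) < d"
      using path s d(1) by blast
    have "unit_signature (Tp s') = unit_signature (Tp s)" if s': "s' \<in> {0..1} \<inter> ball s \<delta>" for s'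
    proof -
      have s'01: "s' \<in> {0..1}" and "\<bar>s' - s\<bar> < \<delta>" using s' by (auto simp: dist_real_def)
      then have op: "opnormK (\<lambda>x. Tp s' x - Tp s x) \<le> d" using \<delta>(2) by (simp add: less_imp_le)
      interpret T': ess_gapped_J_unitary "Tp s'" by unfold_locales (use Tp s'01 in auto)
      obtain a' b' where a'b': "J.has_inertia (unit_eigenspace (Tp s')) a' b'" using T'.unit_inertia_exists by blast
      have "norm (Tp s' x - Tp s x) \<le> d * norm x" for x
        by (rule order_trans[OF norm_le_opnormK[OF T(1) T'.T(1)] mult_right_mono[OF op norm_ge_zero]])
      then have "int a' - int b' = int a - int b" using d(2) T'.J T'.gapped a'b' by blast
      then show ?thesis by (simp add: unit_signatureI[OF ab] unit_signatureI[OF a'b'])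
    qed
    moreover have "openin (top_of_set {0..1}) ({0..1} \<inter> ball s \<delta>)" by (rule openin_open_Int) simp
    moreover have "s \<in> {0..1} \<inter> ball s \<delta>" using s \<delta>(1) by simp
    ultimately show "\<exists>S. openin (top_of_set {0..1}) S \<and> s \<in> S \<and> (\<forall>s'\<in>S. unit_signature (Tp s') = unit_signature (Tp s))"
      by blast
  qed simp
  show "\<forall>s\<in>{0..1}. \<forall>s'\<in>{0..1}. \<forall>h h' \<Phi> \<Phi>'.
      admissible_width (Tp s) h \<and> admissible_width (Tp s') h' \<and>
      is_frame (E_eq (Tp s) h) \<Phi> \<and> is_frame (E_eq (Tp s') h') \<Phi>' \<longrightarrow> sig_frame \<Phi> = sig_frame \<Phi>'"
  proof (intro ballI allI impI)
    fix s s' :: real and h h' \<Phi> \<Phi>' assume s: "s \<in> {0..1}" "s' \<in> {0..1}"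
      and *: "admissible_width (Tp s) h \<and> admissible_width (Tp s') h' \<and>
        is_frame (E_eq (Tp s) h) \<Phi> \<and> is_frame (E_eq (Tp s') h') \<Phi>'"
    have "sig_frame \<Phi> = unit_signature (Tp s)" "sig_frame \<Phi>' = unit_signature (Tp s')"
      using sig_frame_eq_unit_signature[OF Tp] s * by blast+
    moreover have "unit_signature (Tp s) = unit_signature (Tp s')"
      using const s unfolding constant_on_def by metis
    ultimately show "sig_frame \<Phi> = sig_frame \<Phi>'" by simp
  qed
qed

end
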